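(* Let $n\ge 1$ and let $\lambda=(\lambda_1,\lambda_2,2^\ell,1^{n-2\ell-\lambda_1-\lambda_2})\vdash n$ with $\lambda_1\geq\lambda_2\geq 2$ and $\ell\ge 0$ (a partition contained in a double hook but not in a hook). Let $m:=n-2\ell-\lambda_1-\lambda_2+2$. If $\lambda_1=\lambda_2$, then \[ \langle \mathrm{Frob}(R_n^{(0,2)};u,v), s_\lambda\rangle = (uv)^{\ell+\lambda_2-1}\bigl(uv[m-2]_{u,v}+[m]_{u,v}+[m-1]_{u,v}\bigr). \] If $\lambda_1>\lambda_2$, then \[ \langle \mathrm{Frob}(R_n^{(0,2)};u,v), s_\lambda\rangle = (uv)^{\ell+\lambda_2-1}\bigl(uv[m-1]_{u,v}+uv[m-2]_{u,v}+[m]_{u,v}+[m-1]_{u,v}\bigr). \]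
   Context: Let $\mathbb{Q}[\boldsymbol{\theta}_n,\boldsymbol{\xi}_n]$ be the $\mathbb{Q}$-algebra generated by $2n$ pairwise anticommuting variables $\theta_1,\dots,\theta_n,\xi_1,\dots,\xi_n$ (the exterior algebra on them), with $\mathfrak{S}_n$ acting diagonally by permuting indices. The diagonal fermionic coinvariant ring $R_n^{(0,2)}$ is its quotient by the ideal generated by all $\mathfrak{S}_n$-invariant elements with zero constant term; it is bigraded, $(R_n^{(0,2)})_{i,j}$ being spanned by images of monomials with $i$ variables $\theta$ and $j$ variables $\xi$. $\mathrm{Frob}(R_n^{(0,2)};u,v)=\sum_{i,j}F\,\mathrm{char}((R_n^{(0,2)})_{i,j})u^iv^j$ with $F$ the Frobenius characteristic, and $\langle\cdot,\cdot\rangle$ is the Hall inner product, so $\langle \mathrm{Frob}(R_n^{(0,2)};u,v), s_\lambda\rangle$ is the bigraded multiplicity of the irreducible $\mathfrak{S}_n$-representation indexed by $\lambda$. Notation: $[k]_{u,v}:=u^{k-1}+u^{k-2}v+\cdots+v^{k-1}$ for $k\ge1$, and $[k]_{u,v}:=0$ for $k\le 0$. *)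

theory Defs
  imports Main "HOL-Combinatorics.Permutations" "HOL-Library.Function_Algebras"
    "HOL-Library.FuncSet" "HOL-Computational_Algebra.Polynomial"
begin

text \<open>Variables are encoded as natural numbers: theta_(i+1) is i and xi_(i+1) is n+i,
  for i < n.  An element of the exterior algebra is a function assigning to each
  finite set A of variables the coefficient of the monomial x_A (the product of the
  variables of A in increasing order).  The algebra consists of the functions
  supported on subsets of {0..<2n}.\<close>

type_synonym ext = "nat set \<Rightarrow> rat"

definition scl :: "rat \<Rightarrow> ext \<Rightarrow> ext" where
  "scl c f = (\<lambda>A. c * f A)"

definition ext_alg :: "nat \<Rightarrow> ext set" where
  "ext_alg n = {f. \<forall>A. f A \<noteq> 0 \<longrightarrow> A \<subseteq> {0..<2*n}}"

text \<open>x_A * x_B = (-1)^(number of pairs a in A, b in B with a > b) x_(A union B)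
  when A, B are disjoint, and 0 otherwise.\<close>

definition mult_sign :: "nat set \<Rightarrow> nat set \<Rightarrow> rat" where
  "mult_sign A B = (-1) ^ card {(a, b). a \<in> A \<and> b \<in> B \<and> b < a}"

definition ext_mult :: "ext \<Rightarrow> ext \<Rightarrow> ext" where
  "ext_mult f g = (\<lambda>U. \<Sum>A\<in>Pow U. mult_sign A (U - A) * f A * g (U - A))"

definition var_perm :: "nat \<Rightarrow> (nat \<Rightarrow> nat) \<Rightarrow> nat \<Rightarrow> nat" where
  "var_perm n \<sigma> v = (if v < n then \<sigma> v else n + \<sigma> (v - n))"

text \<open>sigma . x_A = (product of x_(tau a), a in A increasing) = (-1)^inv x_(tau A).\<close>

definition act_sign :: "(nat \<Rightarrow> nat) \<Rightarrow> nat set \<Rightarrow> rat" where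
  "act_sign \<tau> A = (-1) ^ card {(a, b). a \<in> A \<and> b \<in> A \<and> a < b \<and> \<tau> b < \<tau> a}"

definition act :: "nat \<Rightarrow> (nat \<Rightarrow> nat) \<Rightarrow> ext \<Rightarrow> ext" where
  "act n \<sigma> f = (\<lambda>U. \<Sum>A\<in>{A. A \<subseteq> {0..<2*n} \<and> var_perm n \<sigma> ` A = U}.
       act_sign (var_perm n \<sigma>) A * f A)"

definition invariants0 :: "nat \<Rightarrow> ext set" where
  "invariants0 n = {f \<in> ext_alg n. f {} = 0 \<and>
      (\<forall>\<sigma>. \<sigma> permutes {0..<n} \<longrightarrow> act n \<sigma> f = f)}"

definition coinv_ideal :: "nat \<Rightarrow> ext set" where
  "coinv_ideal n = module.span scl
     {ext_mult (ext_mult a f) b | a f b. a \<in> ext_alg n \<and> f \<in> invariants0 n \<and> b \<in> ext_alg n}"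

definition bideg :: "nat \<Rightarrow> nat \<Rightarrow> nat \<Rightarrow> ext set" where
  "bideg n i j = {f \<in> ext_alg n. \<forall>A. f A \<noteq> 0 \<longrightarrow>
      card (A \<inter> {0..<n}) = i \<and> card (A \<inter> {n..<2*n}) = j}"

text \<open>Trace of the map induced by T on the quotient W / U (U a subspace of W, both
  T-stable): choose a basis C of U extended to a basis B of W; the images of B - C
  form a basis of W / U.\<close>

definition quot_trace :: "ext set \<Rightarrow> ext set \<Rightarrow> (ext \<Rightarrow> ext) \<Rightarrow> rat" where
  "quot_trace W U T = (let (C, B) = (SOME (C, B). C \<subseteq> B \<and> B \<subseteq> W \<and>
        \<not> module.dependent scl B \<and> module.span scl B = W \<and>
        module.span scl C = U) in
     (\<Sum>b\<in>B - C. module.representation scl B (T b) b))"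

text \<open>Character of S_n on (R_n^(0,2))_(i,j) = image of bideg n i j in the quotient,
  i.e. bideg n i j / (coinv_ideal n \<inter> bideg n i j).\<close>

definition coinv_char :: "nat \<Rightarrow> nat \<Rightarrow> nat \<Rightarrow> (nat \<Rightarrow> nat) \<Rightarrow> rat" where
  "coinv_char n i j \<sigma> = quot_trace (bideg n i j) (coinv_ideal n \<inter> bideg n i j) (act n \<sigma>)"

definition perm_cycles :: "nat \<Rightarrow> (nat \<Rightarrow> nat) \<Rightarrow> nat set set" where
  "perm_cycles n \<sigma> = (\<lambda>x. {(\<sigma> ^^ k) x | k. True}) ` {0..<n}"

text \<open>Coefficient of x^alpha (x = (x_0,..,x_(k-1))) in the power sum product
  p_(cycle type of sigma) = prod over cycles c of (sum_r x_r^|c|).\<close>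

definition psum_coeff :: "nat \<Rightarrow> (nat \<Rightarrow> nat) \<Rightarrow> nat \<Rightarrow> (nat \<Rightarrow> int) \<Rightarrow> nat" where
  "psum_coeff n \<sigma> k \<alpha> = card {f \<in> perm_cycles n \<sigma> \<rightarrow>\<^sub>E {0..<k}.
      \<forall>r<k. int (\<Sum>c\<in>{c \<in> perm_cycles n \<sigma>. f c = r}. card c) = \<alpha> r}"

text \<open>chi^lambda(sigma) = <p_mu, s_lambda> = [x^(lambda+delta)] a_delta p_mu
  (Frobenius formula, k = length of lambda, delta = (k-1,...,1,0)), where
  a_delta = sum over w of sign(w) prod_r x_r^(delta_(w r)).\<close>

definition irr_char :: "nat list \<Rightarrow> nat \<Rightarrow> (nat \<Rightarrow> nat) \<Rightarrow> rat" where
  "irr_char lam n \<sigma> = (let k = length lam in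
     (\<Sum>w | w permutes {0..<k}. of_int (sign w) *
        of_nat (psum_coeff n \<sigma> k
          (\<lambda>r. int (lam ! r) + int (k - 1 - r) - int (k - 1 - w r)))))"

text \<open>The Hall inner product <Frob((R_n)_(i,j)), s_lambda> = (1/n!) sum chi_V chi^lambda.\<close>

definition coinv_mult :: "nat \<Rightarrow> nat list \<Rightarrow> nat \<Rightarrow> nat \<Rightarrow> rat" where
  "coinv_mult n lam i j = (\<Sum>\<sigma> | \<sigma> permutes {0..<n}. coinv_char n i j \<sigma> * irr_char lam n \<sigma>)
       / of_nat (fact n)"

definition U :: "rat poly poly" where "U = [:[:0, 1:]:]"
definition V :: "rat poly poly" where "V = [:0, 1:]"
definition const2 :: "rat \<Rightarrow> rat poly poly" where "const2 c = [:[:c:]:]"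

text \<open>[k]_(u,v) = u^(k-1) + u^(k-2) v + ... + v^(k-1), and 0 for k \<le> 0.\<close>

definition qint :: "int \<Rightarrow> rat poly poly" where
  "qint k = (\<Sum>a\<in>{0..<nat k}. U ^ a * V ^ (nat k - 1 - a))"

text \<open><Frob(R_n^(0,2); u, v), s_lambda> (bidegrees are at most n in each variable).\<close>

definition frob_coeff :: "nat \<Rightarrow> nat list \<Rightarrow> rat poly poly" where
  "frob_coeff n lam = (\<Sum>i\<le>n. \<Sum>j\<le>n. const2 (coinv_mult n lam i j) * U ^ i * V ^ j)"

end

theory Submission
  imports Defs "Jordan_Normal_Form.Determinant" "HOL-Combinatorics.Cycles"
begin

text \<open>
  Let \<open>p = \<Sum> \<theta>\<^sub>i\<close>, \<open>q = \<Sum> \<xi>\<^sub>i\<close> and \<open>\<omega> = \<Sum> \<theta>\<^sub>i \<xi>\<^sub>i\<close>. Modulo \<open>p\<close> and \<open>q\<close>, multiplication by \<open>\<omega>\<close>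
  and its adjoint contraction generate an equivariant action of \<open>sl\<^sub>2\<close>, so \<open>\<omega>\<close> has the Lefschetz
  property and the character of the quotient by \<open>(p, q, \<omega>)\<close> in bidegree \<open>(i, j)\<close> is
  \<open>c\<^sub>i\<^sub>j - c\<^sub>i\<^sub>-\<^sub>1\<^sub>,\<^sub>j\<^sub>-\<^sub>1\<close> for \<open>i + j < n\<close> and zero otherwise, where
  \<open>\<Sum> c\<^sub>i\<^sub>j u\<^sup>i v\<^sup>j\<close> is the graded character of the exterior algebra divided by \<open>(1 + u) (1 + v)\<close>.
  A signed orbit count pairs the character of the exterior algebra with the irreducible character
  of shape \<open>\<lambda>\<close> and gives the Jacobi-Trudi determinant of the series
  \<open>(1 + u t) (1 + v t) / ((1 - t) (1 - u v t))\<close>. Unimodular column operations make this determinant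
  block triangular for a double hook, which evaluates it. For \<open>\<lambda> = (n)\<close> the same computation shows that
  the quotient by \<open>(p, q, \<omega>)\<close> has no invariants of positive degree, so \<open>(p, q, \<omega>)\<close> already
  is the coinvariant ideal.
\<close>

text \<open>Only monomial bases are computed with. A quotient character is obtained as the trace, on
  a whole bidegree of the exterior algebra, of the permutation followed by an operator that kills
  the ideal and is the identity modulo it. The division by \<open>(1 + u) (1 + v)\<close> and the
  subtraction of the shifted term are then instances of cyclicity of the trace between two
  bidegrees. The element \<open>om\<close> does not commute with the contractions along
  \<open>p\<close> and \<open>q\<close>, so it is corrected by \<open>mP * mQ / n\<close>; the
  correction turns the weight \<open>n - i - j\<close> into \<open>n - 1 - i - j\<close>, which is
  why the quotient stops at \<open>i + j < n\<close>. This cut also separates the two cases of the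
  theorem: up to terms of degree at least \<open>n\<close> the series is
  \<open>B (1 + u) (1 + v)\<close> with \<open>B\<close> homogeneous of degree
  \<open>n - 2 - (lambda_1 - lambda_2)\<close>, so \<open>u v B\<close> lands in degree
  \<open>n\<close> exactly when the first two parts are equal.\<close>

lemma sum_fun_eval: "(\<Sum>x\<in>S. f x) A = (\<Sum>x\<in>S. f x A)"
  for f :: "'a \<Rightarrow> 'b \<Rightarrow> 'c::comm_monoid_add"
  by (induction S rule: infinite_finite_induct) auto

interpretation scl: vector_space scl
  by unfold_locales (auto simp: scl_def fun_eq_iff algebra_simps)

lemma scl_apply [simp]: "scl c f A = c * f A"
  by (simp add: scl_def)

section \<open>Linear operators and traces\<close>

text \<open>Bundling linearity into a type makes the operators a ring, so that commutation relations
  become ring equations usable as rewrite rules.\<close>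

typedef lop = "{T :: ext \<Rightarrow> ext. (\<forall>f g. T (f + g) = T f + T g) \<and> (\<forall>c f. T (scl c f) = scl c (T f))}"
  morphisms app Lop
  by (rule exI[of _ id]) simp

setup_lifting type_definition_lop

lemma app_add: "app T (f + g) = app T f + app T g"
  and app_scl: "app T (scl c f) = scl c (app T f)"
  by (transfer, simp)+

lemma app_0 [simp]: "app T 0 = 0"
  using app_scl[of T 0 0] by (simp add: scl.scale_zero_left)

lemma app_sum: "app T (\<Sum>x\<in>S. f x) = (\<Sum>x\<in>S. app T (f x))"
proof (induction S rule: infinite_finite_induct)
  case (insert x S)
  then show ?case by (simp only: sum.insert app_add not_False_eq_True)
qed (simp_all only: sum.infinite sum.empty app_0 not_False_eq_True)

lemma app_uminus: "app T (- f) = - app T f"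
  using app_add[of T "- f" f] by (simp add: eq_neg_iff_add_eq_0)

lemma app_diff: "app T (f - g) = app T f - app T g"
  using app_add[of T f "- g"] by (simp add: app_uminus)

lemma lop_eqI: "(\<And>f. app S f = app T f) \<Longrightarrow> S = T"
  by (transfer, auto)

instantiation lop :: ring_1
begin

lift_definition zero_lop :: lop is "\<lambda>f. 0"
  by (simp add: fun_eq_iff)
lift_definition one_lop :: lop is "\<lambda>f. f" by simp
lift_definition plus_lop :: "lop \<Rightarrow> lop \<Rightarrow> lop" is "\<lambda>S T f. S f + T f"
  by (simp add: scl.scale_right_distrib)
lift_definition uminus_lop :: "lop \<Rightarrow> lop" is "\<lambda>S f. - S f"
  by simp
lift_definition minus_lop :: "lop \<Rightarrow> lop \<Rightarrow> lop" is "\<lambda>S T f. S f - T f"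
  by (simp add: scl.scale_right_diff_distrib)
lift_definition times_lop :: "lop \<Rightarrow> lop \<Rightarrow> lop" is "\<lambda>S T f. S (T f)"
  by simp

instance
proof
  show "(0::lop) \<noteq> 1"
  proof
    assume "(0::lop) = 1"
    then have "app 0 (\<lambda>_. 1) = app 1 (\<lambda>_. 1)" by simp
    then have "(0::ext) = (\<lambda>_. 1)" by (simp add: zero_lop.rep_eq one_lop.rep_eq)
    then show False by (simp add: fun_eq_iff)
  qed
qed (transfer, simp add: fun_eq_iff algebra_simps)+

end

lemmas app_simps [simp] = zero_lop.rep_eq one_lop.rep_eq plus_lop.rep_eq uminus_lop.rep_eq
  minus_lop.rep_eq times_lop.rep_eq

lift_definition scal :: "rat \<Rightarrow> lop" is scl
  by (simp add: scl.scale_right_distrib scl.scale_left_commute)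

lemma app_scal [simp]: "app (scal c) f = scl c f"
  by (simp add: scal.rep_eq)

lemma scal_comm: "T * scal c = scal c * T"
  by (rule lop_eqI) (simp add: app_scl)

lemma scal_comm2: "T * (scal c * S) = scal c * (T * S)"
  by (simp add: scal_comm flip: mult.assoc)

lemma scal_mult: "scal a * scal b = scal (a * b)"
  and scal_mult2: "scal a * (scal b * T) = scal (a * b) * T"
  and scal_add: "scal a + scal b = scal (a + b)"
  by (rule lop_eqI, simp add: scl.scale_left_distrib)+

lemma scal_1 [simp]: "scal 1 = 1" and scal_0 [simp]: "scal 0 = 0"
  by (rule lop_eqI, simp)+

lemma scal_of_nat: "scal (of_nat n) = of_nat n"
  by (induction n) (auto simp flip: scal_add)

lemma app_lop_sum: "app (\<Sum>x\<in>S. T x) f = (\<Sum>x\<in>S. app (T x) f)"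
  by (induction S rule: infinite_finite_induct) auto

lemma app_power_Suc: "app (T ^ Suc k) f = app T (app (T ^ k) f)"
  "app (T ^ Suc k) f = app (T ^ k) (app T f)"
  by (simp, simp only: power_Suc2 times_lop.rep_eq)

section \<open>Monomial basis and coordinate traces\<close>

definition xmon :: "nat set \<Rightarrow> ext" where
  "xmon A = (\<lambda>B. if B = A then 1 else 0)"

definition supp_in :: "nat set set \<Rightarrow> ext set" where
  "supp_in \<A> = {f. \<forall>A. f A \<noteq> 0 \<longrightarrow> A \<in> \<A>}"

text \<open>Only diagonal coefficients indexed by \<open>\<A>\<close> are read, so this makes sense
  for every operator; it is the trace on \<open>supp_in \<A>\<close> when the operator preserves
  that space.\<close>

definition lop_tr :: "nat set set \<Rightarrow> lop \<Rightarrow> rat" where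
  "lop_tr \<A> T = (\<Sum>A\<in>\<A>. app T (xmon A) A)"

lemma xmon_in [simp]: "A \<in> \<A> \<Longrightarrow> xmon A \<in> supp_in \<A>"
  by (auto simp: xmon_def supp_in_def)

lemma supp_in_expand:
  assumes "finite \<A>" "f \<in> supp_in \<A>"
  shows "f = (\<Sum>A\<in>\<A>. scl (f A) (xmon A))"
proof
  fix B
  have "(\<Sum>A\<in>\<A>. f A * xmon A B) = (\<Sum>A\<in>\<A>. if A = B then f A else 0)"
    by (intro sum.cong) (auto simp: xmon_def)
  then show "f B = (\<Sum>A\<in>\<A>. scl (f A) (xmon A)) B"
    using assms by (auto simp: sum_fun_eval supp_in_def)
qed

lemma subspace_supp_in: "scl.subspace (supp_in \<A>)"
  unfolding supp_in_def
  by (auto simp: scl.subspace_def) (metis add_0)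

lemma span_xmon:
  assumes "finite \<A>" shows "scl.span (xmon ` \<A>) = supp_in \<A>"
proof
  show "scl.span (xmon ` \<A>) \<subseteq> supp_in \<A>"
    by (rule scl.span_minimal) (auto simp: subspace_supp_in)
  show "supp_in \<A> \<subseteq> scl.span (xmon ` \<A>)"
  proof
    fix f assume "f \<in> supp_in \<A>"
    then have "f = (\<Sum>A\<in>\<A>. scl (f A) (xmon A))" by (rule supp_in_expand[OF assms])
    also have "\<dots> \<in> scl.span (xmon ` \<A>)"
      by (intro scl.span_sum scl.span_scale scl.span_base) auto
    finally show "f \<in> scl.span (xmon ` \<A>)" .
  qed
qed

lemma tr_cong:
  "(\<And>f. f \<in> supp_in \<A> \<Longrightarrow> app S f = app T f) \<Longrightarrow> lop_tr \<A> S = lop_tr \<A> T"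
  unfolding lop_tr_def by (intro sum.cong) auto

lemma tr_add: "lop_tr \<A> (S + T) = lop_tr \<A> S + lop_tr \<A> T"
  by (simp add: lop_tr_def sum.distrib)

lemma tr_diff: "lop_tr \<A> (S - T) = lop_tr \<A> S - lop_tr \<A> T"
  by (simp add: lop_tr_def sum_subtractf)

lemma tr_scal: "lop_tr \<A> (scal c * T) = c * lop_tr \<A> T"
  by (simp add: lop_tr_def sum_distrib_left)

lemma tr_sum: "lop_tr \<A> (\<Sum>x\<in>S. T x) = (\<Sum>x\<in>S. lop_tr \<A> (T x))"
  by (simp add: lop_tr_def app_lop_sum sum_fun_eval) (rule sum.swap)

lemma tr_expand:
  assumes "finite \<B>" and S: "\<And>f. f \<in> supp_in \<A> \<Longrightarrow> app S f \<in> supp_in \<B>"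
  shows "lop_tr \<A> (T * S) = (\<Sum>A\<in>\<A>. \<Sum>B\<in>\<B>. app S (xmon A) B * app T (xmon B) A)"
proof -
  have "app T (app S (xmon A)) A = (\<Sum>B\<in>\<B>. app S (xmon A) B * app T (xmon B) A)"
    if "A \<in> \<A>" for A
  proof -
    have "app S (xmon A) \<in> supp_in \<B>"
      using that by (intro assms) auto
    from arg_cong[OF supp_in_expand[OF assms(1) this], of "app T"]
    have "app T (app S (xmon A)) = (\<Sum>B\<in>\<B>. scl (app S (xmon A) B) (app T (xmon B)))"
      by (simp only: app_sum app_scl)
    then show ?thesis by (simp add: sum_fun_eval)
  qed
  then show ?thesis by (simp add: lop_tr_def)
qed

text \<open>\<open>S\<close> and \<open>T\<close> run between two different coordinate spaces, later
  two bidegrees: this is the device that carries a trace from one bidegree to another.\<close>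

lemma tr_cyclic:
  assumes "finite \<A>" "finite \<B>"
    and "\<And>f. f \<in> supp_in \<A> \<Longrightarrow> app S f \<in> supp_in \<B>"
    and "\<And>f. f \<in> supp_in \<B> \<Longrightarrow> app T f \<in> supp_in \<A>"
  shows "lop_tr \<A> (T * S) = lop_tr \<B> (S * T)"
  using tr_expand[OF assms(2,3), where T = T] tr_expand[OF assms(1,4), where T = S]
  by (simp add: sum.swap[of _ \<B> \<A>] mult.commute)

text \<open>Expand \<open>b\<close> in monomials and the image of each monomial in \<open>B\<close>,
  then exchange the two sums. This connects the basis picked by choice in \<open>quot_trace\<close>
  with monomial coefficients.\<close>

lemma tr_basis:
  assumes fin: "finite \<A>" and T: "\<And>f. f \<in> supp_in \<A> \<Longrightarrow> app T f \<in> supp_in \<A>"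
    and B: "scl.independent B" "scl.span B = supp_in \<A>"
  shows "(\<Sum>b\<in>B. scl.representation B (app T b) b) = lop_tr \<A> T"
proof -
  have Bs: "B \<subseteq> supp_in \<A>" using B(2) scl.span_superset by blast
  have finB: "finite B"
    using scl.independent_span_bound[of "xmon ` \<A>" B] fin B Bs by (auto simp: span_xmon)
  have rep: "scl.representation B (app T b) b =
      (\<Sum>A\<in>\<A>. b A * scl.representation B (app T (xmon A)) b)" if "b \<in> B" for b
  proof -
    have "b \<in> supp_in \<A>" using that Bs by blast
    from arg_cong[OF supp_in_expand[OF fin this], of "app T"]
    have "app T b = (\<Sum>A\<in>\<A>. scl (b A) (app T (xmon A)))"
      by (simp only: app_sum app_scl)
    moreover have "app T (xmon A) \<in> scl.span B" if "A \<in> \<A>" for A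
      using T that B(2) by simp
    ultimately show ?thesis
      using scl.representation_sum[OF B(1), of \<A> "\<lambda>A. scl (b A) (app T (xmon A))"]
      by (simp add: scl.representation_scale[OF B(1)] scl.span_scale)
  qed
  have "(\<Sum>b\<in>B. scl.representation B (app T b) b) =
      (\<Sum>A\<in>\<A>. \<Sum>b\<in>B. b A * scl.representation B (app T (xmon A)) b)"
    by (simp add: rep sum.swap[of _ B])
  also have "\<dots> = (\<Sum>A\<in>\<A>. app T (xmon A) A)"
  proof (rule sum.cong[OF refl])
    fix A assume "A \<in> \<A>"
    then have "(\<Sum>b\<in>B. scl (scl.representation B (app T (xmon A)) b) b) = app T (xmon A)"
      using scl.sum_representation_eq[OF B(1), of "app T (xmon A)" B] T B(2) finB by auto
    from fun_cong[OF this, of A]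
    show "(\<Sum>b\<in>B. b A * scl.representation B (app T (xmon A)) b) = app T (xmon A) A"
      by (simp add: sum_fun_eval mult.commute)
  qed
  finally show ?thesis by (simp add: lop_tr_def)
qed

section \<open>Traces on quotients and traces of idempotents\<close>

lemma tr_quotient_basis:
  assumes fin: "finite \<A>" and F: "\<And>f. f \<in> supp_in \<A> \<Longrightarrow> app F f \<in> supp_in \<A>"
    and B: "C \<subseteq> B" "B \<subseteq> supp_in \<A>" "scl.independent B" "scl.span B = supp_in \<A>" "scl.span C = Z"
    and FU: "\<And>f. f \<in> Z \<Longrightarrow> app F f = 0"
  shows "lop_tr \<A> F = (\<Sum>b\<in>B - C. scl.representation B (app F b) b)"
proof -
  have "finite B"
    using scl.independent_span_bound[of "xmon ` \<A>" B] fin B by (auto simp: span_xmon)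
  moreover have "scl.representation B (app F b) b = 0" if "b \<in> C" for b
  proof -
    have "app F b = 0" using that FU[of b] B(5) scl.span_base by blast
    then show ?thesis by (simp only: scl.representation_zero)
  qed
  ultimately have "(\<Sum>b\<in>B - C. scl.representation B (app F b) b) =
      (\<Sum>b\<in>B. scl.representation B (app F b) b)"
    using B by (intro sum.mono_neutral_left) auto
  then show ?thesis using tr_basis[OF fin F B(3,4)] by simp
qed

lemma basis_extension_exists:
  assumes "scl.subspace W" "scl.subspace Z" "Z \<subseteq> W"
  shows "\<exists>C B. C \<subseteq> B \<and> B \<subseteq> W \<and> scl.independent B \<and> scl.span B = W \<and> scl.span C = Z"
proof -
  obtain C where C: "C \<subseteq> Z" "scl.independent C" "scl.span C = Z"
    using scl.maximal_independent_subset[of Z] assms(2)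
    by (metis scl.span_eq_iff scl.span_mono subset_antisym)
  then obtain B where "C \<subseteq> B" "B \<subseteq> W" "scl.independent B" "W \<subseteq> scl.span B"
    using scl.maximal_independent_subset_extend[of C W] assms by blast
  with C show ?thesis
    using assms(1) by (metis scl.span_minimal subset_antisym)
qed

text \<open>The difference has coordinates only in \<open>C\<close>, so the coordinates that survive
  in the quotient agree.\<close>

lemma representation_mod:
  assumes "C \<subseteq> B" "scl.independent B" "f - g \<in> scl.span C" "f \<in> scl.span B" "b \<in> B - C"
  shows "scl.representation B f b = scl.representation B g b"
proof -
  have d: "f - g \<in> scl.span B" using assms(1,3) scl.span_mono by blast
  then have g: "g \<in> scl.span B" using assms(4) scl.span_diff[of f B "f - g"] by simp
  have "scl.representation B (f - g) b = scl.representation C (f - g) b"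
    using scl.representation_extend[OF assms(2,3,1)] by simp
  also have "\<dots> = 0"
    using assms(5) scl.representation_ne_zero by blast
  finally show ?thesis
    using scl.representation_diff[OF assms(2) g assms(4)] by simp
qed

text \<open>\<open>F\<close> acts as a projection along \<open>Z\<close>: it induces the identity on
  the quotient and annihilates \<open>Z\<close>. Hence \<open>app T b\<close> may be replaced by
  \<open>app F (app T b)\<close> in the coordinates outside \<open>C\<close>, and the other diagonal
  entries of \<open>F * T\<close> are zero because \<open>T\<close> preserves
  \<open>Z\<close>.\<close>

lemma quot_trace_eq_tr:
  assumes fin: "finite \<A>"
    and F: "\<And>f. f \<in> supp_in \<A> \<Longrightarrow> app F f \<in> supp_in \<A>"
    and T: "\<And>f. f \<in> supp_in \<A> \<Longrightarrow> app T f \<in> supp_in \<A>"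
    and Z: "scl.subspace Z" "Z \<subseteq> supp_in \<A>"
    and TU: "\<And>f. f \<in> Z \<Longrightarrow> app T f \<in> Z"
    and FU: "\<And>f. f \<in> Z \<Longrightarrow> app F f = 0"
    and F1: "\<And>f. f \<in> supp_in \<A> \<Longrightarrow> f - app F f \<in> Z"
  shows "quot_trace (supp_in \<A>) Z (app T) = lop_tr \<A> (F * T)"
proof -
  let ?W = "supp_in \<A>"
  let ?P = "\<lambda>(C, B). C \<subseteq> B \<and> B \<subseteq> ?W \<and> scl.independent B \<and> scl.span B = ?W \<and> scl.span C = Z"
  obtain C B where CB: "(SOME x. ?P x) = (C, B)" by fastforce
  have "\<exists>x. ?P x"
    using basis_extension_exists[OF subspace_supp_in Z] by auto
  then have "?P (C, B)" unfolding CB[symmetric] by (rule someI_ex)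
  then have B: "C \<subseteq> B" "B \<subseteq> ?W" "scl.independent B" "scl.span B = ?W" "scl.span C = Z"
    by auto
  have "quot_trace ?W Z (app T) = (\<Sum>b\<in>B - C. scl.representation B (app T b) b)"
    unfolding quot_trace_def CB by simp
  also have "\<dots> = (\<Sum>b\<in>B - C. scl.representation B (app (F * T) b) b)"
    using B F1 T by (intro sum.cong representation_mod[of C]) auto
  also have "\<dots> = lop_tr \<A> (F * T)"
    using F T TU FU by (intro tr_quotient_basis[OF fin _ B, symmetric]) auto
  finally show ?thesis .
qed

text \<open>In characteristic zero the trace of an idempotent is its rank. In a basis extending one
  of the kernel, \<open>app G b\<close> is congruent to \<open>b\<close> modulo the kernel, so the
  trace counts \<open>B - C\<close>.\<close>

lemma idempotent_tr_0:
  assumes fin: "finite \<A>"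
    and G: "\<And>f. f \<in> supp_in \<A> \<Longrightarrow> app G f \<in> supp_in \<A>"
    and GG: "\<And>f. f \<in> supp_in \<A> \<Longrightarrow> app G (app G f) = app G f"
    and tr0: "lop_tr \<A> G = 0" and f: "f \<in> supp_in \<A>"
  shows "app G f = 0"
proof -
  let ?W = "supp_in \<A>"
  define Z where "Z = {f \<in> ?W. app G f = 0}"
  have "scl.subspace Z"
    using subspace_supp_in by (auto simp: Z_def scl.subspace_def app_add app_scl)
  then obtain C B where B: "C \<subseteq> B" "B \<subseteq> ?W" "scl.independent B" "scl.span B = ?W" "scl.span C = Z"
    using basis_extension_exists[OF subspace_supp_in[of \<A>], of Z] unfolding Z_def by blast
  have "finite B"
    using scl.independent_span_bound[of "xmon ` \<A>" B] fin B by (auto simp: span_xmon)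
  have "lop_tr \<A> G = (\<Sum>b\<in>B - C. scl.representation B (app G b) b)"
    by (rule tr_quotient_basis[OF fin G B]) (auto simp: Z_def)
  also have "\<dots> = (\<Sum>b\<in>B - C. scl.representation B b b)"
  proof (rule sum.cong[OF refl], rule representation_mod[OF B(1,3)])
    fix b assume b: "b \<in> B - C"
    then have "b \<in> ?W" "app G b \<in> ?W" using B G by auto
    then show "app G b - b \<in> scl.span C" "app G b \<in> scl.span B"
      using scl.subspace_diff[OF subspace_supp_in] B GG by (auto simp: Z_def app_diff)
  qed
  also have "\<dots> = of_nat (card (B - C))"
    using B(3) by (simp add: scl.representation_basis)
  finally have "B - C = {}" using tr0 \<open>finite B\<close> by simp
  then have "Z = ?W" using B by auto
  then show ?thesis using f by (auto simp: Z_def)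
qed

lemma app_eq_on:
  assumes "finite \<A>" "f \<in> supp_in \<A>" "\<And>A. A \<in> \<A> \<Longrightarrow> app S (xmon A) = app T (xmon A)"
  shows "app S f = app T f"
proof -
  have "app S (\<Sum>A\<in>\<A>. scl (f A) (xmon A)) = app T (\<Sum>A\<in>\<A>. scl (f A) (xmon A))"
    unfolding app_sum app_scl by (intro sum.cong refl) (simp only: assms(3))
  then show ?thesis using supp_in_expand[OF assms(1,2)] by (simp only: flip:)
qed

section \<open>Creation and annihilation operators\<close>

text \<open>Sign for moving \<open>v\<close> from the front of the ordered monomial of
  \<open>A\<close> to its sorted place. The set counted is finite even for infinite
  \<open>A\<close>, so the operator relations below hold on all of \<open>ext\<close> without a
  support condition.\<close>

definition sg :: "nat \<Rightarrow> nat set \<Rightarrow> rat" where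
  "sg v A = (-1) ^ card {a \<in> A. a < v}"

lemma finite_below [simp]: "finite {a \<in> A. a < (v::nat)}"
  by (rule finite_subset[of _ "{..<v}"]) auto

lemma sg_sq [simp]: "sg v A * sg v A = 1" "sg v A * (sg v A * x) = x"
  by (auto simp: sg_def simp flip: power_add mult_2 mult.assoc)

lemma sg_insert: "w \<notin> A \<Longrightarrow> sg v (insert w A) = (if w < v then - sg v A else sg v A)"
proof -
  assume "w \<notin> A"
  then have "{a \<in> insert w A. a < v} = (if w < v then insert w {a \<in> A. a < v} else {a \<in> A. a < v})"
    by auto
  then show ?thesis using \<open>w \<notin> A\<close> by (simp add: sg_def)
qed

lemma sg_remove: "w \<in> A \<Longrightarrow> sg v (A - {w}) = (if w < v then - sg v A else sg v A)"
  using sg_insert[of w "A - {w}" v] by (auto simp: insert_absorb split: if_splits)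

lemma sg_self [simp]: "sg v (insert v A) = sg v A" "sg v (A - {v}) = sg v A"
proof -
  have "{a \<in> insert v A. a < v} = {a \<in> A. a < v}" "{a \<in> A - {v}. a < v} = {a \<in> A. a < v}"
    by auto
  then show "sg v (insert v A) = sg v A" "sg v (A - {v}) = sg v A"
    unfolding sg_def by presburger+
qed

lemma sg_Un:
  assumes "A \<inter> B = {}" shows "sg v (A \<union> B) = sg v A * sg v B"
proof -
  have "{a \<in> A \<union> B. a < v} = {a \<in> A. a < v} \<union> {a \<in> B. a < v}" by auto
  then show ?thesis using assms
    by (simp add: sg_def card_Un_disjoint disjoint_iff flip: power_add)
qed

lift_definition mul_var :: "nat \<Rightarrow> lop" is
  "\<lambda>v f A. if v \<in> A then sg v A * f (A - {v}) else 0"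
  by (auto simp: fun_eq_iff algebra_simps)

text \<open>Adjoint of \<open>mul_var\<close> for the inner product with orthonormal monomials;
  together they satisfy the canonical anticommutation relations.\<close>

lift_definition con_var :: "nat \<Rightarrow> lop" is
  "\<lambda>v f A. if v \<in> A then 0 else sg v A * f (insert v A)"
  by (auto simp: fun_eq_iff algebra_simps)

lemma mul_mul: "mul_var v * mul_var w = - (mul_var w * mul_var v)"
proof (rule lop_eqI, rule ext)
  fix f A
  have "A - {v} - {w} = A - {w} - {v}" by auto
  then show "app (mul_var v * mul_var w) f A = app (- (mul_var w * mul_var v)) f A"
    by (cases v w rule: linorder_cases)
      (auto simp: mul_var.rep_eq sg_remove)
qed

lemma con_con: "con_var v * con_var w = - (con_var w * con_var v)"
proof (rule lop_eqI, rule ext)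
  fix f A
  show "app (con_var v * con_var w) f A = app (- (con_var w * con_var v)) f A"
    by (cases v w rule: linorder_cases)
      (auto simp: con_var.rep_eq sg_insert insert_commute)
qed

lemma con_mul: "con_var v * mul_var w = (if v = w then 1 else 0) - mul_var w * con_var v"
proof (rule lop_eqI, rule ext)
  fix f A
  have "v \<noteq> w \<Longrightarrow> insert v A - {w} = insert v (A - {w})" by auto
  then show "app (con_var v * mul_var w) f A = app ((if v = w then 1 else 0) - mul_var w * con_var v) f A"
    by (cases v w rule: linorder_cases)
      (auto simp: con_var.rep_eq mul_var.rep_eq sg_insert sg_remove insert_absorb)
qed

lemma mul_var_xmon: "v \<notin> A \<Longrightarrow> app (mul_var v) (xmon A) = scl (sg v A) (xmon (insert v A))"
  by (rule ext) (auto simp: mul_var.rep_eq xmon_def insert_absorb)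

lemma xmon_insert: "v \<notin> A \<Longrightarrow> xmon (insert v A) = scl (sg v A) (app (mul_var v) (xmon A))"
  by (simp add: mul_var_xmon)

section \<open>The action of the symmetric group\<close>

lemma var_perm_permutes:
  assumes "\<sigma> permutes {0..<n}" shows "var_perm n \<sigma> permutes {0..<2*n}"
proof (rule bij_imp_permutes)
  have range: "var_perm n f x < 2*n" if "\<And>y. f y < n \<longleftrightarrow> y < n" "x < 2*n" for f x
    using that(1)[of x] that(1)[of "x - n"] that(2) by (auto simp: var_perm_def)
  have *: "\<sigma> x < n \<longleftrightarrow> x < n" for x using permutes_in_image[OF assms, of x] by simp
  show "bij_betw (var_perm n \<sigma>) {0..<2*n} {0..<2*n}"
  proof (rule bij_betwI[of _ _ _ "var_perm n (inv_into UNIV \<sigma>)"])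
    have **: "inv_into UNIV \<sigma> x < n \<longleftrightarrow> x < n" for x
      using permutes_in_image[OF permutes_inv[OF assms], of x] by simp
    show "var_perm n \<sigma> \<in> {0..<2*n} \<rightarrow> {0..<2*n}" "var_perm n (inv_into UNIV \<sigma>) \<in> {0..<2*n} \<rightarrow> {0..<2*n}"
      using range[OF *] range[OF **] by auto
    show "var_perm n (inv_into UNIV \<sigma>) (var_perm n \<sigma> x) = x" "var_perm n \<sigma> (var_perm n (inv_into UNIV \<sigma>) x) = x" for x
      using * ** permutes_inverses[OF assms] by (auto simp: var_perm_def)
  qed
  show "var_perm n \<sigma> x = x" if "x \<notin> {0..<2*n}" for x
    using that permutes_not_in[OF assms, of "x - n"] by (auto simp: var_perm_def)
qed

lemma var_perm_comp:
  assumes "\<rho> permutes {0..<n}"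
  shows "var_perm n \<sigma> (var_perm n \<rho> v) = var_perm n (\<sigma> \<circ> \<rho>) v"
  using permutes_in_image[OF assms, of v] permutes_in_image[OF assms, of "v - n"]
  by (auto simp: var_perm_def)

lemma act_sign_empty [simp]: "act_sign \<tau> {} = 1"
  by (simp add: act_sign_def)

lemma act_sign_insert:
  assumes "finite B" "v \<notin> B" "inj_on \<tau> (insert v B)"
  shows "act_sign \<tau> (insert v B) = act_sign \<tau> B * sg v B * sg (\<tau> v) (\<tau> ` B)"
proof -
  let ?I = "\<lambda>A. {(a, b). a \<in> A \<and> b \<in> A \<and> a < b \<and> \<tau> b < \<tau> a}"
  \<comment> \<open>\<open>?X\<close> and \<open>?Y\<close> are the elements forming a new inversion
    with \<open>v\<close>; those in \<open>?Z\<close> lie below \<open>v\<close> before and after.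
    The two signs count \<open>?X\<close> with \<open>?Z\<close> and \<open>?Y\<close> with
    \<open>?Z\<close>, so \<open>?Z\<close> cancels modulo 2.\<close>
  let ?X = "{a \<in> B. a < v \<and> \<tau> v < \<tau> a}" and ?Y = "{b \<in> B. v < b \<and> \<tau> b < \<tau> v}"
    and ?Z = "{a \<in> B. a < v \<and> \<tau> a < \<tau> v}"
  have ne: "\<tau> a \<noteq> \<tau> v" "a \<noteq> v" if "a \<in> B" for a
    using assms that by (auto simp: inj_on_def)
  have fI: "finite (?I B)"
    by (rule finite_subset[of _ "B \<times> B"]) (use assms in auto)
  have "?I (insert v B) = ?I B \<union> ((\<lambda>a. (a, v)) ` ?X \<union> (\<lambda>b. (v, b)) ` ?Y)"
    using assms(2) by auto
  moreover have "card \<dots> = card (?I B) + (card ((\<lambda>a. (a, v)) ` ?X) + card ((\<lambda>b. (v, b)) ` ?Y))"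
    using assms fI by (subst card_Un_disjoint; (subst card_Un_disjoint)?) auto
  ultimately have 1: "card (?I (insert v B)) = card (?I B) + (card ?X + card ?Y)"
    by (simp add: card_image inj_on_def)
  have "{a \<in> B. a < v} = ?X \<union> ?Z" using ne by (auto simp: neq_iff)
  then have 2: "card {a \<in> B. a < v} = card ?X + card ?Z"
    using assms by (simp, subst card_Un_disjoint) auto
  have "{c \<in> \<tau> ` B. c < \<tau> v} = \<tau> ` (?Y \<union> ?Z)"
    using ne by (auto simp: neq_iff image_iff)
  then have 3: "card {c \<in> \<tau> ` B. c < \<tau> v} = card ?Y + card ?Z"
  proof -
    have "card (\<tau> ` (?Y \<union> ?Z)) = card (?Y \<union> ?Z)"
      using assms(3) by (intro card_image) (auto simp: inj_on_def)
    also have "\<dots> = card ?Y + card ?Z"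
      using assms by (subst card_Un_disjoint) auto
    finally show ?thesis using \<open>_ = \<tau> ` (?Y \<union> ?Z)\<close> by simp
  qed
  have "(-1::rat) ^ (card ?X + card ?Z) * (-1) ^ (card ?Y + card ?Z) = (-1) ^ (card ?X + card ?Y)"
    by (simp add: power_add)
  then show ?thesis
    unfolding act_sign_def sg_def 1 2 3 by (simp add: power_add)
qed

lift_definition act_op :: "nat \<Rightarrow> (nat \<Rightarrow> nat) \<Rightarrow> lop" is act
  by (auto simp: act_def fun_eq_iff sum.distrib sum_distrib_left algebra_simps)

lemma act_op_outside: "\<not> W \<subseteq> {0..<2*n} \<Longrightarrow> \<sigma> permutes {0..<n} \<Longrightarrow> app (act_op n \<sigma>) f W = 0"
proof -
  assume *: "\<not> W \<subseteq> {0..<2*n}" "\<sigma> permutes {0..<n}"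
  have "{A. A \<subseteq> {0..<2*n} \<and> var_perm n \<sigma> ` A = W} = {}"
    using * permutes_image[OF var_perm_permutes[OF *(2)]] by blast
  then show ?thesis by (simp only: act_op.rep_eq act_def sum.empty)
qed

lemma act_op_image:
  assumes "A \<subseteq> {0..<2*n}" "\<sigma> permutes {0..<n}"
  shows "app (act_op n \<sigma>) f (var_perm n \<sigma> ` A) = act_sign (var_perm n \<sigma>) A * f A"
proof -
  have "inj (var_perm n \<sigma>)" using permutes_inj[OF var_perm_permutes[OF assms(2)]] .
  then have "{B. B \<subseteq> {0..<2*n} \<and> var_perm n \<sigma> ` B = var_perm n \<sigma> ` A} = {A}"
    using assms(1) by (auto simp: inj_image_eq_iff)
  then show ?thesis by (simp add: act_op.rep_eq act_def)
qed

text \<open>\<open>act\<close> pushes coefficients forward along \<open>var_perm\<close>, so its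
  values are simple only at images; every subset of the variables is one.\<close>

lemma act_op_eqI:
  assumes "\<sigma> permutes {0..<n}"
    and "\<And>W. \<not> W \<subseteq> {0..<2*n} \<Longrightarrow> f W = g W"
    and "\<And>A. A \<subseteq> {0..<2*n} \<Longrightarrow> f (var_perm n \<sigma> ` A) = g (var_perm n \<sigma> ` A)"
  shows "f = g"
proof
  fix W
  show "f W = g W"
  proof (cases "W \<subseteq> {0..<2*n}")
    case True
    then obtain A where "A \<subseteq> {0..<2*n}" "W = var_perm n \<sigma> ` A"
      using permutes_image[OF var_perm_permutes[OF assms(1)]] subset_imageE by metis
    then show ?thesis using assms(3) by blast
  qed (use assms in auto)
qed

text \<open>The sign is exactly that of \<open>act_sign_insert\<close>. Together with
  \<open>act_con\<close>, this makes symmetric sums of such operators equivariant without further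
  sign bookkeeping.\<close>

lemma act_mul:
  assumes s: "\<sigma> permutes {0..<n}" and v: "v < 2*n"
  shows "act_op n \<sigma> * mul_var v = mul_var (var_perm n \<sigma> v) * act_op n \<sigma>"
proof (rule lop_eqI, rule act_op_eqI[OF s])
  fix f W assume W: "\<not> W \<subseteq> {0..<2*n}"
  let ?t = "var_perm n \<sigma>"
  have "?t v < 2*n" using permutes_in_image[OF var_perm_permutes[OF s], of v] v by simp
  then have "\<not> W - {?t v} \<subseteq> {0..<2*n}" using W by auto
  then show "app (act_op n \<sigma> * mul_var v) f W = app (mul_var (?t v) * act_op n \<sigma>) f W"
    using W s by (simp add: act_op_outside mul_var.rep_eq)
next
  fix f A assume A: "A \<subseteq> {0..<2*n}"
  let ?t = "var_perm n \<sigma>"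
  have inj: "inj ?t" using permutes_inj[OF var_perm_permutes[OF s]] .
  have "act_sign ?t A * (sg v A * f (A - {v})) = sg (?t v) (?t ` A) * (act_sign ?t (A - {v}) * f (A - {v}))"
    if "v \<in> A"
  proof -
    have im: "?t ` (A - {v}) = ?t ` A - {?t v}"
      using image_set_diff[OF inj, of A "{v}"] by simp
    have "act_sign ?t (insert v (A - {v})) = act_sign ?t (A - {v}) * sg v (A - {v}) * sg (?t v) (?t ` (A - {v}))"
      using A by (intro act_sign_insert inj_on_subset[OF inj]) (auto intro: finite_subset)
    then have "act_sign ?t A = act_sign ?t (A - {v}) * sg v A * sg (?t v) (?t ` A)"
      using that by (simp add: im insert_absorb)
    then show ?thesis by (simp add: mult.commute mult.left_commute)
  qed
  moreover have "?t ` A - {?t v} = ?t ` (A - {v})" using inj by (auto simp: inj_def)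
  moreover have "A - {v} \<subseteq> {0..<2*n}" using A by auto
  ultimately show "app (act_op n \<sigma> * mul_var v) f (?t ` A) = app (mul_var (?t v) * act_op n \<sigma>) f (?t ` A)"
    using A s inj by (simp add: act_op_image mul_var.rep_eq inj_image_mem_iff)
qed

lemma act_con:
  assumes s: "\<sigma> permutes {0..<n}" and v: "v < 2*n"
  shows "act_op n \<sigma> * con_var v = con_var (var_perm n \<sigma> v) * act_op n \<sigma>"
proof (rule lop_eqI, rule act_op_eqI[OF s])
  fix f W assume W: "\<not> W \<subseteq> {0..<2*n}"
  let ?t = "var_perm n \<sigma>"
  have "\<not> insert (?t v) W \<subseteq> {0..<2*n}" using W by auto
  then show "app (act_op n \<sigma> * con_var v) f W = app (con_var (?t v) * act_op n \<sigma>) f W"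
    using W s by (simp add: act_op_outside con_var.rep_eq)
next
  fix f A assume A: "A \<subseteq> {0..<2*n}"
  let ?t = "var_perm n \<sigma>"
  have inj: "inj ?t" using permutes_inj[OF var_perm_permutes[OF s]] .
  have "act_sign ?t A * (sg v A * f (insert v A)) =
      sg (?t v) (?t ` A) * (act_sign ?t (insert v A) * f (insert v A))"
    if "v \<notin> A"
  proof -
    have "act_sign ?t (insert v A) = act_sign ?t A * sg v A * sg (?t v) (?t ` A)"
      using A that by (intro act_sign_insert inj_on_subset[OF inj]) (auto intro: finite_subset)
    then show ?thesis by (simp add: mult.commute mult.left_commute)
  qed
  moreover have "insert (?t v) (?t ` A) = ?t ` insert v A" by simp
  moreover have "insert v A \<subseteq> {0..<2*n}" using A v by auto
  ultimately show "app (act_op n \<sigma> * con_var v) f (?t ` A) = app (con_var (?t v) * act_op n \<sigma>) f (?t ` A)"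
    using A s inj by (simp add: act_op_image con_var.rep_eq inj_image_mem_iff del: image_insert)
qed

lemma act_op_xmon:
  assumes s: "\<sigma> permutes {0..<n}" and A: "A \<subseteq> {0..<2*n}"
  shows "app (act_op n \<sigma>) (xmon A) = scl (act_sign (var_perm n \<sigma>) A) (xmon (var_perm n \<sigma> ` A))"
proof (rule act_op_eqI[OF s])
  have inj: "inj (var_perm n \<sigma>)" using permutes_inj[OF var_perm_permutes[OF s]] .
  have "var_perm n \<sigma> ` A \<subseteq> {0..<2*n}" using A permutes_image[OF var_perm_permutes[OF s]] by blast
  then show "app (act_op n \<sigma>) (xmon A) W = scl (act_sign (var_perm n \<sigma>) A) (xmon (var_perm n \<sigma> ` A)) W"
    if "\<not> W \<subseteq> {0..<2*n}" for W
    using that by (auto simp: act_op_outside[OF _ s] xmon_def)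
  show "app (act_op n \<sigma>) (xmon A) (var_perm n \<sigma> ` B) =
      scl (act_sign (var_perm n \<sigma>) A) (xmon (var_perm n \<sigma> ` A)) (var_perm n \<sigma> ` B)"
    if "B \<subseteq> {0..<2*n}" for B
    using inj by (auto simp: act_op_image[OF that s] xmon_def inj_image_eq_iff)
qed

lemma act_xmon_empty: "\<sigma> permutes {0..<n} \<Longrightarrow> app (act_op n \<sigma>) (xmon {}) = xmon {}"
  using act_op_xmon[of \<sigma> n "{}"] by simp

lemma ext_alg_supp: "ext_alg n = supp_in (Pow {0..<2*n})"
  by (auto simp: ext_alg_def supp_in_def)

text \<open>Monomials are built from \<open>xmon {}\<close> by \<open>mul_var\<close>, and both
  sides move past \<open>mul_var\<close> in the same way; this replaces a count of
  inversions.\<close>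

lemma act_comp:
  assumes s: "\<sigma> permutes {0..<n}" and r: "\<rho> permutes {0..<n}" and f: "f \<in> ext_alg n"
  shows "app (act_op n \<sigma>) (app (act_op n \<rho>) f) = app (act_op n (\<sigma> \<circ> \<rho>)) f"
proof -
  have sr: "(\<sigma> \<circ> \<rho>) permutes {0..<n}" by (rule permutes_compose[OF r s])
  have mon: "app (act_op n \<sigma>) (app (act_op n \<rho>) (xmon A)) = app (act_op n (\<sigma> \<circ> \<rho>)) (xmon A)"
    if "A \<subseteq> {0..<2*n}" for A
  proof -
    have "finite A" using that finite_subset by blast
    then show ?thesis using that
    proof (induction A rule: finite_induct)
      case empty
      show ?case by (simp only: act_xmon_empty s r sr)
    next
      case (insert v A)
      have v: "v < 2*n" and v': "var_perm n \<rho> v < 2*n"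
        using insert permutes_in_image[OF var_perm_permutes[OF r], of v] by auto
      have "app (act_op n \<sigma> * act_op n \<rho> * mul_var v) (xmon A) =
          app (mul_var (var_perm n (\<sigma> \<circ> \<rho>) v) * (act_op n \<sigma> * act_op n \<rho>)) (xmon A)"
        by (simp only: mult.assoc act_mul[OF r v] var_perm_comp[OF r, symmetric])
          (simp only: mult.assoc[symmetric] act_mul[OF s v'])
      also have "\<dots> = app (mul_var (var_perm n (\<sigma> \<circ> \<rho>) v) * act_op n (\<sigma> \<circ> \<rho>)) (xmon A)"
        using insert.IH insert.prems by (simp only: times_lop.rep_eq insert_subset)
      also have "\<dots> = app (act_op n (\<sigma> \<circ> \<rho>) * mul_var v) (xmon A)"
        by (simp only: act_mul[OF sr v])
      finally show ?case
        by (simp only: xmon_insert[OF insert(2)] app_scl times_lop.rep_eq)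
    qed
  qed
  then show ?thesis
    using app_eq_on[of "Pow {0..<2*n}" f "act_op n \<sigma> * act_op n \<rho>" "act_op n (\<sigma> \<circ> \<rho>)"] f
    by (simp only: times_lop.rep_eq ext_alg_supp Pow_iff finite_Pow_iff finite_atLeastLessThan)
qed

section \<open>Multiplication\<close>

lemma mult_sign_insert:
  assumes "v \<notin> A" "finite A" "finite B"
  shows "mult_sign (insert v A) B = mult_sign A B * sg v B"
proof -
  let ?I = "\<lambda>A. {(a, b). a \<in> A \<and> b \<in> B \<and> b < a}"
  have "?I (insert v A) = ?I A \<union> (\<lambda>b. (v, b)) ` {b \<in> B. b < v}" by auto
  moreover have "finite (?I A)"
    by (rule finite_subset[of _ "A \<times> B"]) (use assms in auto)
  ultimately have "card (?I (insert v A)) = card (?I A) + card {b \<in> B. b < v}"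
    using assms by (simp, subst card_Un_disjoint) (auto simp: card_image inj_on_def)
  then show ?thesis by (simp add: mult_sign_def sg_def power_add)
qed

text \<open>Associativity with a single variable on the left. Iterating it expresses multiplication
  by a monomial, or by a sum such as \<open>mP\<close>, through the operators
  \<open>mul_var\<close>.\<close>

lemma ext_mult_mul_var: "ext_mult (app (mul_var v) f) g = app (mul_var v) (ext_mult f g)"
proof
  fix W
  let ?l = "\<lambda>A. mult_sign A (W - A) * app (mul_var v) f A * g (W - A)"
  show "ext_mult (app (mul_var v) f) g W = app (mul_var v) (ext_mult f g) W"
  proof (cases "finite W \<and> v \<in> W")
    \<comment> \<open>For infinite \<open>W\<close> both sides vanish because a sum over the
      infinite set \<open>Pow W\<close> is 0 by convention.\<close>
    case False
    then show ?thesis by (auto simp: ext_mult_def mul_var.rep_eq intro!: sum.neutral)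
  next
    case True
    then have fin: "finite W" and v: "v \<in> W" by auto
    have "(\<Sum>A\<in>Pow W. ?l A) = (\<Sum>A\<in>insert v ` Pow (W - {v}). ?l A)"
    proof (rule sum.mono_neutral_right)
      show "insert v ` Pow (W - {v}) \<subseteq> Pow W" using v by auto
      show "\<forall>A\<in>Pow W - insert v ` Pow (W - {v}). ?l A = 0"
      proof
        fix A assume A: "A \<in> Pow W - insert v ` Pow (W - {v})"
        have "A = insert v (A - {v})" if "v \<in> A" using that by auto
        then have "v \<notin> A" using A by blast
        then show "?l A = 0" by (simp add: mul_var.rep_eq)
      qed
    qed (use fin in auto)
    also have "\<dots> = (\<Sum>A\<in>Pow (W - {v}). ?l (insert v A))"
      by (subst sum.reindex) (auto simp: inj_on_def)
    also have "\<dots> = (\<Sum>A\<in>Pow (W - {v}). sg v W * (mult_sign A (W - {v} - A) * f A * g (W - {v} - A)))"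
    proof (rule sum.cong[OF refl])
      fix A assume "A \<in> Pow (W - {v})"
      then have A: "A \<subseteq> W" "v \<notin> A" "finite A" using fin by (auto intro: finite_subset)
      have W: "W - insert v A = W - {v} - A" by auto
      have "sg v W = sg v (insert v A \<union> (W - insert v A))"
        using A v by (intro arg_cong[of _ _ "sg v"]) auto
      also have "\<dots> = sg v A * sg v (W - {v} - A)"
        by (subst sg_Un) (auto simp: W)
      finally have "sg v W = sg v A * sg v (W - {v} - A)" .
      moreover have "mult_sign (insert v A) (W - {v} - A) = mult_sign A (W - {v} - A) * sg v (W - {v} - A)"
        using A fin by (intro mult_sign_insert) auto
      ultimately show "?l (insert v A) = sg v W * (mult_sign A (W - {v} - A) * f A * g (W - {v} - A))"
        using A by (simp add: mul_var.rep_eq W)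
    qed
    finally show ?thesis using v by (simp add: ext_mult_def mul_var.rep_eq sum_distrib_left)
  qed
qed

lemma ext_mult_one: "f \<in> ext_alg n \<Longrightarrow> ext_mult (xmon {}) f = f"
proof
  fix W assume f: "f \<in> ext_alg n"
  show "ext_mult (xmon {}) f W = f W"
  proof (cases "finite W")
    case True
    have "(\<Sum>A\<in>Pow W. mult_sign A (W - A) * xmon {} A * f (W - A)) =
        (\<Sum>A\<in>{{}}. mult_sign A (W - A) * xmon {} A * f (W - A))"
      using True by (intro sum.mono_neutral_right) (auto simp: xmon_def)
    then show ?thesis by (simp add: ext_mult_def mult_sign_def xmon_def)
  next
    case False
    then have "\<not> W \<subseteq> {0..<2*n}" using finite_subset by blast
    then show ?thesis using False f by (auto simp: ext_mult_def ext_alg_def)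
  qed
qed

lemma ext_mult_scl: "ext_mult (scl c f) g = scl c (ext_mult f g)"
  and ext_mult_add: "ext_mult (f + f') g = ext_mult f g + ext_mult f' g"
  by (auto simp: ext_mult_def fun_eq_iff sum_distrib_left sum.distrib algebra_simps)

lemma ext_mult_zero: "ext_mult 0 g = 0"
  by (auto simp: ext_mult_def fun_eq_iff)

lemma ext_mult_sum: "ext_mult (\<Sum>x\<in>S. f x) g = (\<Sum>x\<in>S. ext_mult (f x) g)"
proof (induction S rule: infinite_finite_induct)
  case (insert x S)
  then show ?case by (simp only: sum.insert ext_mult_add not_False_eq_True)
qed (simp_all only: sum.infinite sum.empty ext_mult_zero not_False_eq_True)

lemma ext_mult_closed: "f \<in> ext_alg n \<Longrightarrow> g \<in> ext_alg n \<Longrightarrow> ext_mult f g \<in> ext_alg n"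
proof -
  assume fg: "f \<in> ext_alg n" "g \<in> ext_alg n"
  have "ext_mult f g W = 0" if "\<not> W \<subseteq> {0..<2*n}" for W
    unfolding ext_mult_def
  proof (rule sum.neutral, rule ballI)
    fix A assume "A \<in> Pow W"
    then have "\<not> A \<subseteq> {0..<2*n} \<or> \<not> W - A \<subseteq> {0..<2*n}" using that by auto
    then show "mult_sign A (W - A) * f A * g (W - A) = 0" using fg by (auto simp: ext_alg_def)
  qed
  then show ?thesis by (auto simp: ext_alg_def)
qed

section \<open>Permutation characters as counts of invariant words\<close>

text \<open>Their number is the value at \<open>\<sigma>\<close> of the permutation character on
  words of content \<open>\<alpha>\<close>. Contents are integers because the Frobenius formula
  produces negative ones; the set is then empty, matching complete symmetric functions of negative
  degree.\<close>

definition fixed_words :: "nat \<Rightarrow> (nat \<Rightarrow> nat) \<Rightarrow> nat \<Rightarrow> (nat \<Rightarrow> int) \<Rightarrow> (nat \<Rightarrow> nat) set" where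
  "fixed_words n \<sigma> k \<alpha> = {g \<in> {0..<n} \<rightarrow>\<^sub>E {0..<k}. (\<forall>x<n. g (\<sigma> x) = g x) \<and>
     (\<forall>r<k. int (card {x \<in> {0..<n}. g x = r}) = \<alpha> r)}"

definition cyc_of :: "(nat \<Rightarrow> nat) \<Rightarrow> nat \<Rightarrow> nat set" where
  "cyc_of \<sigma> x = {(\<sigma> ^^ k) x | k. True}"

lemma cyc_of_eq:
  assumes "\<sigma> permutes {0..<n}" "y \<in> cyc_of \<sigma> x"
  shows "cyc_of \<sigma> y = cyc_of \<sigma> x"
proof -
  obtain a where a: "y = (\<sigma> ^^ a) x" using assms(2) by (auto simp: cyc_of_def)
  have "permutation \<sigma>" by (rule permutes_imp_permutation[OF _ assms(1)]) simp
  \<comment> \<open>Finite order makes the forward orbit a full cycle: \<open>m - a\<close> further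
    steps lead from \<open>y\<close> back to \<open>x\<close>.\<close>
  then obtain m where m: "\<sigma> ^^ m = id" "m > a" by (rule permutation_is_nilpotent')
  have "x = (\<sigma> ^^ (m - a)) y"
    using m unfolding a by (metis comp_apply funpow_add id_apply le_add_diff_inverse2 less_imp_le)
  then have "(\<sigma> ^^ k) x = (\<sigma> ^^ (k + (m - a))) y" for k by (simp add: funpow_add)
  moreover have "(\<sigma> ^^ k) y = (\<sigma> ^^ (k + a)) x" for k unfolding a by (simp add: funpow_add)
  ultimately show ?thesis unfolding cyc_of_def by blast
qed

text \<open>A map on cycles is the same as a word constant on cycles; adding the lengths of the
  cycles sent to \<open>r\<close> counts the positions carrying \<open>r\<close>.\<close>

lemma psum_coeff_eq:
  assumes s: "\<sigma> permutes {0..<n}"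
  shows "psum_coeff n \<sigma> k \<alpha> = card (fixed_words n \<sigma> k \<alpha>)"
proof -
  let ?o = "cyc_of \<sigma>" and ?C = "perm_cycles n \<sigma>"
  let ?F = "{f \<in> ?C \<rightarrow>\<^sub>E {0..<k}. \<forall>r<k. int (\<Sum>c\<in>{c \<in> ?C. f c = r}. card c) = \<alpha> r}"
  let ?\<Phi> = "\<lambda>f. \<lambda>x\<in>{0..<n}. f (?o x)"
  have C: "?C = ?o ` {0..<n}" by (simp add: perm_cycles_def cyc_of_def)
  have self: "x \<in> ?o x" for x unfolding cyc_of_def by (auto intro: exI[of _ 0])
  have sub: "?o x \<subseteq> {0..<n}" if "x < n" for x
    using permutes_in_image[OF permutes_funpow[OF s], of _ x] that by (auto simp: cyc_of_def)
  have step: "?o (\<sigma> x) = ?o x" for x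
  proof (rule cyc_of_eq[OF s])
    have "\<sigma> x = (\<sigma> ^^ 1) x" by simp
    then show "\<sigma> x \<in> ?o x" unfolding cyc_of_def by blast
  qed
  have cyc: "c = {x \<in> {0..<n}. ?o x = c}" if "c \<in> ?C" for c
  proof
    show "c \<subseteq> {x \<in> {0..<n}. ?o x = c}"
    proof
      fix y assume y: "y \<in> c"
      obtain x where x: "x < n" "c = ?o x" using \<open>c \<in> ?C\<close> by (auto simp: C)
      then show "y \<in> {x \<in> {0..<n}. ?o x = c}"
        using y sub[OF x(1)] cyc_of_eq[OF s, of y x] by auto
    qed
    show "{x \<in> {0..<n}. ?o x = c} \<subseteq> c" using self by blast
  qed
  have size: "(\<Sum>c\<in>{c \<in> ?C. f c = r}. card c) = card {x \<in> {0..<n}. ?\<Phi> f x = r}" for f r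
  proof -
    have "(\<Sum>c\<in>{c \<in> ?C. f c = r}. card c) = (\<Sum>c\<in>{c \<in> ?C. f c = r}. card {x \<in> {0..<n}. ?o x = c})"
      using cyc by (intro sum.cong refl arg_cong[of _ _ card]) blast
    also have "\<dots> = card (\<Union>c\<in>{c \<in> ?C. f c = r}. {x \<in> {0..<n}. ?o x = c})"
      by (rule card_UN_disjoint[symmetric]) (auto simp: C)
    also have "(\<Union>c\<in>{c \<in> ?C. f c = r}. {x \<in> {0..<n}. ?o x = c}) = {x \<in> {0..<n}. ?\<Phi> f x = r}"
      by (auto simp: C)
    finally show ?thesis .
  qed
  have "bij_betw ?\<Phi> ?F (fixed_words n \<sigma> k \<alpha>)"
    unfolding bij_betw_def
  proof
    show "inj_on ?\<Phi> ?F"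
    proof (rule inj_onI)
      fix f g assume f: "f \<in> ?F" and g: "g \<in> ?F" and eq: "?\<Phi> f = ?\<Phi> g"
      have "f c = g c" if "c \<in> ?C" for c
      proof -
        obtain x where "x < n" "c = ?o x" using \<open>c \<in> ?C\<close> by (auto simp: C)
        then show ?thesis using fun_cong[OF eq, of x] by simp
      qed
      then show "f = g" using f g by (intro PiE_ext[of f ?C _ g]) auto
    qed
    show "?\<Phi> ` ?F = fixed_words n \<sigma> k \<alpha>"
    proof
      show "?\<Phi> ` ?F \<subseteq> fixed_words n \<sigma> k \<alpha>"
      proof
        fix g assume "g \<in> ?\<Phi> ` ?F"
        then obtain f where f: "f \<in> ?F" "g = ?\<Phi> f" by auto
        have "g \<in> {0..<n} \<rightarrow>\<^sub>E {0..<k}" using f by (auto simp: C)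
        moreover have "\<forall>x<n. g (\<sigma> x) = g x"
          using permutes_in_image[OF s] step f(2) by simp
        moreover have "int (card {x \<in> {0..<n}. g x = r}) = \<alpha> r" if "r < k" for r
          using f(1) that unfolding f(2) size[symmetric] by blast
        ultimately show "g \<in> fixed_words n \<sigma> k \<alpha>"
          unfolding fixed_words_def by blast
      qed
      show "fixed_words n \<sigma> k \<alpha> \<subseteq> ?\<Phi> ` ?F"
      proof
        fix g assume g: "g \<in> fixed_words n \<sigma> k \<alpha>"
        \<comment> \<open>The arbitrary representative is harmless because \<open>g\<close> is
          constant on each cycle.\<close>
        define f where "f = (\<lambda>c\<in>?C. g (SOME x. x \<in> c))"
        have orb: "g y = g x" if "x < n" "y \<in> ?o x" for x y
        proof -
          have "g ((\<sigma> ^^ m) x) = g x \<and> (\<sigma> ^^ m) x < n" for m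
            using that(1) g permutes_in_image[OF s] by (induction m) (auto simp: fixed_words_def)
          then show ?thesis using that(2) by (auto simp: cyc_of_def)
        qed
        have fo: "f (?o x) = g x" if "x < n" for x
        proof -
          have "(SOME y. y \<in> ?o x) \<in> ?o x" by (rule someI[of "\<lambda>y. y \<in> ?o x", OF self])
          then show ?thesis using orb[OF that] that by (simp add: f_def C)
        qed
        have \<Phi>: "?\<Phi> f = g"
          using fo g by (auto simp: fixed_words_def PiE_def extensional_def fun_eq_iff)
        have "f \<in> ?C \<rightarrow>\<^sub>E {0..<k}"
        proof
          fix c assume "c \<in> ?C"
          then obtain x where x: "x < n" "c = ?o x" by (auto simp: C)
          have "g \<in> {0..<n} \<rightarrow>\<^sub>E {0..<k}" using g by (simp add: fixed_words_def)
          then have "g x \<in> {0..<k}" using x(1) by (intro PiE_mem[of g "{0..<n}"]) auto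
          then show "f c \<in> {0..<k}" using fo x by simp
        qed (simp add: f_def)
        moreover have "int (\<Sum>c\<in>{c \<in> ?C. f c = r}. card c) = \<alpha> r" if "r < k" for r
          using g that unfolding size \<Phi> fixed_words_def by blast
        ultimately have "f \<in> ?F" by blast
        then show "g \<in> ?\<Phi> ` ?F"
          using \<Phi> by (intro image_eqI[of _ _ f]) (rule sym)
      qed
    qed
  qed
  then show ?thesis unfolding psum_coeff_def by (rule bij_betw_same_card)
qed

section \<open>Signed counting of coloured words\<close>

text \<open>Colour of a position: a letter of the word, then whether the theta and the xi of that
  position occur in the monomial. A coloured word thus encodes a word together with a monomial,
  which \<open>col_set\<close> recovers.\<close>

type_synonym col = "nat \<times> bool \<times> bool"

definition col_set :: "nat \<Rightarrow> (nat \<Rightarrow> col) \<Rightarrow> nat set" where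
  "col_set n c = {x. x < n \<and> fst (snd (c x))} \<union> (+) n ` {x. x < n \<and> snd (snd (c x))}"

definition stab :: "nat \<Rightarrow> (nat \<Rightarrow> col) \<Rightarrow> (nat \<Rightarrow> nat) set" where
  "stab n c = {\<sigma>. \<sigma> permutes {0..<n} \<and> (\<forall>x<n. c (\<sigma> x) = c x)}"

text \<open>A colour with exactly one of the two flags is odd: exchanging two positions of that
  colour exchanges two anticommuting variables. Good means that no odd colour repeats.\<close>

definition good_col :: "nat \<Rightarrow> (nat \<Rightarrow> col) \<Rightarrow> bool" where
  "good_col n c \<longleftrightarrow> (\<forall>x<n. \<forall>y<n. x \<noteq> y \<longrightarrow> c x = c y \<longrightarrow> fst (snd (c x)) = snd (snd (c x)))"

lemma col_set_lo: "x < n \<Longrightarrow> x \<in> col_set n c \<longleftrightarrow> fst (snd (c x))"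
  and col_set_hi: "n + x \<in> col_set n c \<longleftrightarrow> x < n \<and> snd (snd (c x))"
  by (auto simp: col_set_def)

lemma col_set_sub: "col_set n c \<subseteq> {0..<2*n}"
  by (auto simp: col_set_def)

lemma finite_col_set [simp]: "finite (col_set n c)"
  using col_set_sub finite_subset by blast

lemma var_perm_image_eq_iff:
  assumes s: "\<sigma> permutes {0..<n}" and A: "A \<subseteq> {0..<2*n}"
  shows "var_perm n \<sigma> ` A = A \<longleftrightarrow> (\<forall>x<n. (\<sigma> x \<in> A \<longleftrightarrow> x \<in> A) \<and> (n + \<sigma> x \<in> A \<longleftrightarrow> n + x \<in> A))"
proof
  let ?t = "var_perm n \<sigma>"
  have inj: "inj ?t" using permutes_inj[OF var_perm_permutes[OF s]] .
  {
    assume "?t ` A = A"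
    then have *: "?t v \<in> A \<longleftrightarrow> v \<in> A" for v using inj_image_mem_iff[OF inj, of v A] by simp
    show "\<forall>x<n. (\<sigma> x \<in> A \<longleftrightarrow> x \<in> A) \<and> (n + \<sigma> x \<in> A \<longleftrightarrow> n + x \<in> A)"
    proof (intro allI impI)
      fix x assume "x < n"
      then show "(\<sigma> x \<in> A \<longleftrightarrow> x \<in> A) \<and> (n + \<sigma> x \<in> A \<longleftrightarrow> n + x \<in> A)"
        using *[of x] *[of "n + x"] by (simp add: var_perm_def)
    qed
  }
  assume *: "\<forall>x<n. (\<sigma> x \<in> A \<longleftrightarrow> x \<in> A) \<and> (n + \<sigma> x \<in> A \<longleftrightarrow> n + x \<in> A)"
  have "?t v \<in> A" if "v \<in> A" for v
  proof (cases "v < n")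
    case True
    then show ?thesis using * that by (simp add: var_perm_def)
  next
    case False
    then have "v - n < n" "n + (v - n) = v" using A that by auto
    then show ?thesis using * that False by (auto simp: var_perm_def)
  qed
  then have "?t ` A \<subseteq> A" by auto
  moreover have "finite A" using A finite_subset by blast
  ultimately show "?t ` A = A" using inj by (metis card_image card_subset_eq inj_on_subset subset_UNIV)
qed

lemma stab_col_set: "\<sigma> \<in> stab n c \<Longrightarrow> var_perm n \<sigma> ` col_set n c = col_set n c"
proof -
  assume "\<sigma> \<in> stab n c"
  then have s: "\<sigma> permutes {0..<n}" and c: "\<And>x. x < n \<Longrightarrow> c (\<sigma> x) = c x" by (auto simp: stab_def)
  have "\<sigma> x < n" if "x < n" for x using permutes_in_image[OF s, of x] that by simp
  then show ?thesis
    using c by (simp add: var_perm_image_eq_iff[OF s col_set_sub] col_set_lo col_set_hi)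
qed

text \<open>Each fixed variable \<open>v\<close> contributes its sign \<open>sg v\<close> twice,
  hence nothing.\<close>

lemma act_sign_fixed:
  assumes "finite R" "finite A" "inj \<tau>" "\<tau> ` A = A" "R \<inter> A = {}" "\<And>v. v \<in> R \<Longrightarrow> \<tau> v = v"
  shows "act_sign \<tau> (A \<union> R) = act_sign \<tau> A"
  using assms(1,5,6)
proof (induction R rule: finite_induct)
  case (insert v R)
  have "\<tau> ` R = (\<lambda>v. v) ` R" using insert.prems by (intro image_cong) auto
  then have im: "\<tau> ` (A \<union> R) = A \<union> R" using assms(4) by (simp add: image_Un)
  have "act_sign \<tau> (insert v (A \<union> R)) =
      act_sign \<tau> (A \<union> R) * sg v (A \<union> R) * sg (\<tau> v) (\<tau> ` (A \<union> R))"
    using insert assms(2) by (intro act_sign_insert inj_on_subset[OF assms(3)]) auto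
  then show ?case using insert im by (simp add: mult.assoc)
qed simp

text \<open>Products theta_x xi_x are even: every inversion of \<open>\<sigma>\<close> on
  \<open>D\<close> appears once among the thetas and once among the xis, and no theta passes a
  xi.\<close>

lemma act_sign_doubled:
  assumes s: "\<sigma> permutes {0..<n}" and D: "D \<subseteq> {0..<n}"
  shows "act_sign (var_perm n \<sigma>) (D \<union> (+) n ` D) = 1"
proof -
  let ?t = "var_perm n \<sigma>" and ?I = "{(a, b). a \<in> D \<and> b \<in> D \<and> a < b \<and> \<sigma> b < \<sigma> a}"
  have lt: "\<sigma> a < n" if "a \<in> D" for a using permutes_in_image[OF s, of a] D that by auto
  have fI: "finite ?I" by (rule finite_subset[of _ "D \<times> D"]) (use D finite_subset in auto)
  have Dn: "a < n" if "a \<in> D" for a using D that by auto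
  have "{(a, b). a \<in> D \<union> (+) n ` D \<and> b \<in> D \<union> (+) n ` D \<and> a < b \<and> ?t b < ?t a} =
      ?I \<union> (\<lambda>(a, b). (n + a, n + b)) ` ?I" (is "?L = ?R")
  proof
    show "?L \<subseteq> ?R"
    proof
      fix p assume "p \<in> ?L"
      then obtain a b where p: "p = (a, b)" "a \<in> D \<union> (+) n ` D" "b \<in> D \<union> (+) n ` D"
        "a < b" "?t b < ?t a" by auto
      consider "a \<in> D" "b \<in> D" | a' b' where "a = n + a'" "b = n + b'" "a' \<in> D" "b' \<in> D"
        | b' where "a \<in> D" "b = n + b'" "b' \<in> D" | a' where "a = n + a'" "b \<in> D" "a' \<in> D"
        using p by blast
      then show "p \<in> ?R"
      proof cases
        case 1
        then show ?thesis using p Dn by (auto simp: var_perm_def)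
      next
        case (2 a' b')
        then have "(a', b') \<in> ?I" using p by (auto simp: var_perm_def)
        then show ?thesis using 2 p by force
      next
        case (3 b')
        then show ?thesis using p Dn lt[of a] by (auto simp: var_perm_def)
      next
        case (4 a')
        then show ?thesis using p Dn[of b] by auto
      qed
    qed
    show "?R \<subseteq> ?L" using Dn by (auto simp: var_perm_def)
  qed
  moreover have "card (?I \<union> (\<lambda>(a, b). (n + a, n + b)) ` ?I) = card ?I + card ((\<lambda>(a, b). (n + a, n + b)) ` ?I)"
    using fI Dn by (intro card_Un_disjoint) fastforce+
  moreover have "card ((\<lambda>(a, b). (n + a, n + b)) ` ?I) = card ?I"
    by (intro card_image) (auto simp: inj_on_def)
  ultimately show ?thesis by (simp add: act_sign_def flip: mult_2)
qed

text \<open>A stabilizing permutation fixes every position of odd colour, since such a colour occurs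
  only once; the rest of the monomial is doubled.\<close>

lemma act_sign_good:
  assumes good: "good_col n c" and st: "\<sigma> \<in> stab n c"
  shows "act_sign (var_perm n \<sigma>) (col_set n c) = 1"
proof -
  let ?t = "var_perm n \<sigma>"
  have s: "\<sigma> permutes {0..<n}" and c: "\<And>x. x < n \<Longrightarrow> c (\<sigma> x) = c x" using st by (auto simp: stab_def)
  have lt: "\<sigma> x < n" if "x < n" for x using permutes_in_image[OF s, of x] that by simp
  have inj: "inj ?t" using permutes_inj[OF var_perm_permutes[OF s]] .
  define D where "D = {x. x < n \<and> fst (snd (c x)) \<and> snd (snd (c x))}"
  let ?A = "D \<union> (+) n ` D" and ?R = "col_set n c - (D \<union> (+) n ` D)"
  have D: "D \<subseteq> {0..<n}" by (auto simp: D_def)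
  have "?A \<subseteq> {0..<2*n}" using D by auto
  then have im: "?t ` ?A = ?A"
  proof (subst var_perm_image_eq_iff[OF s], simp, intro allI impI)
    fix x assume x: "x < n"
    have lo: "y \<in> ?A \<longleftrightarrow> y \<in> D" if "y < n" for y using that by auto
    have hi: "n + y \<in> ?A \<longleftrightarrow> y \<in> D" for y using D by auto
    have "\<sigma> x \<in> D \<longleftrightarrow> x \<in> D" using x c[OF x] lt[OF x] by (simp add: D_def)
    then show "(\<sigma> x \<in> ?A \<longleftrightarrow> x \<in> ?A) \<and> (n + \<sigma> x \<in> ?A \<longleftrightarrow> n + x \<in> ?A)"
      unfolding lo[OF x] lo[OF lt[OF x]] hi by blast
  qed
  have un: "col_set n c = ?A \<union> ?R" by (auto simp: D_def col_set_def)
  have fix_odd: "\<sigma> x = x" if "x < n" "fst (snd (c x)) \<noteq> snd (snd (c x))" for x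
    using good that lt[OF that(1)] c[OF that(1)] by (metis good_col_def)
  have fx: "?t v = v" if "v \<in> ?R" for v
  proof (cases "v < n")
    case True
    then have "fst (snd (c v)) \<noteq> snd (snd (c v))" using that by (auto simp: D_def col_set_lo)
    then show ?thesis using fix_odd[OF True] True by (simp add: var_perm_def)
  next
    case False
    then obtain x where x: "v = n + x" by (metis le_add_diff_inverse not_less)
    then have "x < n" "fst (snd (c x)) \<noteq> snd (snd (c x))"
      using that by (auto simp: D_def col_set_hi)
    then show ?thesis using fix_odd x by (simp add: var_perm_def)
  qed
  have "finite ?A" using D finite_subset by blast
  then have "act_sign ?t (?A \<union> ?R) = act_sign ?t ?A"
    using im fx by (intro act_sign_fixed inj) auto
  then show ?thesis using un act_sign_doubled[OF s D] by simp
qed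

text \<open>The cocycle identity is read off from \<open>act_comp\<close> at the monomial of
  \<open>A\<close>.\<close>

lemma act_sign_comp:
  assumes s: "\<sigma> permutes {0..<n}" and r: "\<rho> permutes {0..<n}" and A: "A \<subseteq> {0..<2*n}"
  shows "act_sign (var_perm n (\<sigma> \<circ> \<rho>)) A =
    act_sign (var_perm n \<rho>) A * act_sign (var_perm n \<sigma>) (var_perm n \<rho> ` A)"
proof -
  have sr: "(\<sigma> \<circ> \<rho>) permutes {0..<n}" by (rule permutes_compose[OF r s])
  have rA: "var_perm n \<rho> ` A \<subseteq> {0..<2*n}" using A permutes_image[OF var_perm_permutes[OF r]] by blast
  have im: "var_perm n \<sigma> ` var_perm n \<rho> ` A = var_perm n (\<sigma> \<circ> \<rho>) ` A"
    unfolding image_image using var_perm_comp[OF r] by simp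
  have "xmon A \<in> ext_alg n" unfolding ext_alg_supp using A by (intro xmon_in) simp
  from act_comp[OF s r this]
  have "scl (act_sign (var_perm n \<rho>) A * act_sign (var_perm n \<sigma>) (var_perm n \<rho> ` A)) (xmon (var_perm n (\<sigma> \<circ> \<rho>) ` A)) =
      scl (act_sign (var_perm n (\<sigma> \<circ> \<rho>)) A) (xmon (var_perm n (\<sigma> \<circ> \<rho>) ` A))"
    by (simp only: act_op_xmon[OF r A] act_op_xmon[OF s rA] act_op_xmon[OF sr A] app_scl im scl.scale_scale)
  from fun_cong[OF this, of "var_perm n (\<sigma> \<circ> \<rho>) ` A"] show ?thesis by (simp add: xmon_def)
qed

lemma act_sign_pair:
  assumes "p \<noteq> q" "\<tau> p = q" "\<tau> q = p" shows "act_sign \<tau> {p, q} = -1"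
proof -
  have 1: "act_sign \<tau> {q} = 1"
    using act_sign_insert[of "{}" q \<tau>] by (simp add: sg_def)
  have "act_sign \<tau> {p, q} = act_sign \<tau> {q} * sg p {q} * sg (\<tau> p) (\<tau> ` {q})"
    using assms by (intro act_sign_insert) auto
  moreover have "sg a {b} = (if b < a then -1 else 1)" for a b
    using sg_insert[of b "{}" a] by (simp add: sg_def)
  ultimately show ?thesis using assms 1 by (auto simp: neq_iff)
qed

text \<open>Two positions share an odd colour. Composing with their transposition permutes the
  stabilizer and reverses the sign, so the sum is its own negative.\<close>

lemma sum_act_sign_bad:
  assumes "\<not> good_col n c"
  shows "(\<Sum>\<sigma>\<in>stab n c. act_sign (var_perm n \<sigma>) (col_set n c)) = 0"
proof -
  let ?A = "col_set n c"
  obtain x y where xy: "x < n" "y < n" "x \<noteq> y" "c x = c y" "fst (snd (c x)) \<noteq> snd (snd (c x))"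
    using assms by (auto simp: good_col_def)
  let ?p = "transpose x y"
  have p: "?p permutes {0..<n}" using xy by (intro permutes_swap_id) auto
  have cp: "c (?p z) = c z" for z using xy(4) by (auto simp: transpose_def)
  have pst: "?p \<in> stab n c" using p cp by (simp add: stab_def)
  \<comment> \<open>Exactly one flag holds, so \<open>a\<close> and \<open>b\<close> are the two
    thetas or the two xis; they are the only variables of the monomial that the transposition
    moves.\<close>
  define a b where "a = (if fst (snd (c x)) then x else n + x)"
    and "b = (if fst (snd (c x)) then y else n + y)"
  have ab: "a \<noteq> b" "var_perm n ?p a = b" "var_perm n ?p b = a" "a \<in> ?A" "b \<in> ?A"
    using xy by (auto simp: a_def b_def var_perm_def col_set_lo col_set_hi)
  have fx: "var_perm n ?p v = v" if "v \<in> ?A - {a, b}" for v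
  proof (cases "v < n")
    case True
    then have "v \<noteq> x" "v \<noteq> y" using that xy by (auto simp: a_def b_def col_set_lo split: if_splits)
    then show ?thesis using True by (simp add: var_perm_def)
  next
    case False
    then obtain z where z: "v = n + z" by (metis le_add_diff_inverse not_less)
    then have "z \<noteq> x" "z \<noteq> y" using that xy by (auto simp: a_def b_def col_set_hi split: if_splits)
    then show ?thesis using z by (simp add: var_perm_def)
  qed
  have "act_sign (var_perm n ?p) ({a, b} \<union> (?A - {a, b})) = act_sign (var_perm n ?p) {a, b}"
    using ab fx permutes_inj[OF var_perm_permutes[OF p]] by (intro act_sign_fixed) auto
  moreover have "{a, b} \<union> (?A - {a, b}) = ?A" using ab by auto
  ultimately have sp: "act_sign (var_perm n ?p) ?A = -1" using act_sign_pair[OF ab(1-3)] by simp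
  let ?f = "\<lambda>\<sigma>. act_sign (var_perm n \<sigma>) ?A"
  have "(\<Sum>\<sigma>\<in>stab n c. ?f \<sigma>) = (\<Sum>\<sigma>\<in>stab n c. ?f (\<sigma> \<circ> ?p))"
  proof (rule sum.reindex_bij_witness[of _ "\<lambda>\<sigma>. \<sigma> \<circ> ?p" "\<lambda>\<sigma>. \<sigma> \<circ> ?p"])
    fix \<sigma> assume st: "\<sigma> \<in> stab n c"
    have "?p z < n" if "z < n" for z using permutes_in_image[OF p, of z] that by simp
    then show "\<sigma> \<circ> ?p \<in> stab n c" "\<sigma> \<circ> ?p \<in> stab n c"
      using st p cp by (auto simp: stab_def permutes_compose)
    show "\<sigma> \<circ> ?p \<circ> ?p = \<sigma>" "\<sigma> \<circ> ?p \<circ> ?p = \<sigma>" by (auto simp: comp_assoc)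
    show "?f (\<sigma> \<circ> ?p \<circ> ?p) = ?f \<sigma>" by (simp add: comp_assoc)
  qed
  also have "\<dots> = (\<Sum>\<sigma>\<in>stab n c. - ?f \<sigma>)"
  proof (rule sum.cong[OF refl])
    fix \<sigma> assume "\<sigma> \<in> stab n c"
    then have s: "\<sigma> permutes {0..<n}" by (simp add: stab_def)
    show "?f (\<sigma> \<circ> ?p) = - ?f \<sigma>"
      using act_sign_comp[OF s p col_set_sub] stab_col_set[OF pst] sp by simp
  qed
  finally show ?thesis by (simp add: sum_negf)
qed

lemma sum_act_sign_good:
  "good_col n c \<Longrightarrow> (\<Sum>\<sigma>\<in>stab n c. act_sign (var_perm n \<sigma>) (col_set n c)) = of_nat (card (stab n c))"
  by (simp add: act_sign_good)

lemma prod_sum_PiE: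
  fixes f :: "nat \<Rightarrow> 'b \<Rightarrow> 'a::comm_semiring_1"
  assumes "\<And>r. finite (B r)"
  shows "(\<Prod>r\<in>{0..<k}. \<Sum>x\<in>B r. f r x) = (\<Sum>g\<in>PiE {0..<k} B. \<Prod>r\<in>{0..<k}. f r (g r))"
proof (induction k)
  case (Suc k)
  have ins: "{0..<Suc k} = insert k {0..<k}" by auto
  have inj: "inj_on (\<lambda>(y, g). g(k := y)) (B k \<times> PiE {0..<k} B)"
    by (rule inj_combinator) simp
  have "(\<Sum>g\<in>PiE {0..<Suc k} B. \<Prod>r\<in>{0..<Suc k}. f r (g r)) =
      (\<Sum>(y, g)\<in>B k \<times> PiE {0..<k} B. \<Prod>r\<in>{0..<Suc k}. f r ((g(k := y)) r))"
    unfolding ins PiE_insert_eq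
    by (subst sum.reindex[OF inj]) (simp add: split_def o_def)
  also have "\<dots> = (\<Sum>(y, g)\<in>B k \<times> PiE {0..<k} B. f k y * (\<Prod>r\<in>{0..<k}. f r (g r)))"
    by (intro sum.cong refl) (auto simp: ins intro!: prod.cong)
  also have "\<dots> = (\<Sum>y\<in>B k. f k y) * (\<Sum>g\<in>PiE {0..<k} B. \<Prod>r\<in>{0..<k}. f r (g r))"
    by (simp add: sum_product sum.cartesian_product)
  finally show ?case by (simp add: Suc mult.commute)
qed simp

lemma sum_times: "sum f (A \<times> B) = (\<Sum>x\<in>A. \<Sum>y\<in>B. f (x, y))"
  by (simp add: sum.cartesian_product)

lemma const2_simps [simp]: "const2 0 = 0" "const2 1 = 1" "const2 (a + b) = const2 a + const2 b"
  "const2 (a * b) = const2 a * const2 b" "const2 (- a) = - const2 a" "const2 (a - b) = const2 a - const2 b"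
  by (simp_all add: const2_def one_pCons)

lemma const2_sum: "const2 (\<Sum>x\<in>S. f x) = (\<Sum>x\<in>S. const2 (f x))"
  by (induction S rule: infinite_finite_induct) auto

lemma const2_of_nat: "const2 (of_nat m) = of_nat m"
  by (induction m) auto

lemma card_fibres:
  assumes "finite S" "finite Y"
  shows "card {x \<in> S. c x \<in> Y} = (\<Sum>y\<in>Y. card {x \<in> S. c x = y})"
proof -
  have "{x \<in> S. c x \<in> Y} = (\<Union>y\<in>Y. {x \<in> S. c x = y})" by auto
  then show ?thesis using assms by (simp, subst card_UN_disjoint) auto
qed

section \<open>Types of coloured words and orbit counting\<close>

definition Nc :: "nat \<Rightarrow> (nat \<Rightarrow> col) \<Rightarrow> col \<Rightarrow> nat" where
  "Nc n c y = card {x \<in> {0..<n}. c x = y}"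

definition wcols :: "nat \<Rightarrow> nat \<Rightarrow> (nat \<Rightarrow> int) \<Rightarrow> (nat \<Rightarrow> col) set" where
  "wcols n k \<alpha> = {c \<in> {0..<n} \<rightarrow>\<^sub>E ({0..<k} \<times> UNIV). \<forall>r<k. int (card {x \<in> {0..<n}. fst (c x) = r}) = \<alpha> r}"

definition ctrip :: "nat \<Rightarrow> nat \<Rightarrow> (nat \<Rightarrow> col) \<Rightarrow> nat \<Rightarrow> nat \<times> nat \<times> nat" where
  "ctrip n k c = (\<lambda>r\<in>{0..<k}. (Nc n c (r, True, False), Nc n c (r, False, True), Nc n c (r, True, True)))"

text \<open>The triple counts the positions of one letter that carry only theta, only xi, and both;
  the slack up to \<open>m\<close> is filled by positions carrying neither. The bounds by 1 express
  that odd colours do not repeat.\<close>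

definition cont :: "int \<Rightarrow> (nat \<times> nat \<times> nat) set" where
  "cont m = {(a, b, e). a \<le> 1 \<and> b \<le> 1 \<and> int (a + b + e) \<le> m}"

definition wtrip :: "nat \<times> nat \<times> nat \<Rightarrow> rat poly poly" where
  "wtrip = (\<lambda>(a, b, e). U ^ (a + e) * V ^ (b + e))"

text \<open>Complete supersymmetric function of degree \<open>m\<close> in the even variables
  \<open>1\<close> and \<open>U * V\<close> and the odd variables \<open>U\<close> and
  \<open>V\<close>.\<close>

definition hsym :: "int \<Rightarrow> rat poly poly" where
  "hsym m = (\<Sum>t\<in>cont m. wtrip t)"

lemma finite_cont [simp]: "finite (cont m)"
  by (rule finite_subset[of _ "{..1} \<times> {..1} \<times> {..nat m}"]) (auto simp: cont_def)

lemma finite_wcols [simp]: "finite (wcols n k \<alpha>)"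
  unfolding wcols_def by (simp add: finite_PiE)

lemma wcols_mem: "c \<in> wcols n k \<alpha> \<Longrightarrow> x < n \<Longrightarrow> c x \<in> {0..<k} \<times> UNIV"
  using PiE_mem[of c "{0..<n}" "\<lambda>_. {0..<k} \<times> UNIV" x] by (simp add: wcols_def)

lemma UNIV_bool2: "(UNIV :: (bool \<times> bool) set) = {(False, False), (True, False), (False, True), (True, True)}"
  by auto

lemma card_fst_col:
  "card {x \<in> {0..<n}. fst (c x) = r} =
    Nc n c (r, False, False) + Nc n c (r, True, False) + Nc n c (r, False, True) + Nc n c (r, True, True)"
proof -
  have "{x \<in> {0..<n}. fst (c x) = r} = {x \<in> {0..<n}. c x \<in> Pair r ` UNIV}"
    by (auto simp: image_iff) (metis prod.collapse)
  also have "card \<dots> = (\<Sum>y\<in>Pair r ` UNIV. Nc n c y)"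
    unfolding Nc_def by (rule card_fibres) auto
  also have "\<dots> = (\<Sum>y\<in>UNIV. Nc n c (r, y))"
    by (subst sum.reindex) (auto simp: inj_on_def)
  finally show ?thesis by (simp add: UNIV_bool2)
qed

lemma good_col_iff:
  assumes c: "c \<in> wcols n k \<alpha>"
  shows "good_col n c \<longleftrightarrow> (\<forall>r<k. Nc n c (r, True, False) \<le> 1 \<and> Nc n c (r, False, True) \<le> 1)"
proof
  assume g: "good_col n c"
  have N: "Nc n c (r, s, t) \<le> 1" if "s \<noteq> t" for r s t
    unfolding Nc_def One_nat_def
  proof (subst card_le_Suc0_iff_eq, simp, intro ballI)
    fix x y assume "x \<in> {x \<in> {0..<n}. c x = (r, s, t)}" "y \<in> {x \<in> {0..<n}. c x = (r, s, t)}"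
    then show "x = y" using g that unfolding good_col_def by (metis (mono_tags, lifting) atLeastLessThan_iff fst_conv mem_Collect_eq snd_conv)
  qed
  have "True \<noteq> False" "False \<noteq> True" by auto
  from this[THEN N] show "\<forall>r<k. Nc n c (r, True, False) \<le> 1 \<and> Nc n c (r, False, True) \<le> 1" by blast
next
  assume N: "\<forall>r<k. Nc n c (r, True, False) \<le> 1 \<and> Nc n c (r, False, True) \<le> 1"
  show "good_col n c"
    unfolding good_col_def
  proof (intro allI impI, rule ccontr)
    fix x y assume xy: "x < n" "y < n" "x \<noteq> y" "c x = c y" "fst (snd (c x)) \<noteq> snd (snd (c x))"
    obtain r s t where r: "c x = (r, s, t)" by (cases "c x") auto
    have "c x \<in> {0..<k} \<times> UNIV" by (rule wcols_mem[OF c xy(1)])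
    then have "r < k" using r by auto
    then have "card {z \<in> {0..<n}. c z = (r, s, t)} \<le> Suc 0"
      using N xy(5) r by (cases s; cases t) (auto simp: Nc_def)
    then show False
      using xy r by (subst (asm) card_le_Suc0_iff_eq) auto
  qed
qed

lemma ctrip_in:
  assumes c: "c \<in> wcols n k \<alpha>" and g: "good_col n c"
  shows "ctrip n k c \<in> PiE {0..<k} (\<lambda>r. cont (\<alpha> r))"
proof
  fix r assume r: "r \<in> {0..<k}"
  then have "\<alpha> r = int (card {x \<in> {0..<n}. fst (c x) = r})" using c by (simp add: wcols_def)
  then show "ctrip n k c r \<in> cont (\<alpha> r)"
    using r g unfolding good_col_iff[OF c] card_fst_col by (simp add: ctrip_def cont_def)
qed (simp add: ctrip_def)

lemma exists_col:
  assumes b: "\<beta> \<in> PiE {0..<k} (\<lambda>r. cont (\<alpha> r))" and n: "(\<Sum>r\<in>{0..<k}. \<alpha> r) = int n"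
  obtains c where "c \<in> wcols n k \<alpha>" "ctrip n k c = \<beta>"
proof -
  define a where "a r = fst (\<beta> r)" for r
  define b' where "b' r = fst (snd (\<beta> r))" for r
  define e where "e r = snd (snd (\<beta> r))" for r
  have \<beta>: "\<beta> r = (a r, b' r, e r)" for r by (simp add: a_def b'_def e_def)
  have le: "a r \<le> 1" "b' r \<le> 1" "int (a r + b' r + e r) \<le> \<alpha> r" if "r < k" for r
    using PiE_mem[OF b, of r] that unfolding \<beta> by (simp_all add: cont_def)
  \<comment> \<open>The multiset of colours with the prescribed multiplicities, completed by
    positions carrying neither variable; any listing of it is the required word.\<close>
  define M where "M = (\<Sum>r\<in>{0..<k}. replicate_mset (nat (\<alpha> r) - a r - b' r - e r) (r, False, False) +
    replicate_mset (a r) (r, True, False) + replicate_mset (b' r) (r, False, True) +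
    replicate_mset (e r) (r, True, True))"
  have cnt: "count M (r, s, t) = (if r < k then
      (if s then if t then e r else a r else if t then b' r else nat (\<alpha> r) - a r - b' r - e r) else 0)" for r s t
  proof -
    have "count M (r, s, t) = (\<Sum>r'\<in>{0..<k}. if r' = r then
        (if s then if t then e r else a r else if t then b' r else nat (\<alpha> r) - a r - b' r - e r) else 0)"
      unfolding M_def count_sum by (intro sum.cong refl) auto
    then show ?thesis by simp
  qed
  have "size M = (\<Sum>r\<in>{0..<k}. nat (\<alpha> r))"
    unfolding M_def size_multiset_sum using le by (intro sum.cong refl) fastforce
  also have "int \<dots> = (\<Sum>r\<in>{0..<k}. \<alpha> r)"
    unfolding of_nat_sum using le by (intro sum.cong refl) fastforce
  finally have size: "size M = n" using n by simp
  obtain xs where xs: "mset xs = M" using ex_mset by blast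
  then have len: "length xs = n" using size by auto
  define c where "c = (\<lambda>x\<in>{0..<n}. xs ! x)"
  have N: "Nc n c y = count M y" for y
  proof -
    have "{x \<in> {0..<n}. c x = y} = {i. i < length xs \<and> y = xs ! i}"
      using len by (auto simp: c_def)
    then show ?thesis
      unfolding Nc_def xs[symmetric] count_mset count_list_eq_length_filter length_filter_conv_card by simp
  qed
  have "c \<in> {0..<n} \<rightarrow>\<^sub>E ({0..<k} \<times> UNIV)"
  proof
    fix x assume x: "x \<in> {0..<n}"
    obtain r s t where y: "xs ! x = (r, s, t)" by (cases "xs ! x") auto
    have "xs ! x \<in># M" using x len unfolding xs[symmetric] by simp
    then have "count M (r, s, t) \<noteq> 0" unfolding y by (metis count_eq_zero_iff)
    then have "r < k" unfolding cnt by (metis (full_types))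
    then show "c x \<in> {0..<k} \<times> UNIV" using x y by (simp add: c_def)
  qed (simp add: c_def)
  moreover have "int (card {x \<in> {0..<n}. fst (c x) = r}) = \<alpha> r" if "r < k" for r
    unfolding card_fst_col N cnt using le[OF that] that by simp
  ultimately have "c \<in> wcols n k \<alpha>" by (simp add: wcols_def)
  moreover have "ctrip n k c r = \<beta> r" for r
  proof (cases "r < k")
    case True
    then show ?thesis unfolding ctrip_def N cnt using \<beta>[of r] by simp
  next
    case False
    then show ?thesis using PiE_arb[OF b, of r] by (simp add: ctrip_def)
  qed
  ultimately show ?thesis using that[of c] by (simp add: fun_eq_iff)
qed

text \<open>Orbit and stabilizer: the coloured words of given content and type form one orbit, and
  the permutations taking \<open>c0\<close> to \<open>c\<close> form a coset of the stabilizer of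
  \<open>c\<close>. The fibres of \<open>\<Phi>\<close> partition the symmetric group.\<close>

lemma sum_card_stab:
  assumes b: "\<beta> \<in> PiE {0..<k} (\<lambda>r. cont (\<alpha> r))" and n: "(\<Sum>r\<in>{0..<k}. \<alpha> r) = int n"
  shows "(\<Sum>c\<in>{c \<in> wcols n k \<alpha>. ctrip n k c = \<beta>}. card (stab n c)) = fact n"
proof -
  let ?X = "{c \<in> wcols n k \<alpha>. ctrip n k c = \<beta>}" and ?S = "{\<rho>. \<rho> permutes {0..<n}}"
  obtain c0 where c0: "c0 \<in> wcols n k \<alpha>" "ctrip n k c0 = \<beta>" by (rule exists_col[OF b n])
  define \<Phi> where "\<Phi> \<rho> = (\<lambda>x\<in>{0..<n}. c0 (\<rho> x))" for \<rho> :: "nat \<Rightarrow> nat"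
  have cardeq: "card {x \<in> {0..<n}. P (\<Phi> \<rho> x)} = card {x \<in> {0..<n}. P (c0 x)}" if r: "\<rho> permutes {0..<n}" for \<rho> P
  proof -
    have "{x \<in> {0..<n}. P (c0 x)} = \<rho> ` {x \<in> {0..<n}. P (\<Phi> \<rho> x)}" (is "?L = \<rho> ` ?R")
    proof
      show "?L \<subseteq> \<rho> ` ?R"
      proof
        fix y assume y: "y \<in> ?L"
        then obtain x where "y = \<rho> x" "x \<in> {0..<n}" using permutes_image[OF r] by blast
        then show "y \<in> \<rho> ` ?R" using y by (auto simp: \<Phi>_def)
      qed
    qed (use permutes_in_image[OF r] in \<open>auto simp: \<Phi>_def\<close>)
    then show ?thesis using permutes_inj_on[OF r] by (simp add: card_image)
  qed
  have \<Phi>: "\<Phi> \<rho> \<in> ?X" if r: "\<rho> permutes {0..<n}" for \<rho>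
  proof -
    have "\<Phi> \<rho> \<in> {0..<n} \<rightarrow>\<^sub>E ({0..<k} \<times> UNIV)"
    proof
      fix x assume x: "x \<in> {0..<n}"
      then have "\<rho> x \<in> {0..<n}" using permutes_in_image[OF r] by blast
      then have "c0 (\<rho> x) \<in> {0..<k} \<times> UNIV" using c0(1) unfolding wcols_def by blast
      then show "\<Phi> \<rho> x \<in> {0..<k} \<times> UNIV" using x by (simp add: \<Phi>_def)
    qed (simp add: \<Phi>_def)
    moreover have "Nc n (\<Phi> \<rho>) y = Nc n c0 y" for y
      unfolding Nc_def by (rule cardeq[OF r])
    ultimately show ?thesis
      using c0 cardeq[OF r, of "\<lambda>y. fst y = _"] by (simp add: wcols_def ctrip_def)
  qed
  have fib: "card {\<rho> \<in> ?S. \<Phi> \<rho> = c} = card (stab n c)" if c: "c \<in> ?X" for c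
  proof -
    \<comment> \<open>Type and content determine every multiplicity: positions with neither flag are
      what remains of the content.\<close>
    have N: "Nc n c y = Nc n c0 y" for y
    proof -
      obtain r s t where y: "y = (r, s, t)" by (cases y) auto
      show ?thesis
      proof (cases "r < k")
        case True
        have "ctrip n k c r = ctrip n k c0 r" using c c0 by simp
        then have e: "Nc n c (r, True, False) = Nc n c0 (r, True, False)"
          "Nc n c (r, False, True) = Nc n c0 (r, False, True)" "Nc n c (r, True, True) = Nc n c0 (r, True, True)"
          using True by (auto simp: ctrip_def)
        have "int (card {x \<in> {0..<n}. fst (c x) = r}) = int (card {x \<in> {0..<n}. fst (c0 x) = r})"
          using c c0 True by (simp add: wcols_def)
        then have "Nc n c (r, False, False) = Nc n c0 (r, False, False)"
          using e unfolding card_fst_col by simp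
        then show ?thesis using e y by (cases s; cases t) auto
      next
        case False
        have "Nc n d (r, s, t) = 0" if d: "d \<in> wcols n k \<alpha>" for d
        proof -
          have "d x \<noteq> (r, s, t)" if "x \<in> {0..<n}" for x
          proof -
            have "d x \<in> {0..<k} \<times> UNIV" using d that unfolding wcols_def by blast
            then show ?thesis using False by auto
          qed
          then show ?thesis by (simp add: Nc_def)
        qed
        then show ?thesis using c c0 y by simp
      qed
    qed
    have "count (image_mset d (mset_set {0..<n})) y = Nc n d y" for d y
      unfolding count_image_mset Nc_def by (simp, intro arg_cong[of _ _ card]) auto
    then have "image_mset c (mset_set {0..<n}) = image_mset c0 (mset_set {0..<n})"
      using N by (intro multiset_eqI) simp
    then obtain p where p: "p permutes {0..<n}" and cp: "\<forall>x\<in>{0..<n}. c x = c0 (p x)"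
      using image_mset_eq_implies_permutes[of "{0..<n}" c c0] by auto
    have ce: "c \<in> extensional {0..<n}" using c by (auto simp: wcols_def PiE_def)
    have "bij_betw (\<lambda>\<sigma>. p \<circ> \<sigma>) (stab n c) {\<rho> \<in> ?S. \<Phi> \<rho> = c}"
    proof (rule bij_betw_byWitness[of _ "\<lambda>\<rho>. inv_into UNIV p \<circ> \<rho>"])
      show "\<forall>\<sigma>\<in>stab n c. inv_into UNIV p \<circ> (p \<circ> \<sigma>) = \<sigma>"
        using permutes_inverses[OF p] by (auto simp: fun_eq_iff)
      show "\<forall>\<rho>\<in>{\<rho> \<in> ?S. \<Phi> \<rho> = c}. p \<circ> (inv_into UNIV p \<circ> \<rho>) = \<rho>"
        using permutes_inverses[OF p] by (auto simp: fun_eq_iff)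
      show "(\<lambda>\<sigma>. p \<circ> \<sigma>) ` stab n c \<subseteq> {\<rho> \<in> ?S. \<Phi> \<rho> = c}"
      proof safe
        fix \<sigma> assume st: "\<sigma> \<in> stab n c"
        then have s: "\<sigma> permutes {0..<n}" by (simp add: stab_def)
        then show "(p \<circ> \<sigma>) permutes {0..<n}" using p by (rule permutes_compose)
        show "\<Phi> (p \<circ> \<sigma>) = c"
        proof
          fix x
          show "\<Phi> (p \<circ> \<sigma>) x = c x"
          proof (cases "x < n")
            case True
            then have "\<sigma> x \<in> {0..<n}" using permutes_in_image[OF s, of x] by simp
            then have "c0 (p (\<sigma> x)) = c (\<sigma> x)" using cp by simp
            then show ?thesis using st True by (simp add: \<Phi>_def stab_def)
          qed (use ce in \<open>simp add: \<Phi>_def extensional_def\<close>)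
        qed
      qed
      show "(\<lambda>\<rho>. inv_into UNIV p \<circ> \<rho>) ` {\<rho> \<in> ?S. \<Phi> \<rho> = c} \<subseteq> stab n c"
      proof safe
        fix \<rho> assume r: "\<rho> permutes {0..<n}" and c: "c = \<Phi> \<rho>"
        have ip: "inv_into UNIV p permutes {0..<n}" by (rule permutes_inv[OF p])
        have "\<Phi> \<rho> ((inv_into UNIV p \<circ> \<rho>) x) = \<Phi> \<rho> x" if "x < n" for x
        proof -
          have "\<rho> x \<in> {0..<n}" "inv_into UNIV p (\<rho> x) \<in> {0..<n}"
            using permutes_in_image[OF r, of x] permutes_in_image[OF ip, of "\<rho> x"] that by simp_all
          then have "c (inv_into UNIV p (\<rho> x)) = c0 (\<rho> x)"
            using cp permutes_inverses[OF p] by simp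
          then show ?thesis using c that by (simp add: \<Phi>_def)
        qed
        then show "inv_into UNIV p \<circ> \<rho> \<in> stab n (\<Phi> \<rho>)"
          unfolding stab_def using permutes_compose[OF r ip] by blast
      qed
    qed
    then show ?thesis by (simp add: bij_betw_same_card)
  qed
  have "fact n = card ?S" using card_permutations[of "{0..<n}" n] by simp
  also have "\<dots> = (\<Sum>\<rho>\<in>?S. 1)" by simp
  also have "\<dots> = (\<Sum>c\<in>?X. \<Sum>\<rho>\<in>{\<rho> \<in> ?S. \<Phi> \<rho> = c}. 1)"
    using \<Phi> by (intro sum.group[symmetric]) (auto simp: finite_permutations)
  also have "\<dots> = (\<Sum>c\<in>?X. card (stab n c))"
    by (intro sum.cong refl) (use fib in simp)
  finally show ?thesis by simp
qed

definition mwt :: "nat \<Rightarrow> nat set \<Rightarrow> rat poly poly" where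
  "mwt n A = U ^ card (A \<inter> {0..<n}) * V ^ card (A \<inter> {n..<2*n})"

lemma mwt_col_set:
  assumes c: "c \<in> wcols n k \<alpha>"
  shows "mwt n (col_set n c) = (\<Prod>r\<in>{0..<k}. wtrip (ctrip n k c r))"
proof -
  have ck: "c x \<in> {0..<k} \<times> UNIV" if "x \<in> {0..<n}" for x using c that unfolding wcols_def by blast
  have "col_set n c \<inter> {0..<n} = {x \<in> {0..<n}. c x \<in> {0..<k} \<times> {(True, False), (True, True)}}"
    using ck by (auto simp: col_set_def mem_Times_iff) (metis (full_types) prod.collapse)
  then have 1: "card (col_set n c \<inter> {0..<n}) = (\<Sum>r\<in>{0..<k}. Nc n c (r, True, False) + Nc n c (r, True, True))"
    by (simp only: card_fibres finite_atLeastLessThan finite_cartesian_product finite.intros sum_times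
        Nc_def[symmetric]) simp
  have "col_set n c \<inter> {n..<2*n} = (+) n ` {x \<in> {0..<n}. c x \<in> {0..<k} \<times> {(False, True), (True, True)}}"
    using ck by (auto simp: col_set_def mem_Times_iff image_iff) (metis (full_types) prod.collapse)+
  then have "card (col_set n c \<inter> {n..<2*n}) = card {x \<in> {0..<n}. c x \<in> {0..<k} \<times> {(False, True), (True, True)}}"
    by (simp add: card_image inj_on_def)
  then have 2: "card (col_set n c \<inter> {n..<2*n}) = (\<Sum>r\<in>{0..<k}. Nc n c (r, False, True) + Nc n c (r, True, True))"
    by (simp only: card_fibres finite_atLeastLessThan finite_cartesian_product finite.intros sum_times
        Nc_def[symmetric]) simp
  show ?thesis
    unfolding mwt_def 1 2 power_sum prod.distrib[symmetric]
    by (intro prod.cong refl) (simp add: wtrip_def ctrip_def)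
qed

section \<open>Pairing with permutation characters\<close>

text \<open>Bigraded trace of \<open>\<sigma>\<close> on the exterior algebra: only monomials
  preserved up to sign reach the diagonal. See \<open>trA_asum\<close>.\<close>

definition asum :: "nat \<Rightarrow> (nat \<Rightarrow> nat) \<Rightarrow> rat poly poly" where
  "asum n \<sigma> = (\<Sum>A\<in>{A. A \<subseteq> {0..<2*n} \<and> var_perm n \<sigma> ` A = A}. const2 (act_sign (var_perm n \<sigma>) A) * mwt n A)"

text \<open>A fixed word together with a fixed monomial is the same as a coloured word stabilized by
  \<open>\<sigma>\<close>; \<open>?j\<close> and \<open>?i\<close> translate between the
  two.\<close>

lemma asum_psum:
  assumes s: "\<sigma> permutes {0..<n}"
  shows "asum n \<sigma> * of_nat (psum_coeff n \<sigma> k \<alpha>) =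
    (\<Sum>c\<in>{c \<in> wcols n k \<alpha>. \<sigma> \<in> stab n c}. const2 (act_sign (var_perm n \<sigma>) (col_set n c)) * mwt n (col_set n c))"
proof -
  let ?A = "{A. A \<subseteq> {0..<2*n} \<and> var_perm n \<sigma> ` A = A}" and ?G = "fixed_words n \<sigma> k \<alpha>"
  let ?F = "\<lambda>A. const2 (act_sign (var_perm n \<sigma>) A) * mwt n A"
  let ?j = "\<lambda>(g, A). \<lambda>x\<in>{0..<n}. (g x, x \<in> A, n + x \<in> A)"
  let ?i = "\<lambda>c. (\<lambda>x\<in>{0..<n}. fst (c x), col_set n c)"
  have lt: "\<sigma> x < n" if "x < n" for x using permutes_in_image[OF s, of x] that by simp
  have "asum n \<sigma> * of_nat (psum_coeff n \<sigma> k \<alpha>) = (\<Sum>x\<in>?G \<times> ?A. ?F (snd x))"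
    unfolding sum_times psum_coeff_eq[OF s] asum_def by (simp add: mult.commute[of _ "of_nat _"])
  also have "\<dots> = (\<Sum>c\<in>{c \<in> wcols n k \<alpha>. \<sigma> \<in> stab n c}. ?F (col_set n c))"
  proof (rule sum.reindex_bij_witness[of _ ?i ?j])
    fix x assume x: "x \<in> ?G \<times> ?A"
    obtain g A where gA: "x = (g, A)" by (cases x)
    then have g: "g \<in> ?G" and A: "A \<subseteq> {0..<2*n}" "var_perm n \<sigma> ` A = A" using x by auto
    have cs: "col_set n (?j x) = A"
    proof
      show "A \<subseteq> col_set n (?j x)"
      proof
        fix v assume v: "v \<in> A"
        show "v \<in> col_set n (?j x)"
        proof (cases "v < n")
          case False
          moreover have "v < 2 * n" using v A(1) by auto
          ultimately have "v = n + (v - n)" "v - n < n" by auto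
          then obtain y where y: "v = n + y" "y < n" by blast
          then show ?thesis using v gA by (simp add: col_set_hi)
        qed (use v gA in \<open>simp add: col_set_lo\<close>)
      qed
    qed (auto simp: gA col_set_def)
    show "?i (?j x) = x"
      unfolding cs using g by (auto simp: gA fixed_words_def PiE_def extensional_def fun_eq_iff)
    show "?F (col_set n (?j x)) = ?F (snd x)" unfolding cs by (simp add: gA)
    have "?j x \<in> wcols n k \<alpha>"
      using g by (auto simp: gA wcols_def fixed_words_def PiE_iff cong: conj_cong)
    moreover have "\<sigma> \<in> stab n (?j x)"
      using g A(2) lt s unfolding var_perm_image_eq_iff[OF s A(1)] by (simp add: gA stab_def fixed_words_def)
    ultimately show "?j x \<in> {c \<in> wcols n k \<alpha>. \<sigma> \<in> stab n c}" by simp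
  next
    fix c assume "c \<in> {c \<in> wcols n k \<alpha>. \<sigma> \<in> stab n c}"
    then have c: "c \<in> wcols n k \<alpha>" and st: "\<sigma> \<in> stab n c" by auto
    show "?j (?i c) = c"
      using c by (auto simp: wcols_def col_set_lo col_set_hi PiE_def extensional_def fun_eq_iff)
    have "(\<lambda>x\<in>{0..<n}. fst (c x)) \<in> ?G"
      using c st lt by (auto simp: fixed_words_def wcols_def stab_def PiE_iff mem_Times_iff cong: conj_cong)
    then show "?i c \<in> ?G \<times> ?A"
      using stab_col_set[OF st] col_set_sub by auto
  qed
  finally show ?thesis .
qed

text \<open>Exchange the sums. For each coloured word the signed sum over its stabilizer is 0 or the
  order of the stabilizer; every type then contributes \<open>fact n\<close> times its weight, and
  the choices for different letters are independent.\<close>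

theorem burnside:
  assumes n: "(\<Sum>r\<in>{0..<k}. \<alpha> r) = int n"
  shows "(\<Sum>\<sigma> | \<sigma> permutes {0..<n}. asum n \<sigma> * of_nat (psum_coeff n \<sigma> k \<alpha>)) =
    fact n * (\<Prod>r\<in>{0..<k}. hsym (\<alpha> r))"
proof -
  let ?S = "{\<sigma>. \<sigma> permutes {0..<n}}" and ?G = "{c \<in> wcols n k \<alpha>. good_col n c}"
  let ?B = "PiE {0..<k} (\<lambda>r. cont (\<alpha> r))"
  let ?s = "\<lambda>\<sigma> c. const2 (act_sign (var_perm n \<sigma>) (col_set n c))" and ?w = "\<lambda>c. mwt n (col_set n c)"
  have fS: "finite ?S" by (simp add: finite_permutations)
  have "(\<Sum>\<sigma>\<in>?S. asum n \<sigma> * of_nat (psum_coeff n \<sigma> k \<alpha>)) =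
      (\<Sum>\<sigma>\<in>?S. \<Sum>c\<in>{c \<in> wcols n k \<alpha>. \<sigma> \<in> stab n c}. ?s \<sigma> c * ?w c)"
    by (intro sum.cong refl) (simp add: asum_psum)
  also have "\<dots> = (\<Sum>c\<in>wcols n k \<alpha>. \<Sum>\<sigma>\<in>{\<sigma> \<in> ?S. \<sigma> \<in> stab n c}. ?s \<sigma> c * ?w c)"
    by (rule sum.swap_restrict[OF fS finite_wcols])
  also have "\<dots> = (\<Sum>c\<in>wcols n k \<alpha>. if good_col n c then of_nat (card (stab n c)) * ?w c else 0)"
  proof (rule sum.cong[OF refl])
    fix c
    have "{\<sigma> \<in> ?S. \<sigma> \<in> stab n c} = stab n c" by (auto simp: stab_def)
    then have "(\<Sum>\<sigma>\<in>{\<sigma> \<in> ?S. \<sigma> \<in> stab n c}. ?s \<sigma> c * ?w c) =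
        const2 (\<Sum>\<sigma>\<in>stab n c. act_sign (var_perm n \<sigma>) (col_set n c)) * ?w c"
      by (simp add: const2_sum sum_distrib_right)
    then show "(\<Sum>\<sigma>\<in>{\<sigma> \<in> ?S. \<sigma> \<in> stab n c}. ?s \<sigma> c * ?w c) =
        (if good_col n c then of_nat (card (stab n c)) * ?w c else 0)"
      using sum_act_sign_good[of n c] sum_act_sign_bad[of n c] by (simp add: const2_of_nat)
  qed
  also have "\<dots> = (\<Sum>c\<in>?G. of_nat (card (stab n c)) * ?w c)"
    by (simp add: sum.inter_filter)
  also have "\<dots> = (\<Sum>\<beta>\<in>?B. \<Sum>c\<in>{c \<in> ?G. ctrip n k c = \<beta>}. of_nat (card (stab n c)) * ?w c)"
  proof (rule sum.group[symmetric])
    show "ctrip n k ` ?G \<subseteq> ?B" using ctrip_in by blast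
  qed (auto intro!: finite_PiE)
  also have "\<dots> = (\<Sum>\<beta>\<in>?B. of_nat (fact n) * (\<Prod>r\<in>{0..<k}. wtrip (\<beta> r)))"
  proof (rule sum.cong[OF refl])
    fix \<beta> assume b: "\<beta> \<in> ?B"
    have "good_col n c" if c: "c \<in> wcols n k \<alpha>" "ctrip n k c = \<beta>" for c
      unfolding good_col_iff[OF c(1)]
    proof (intro allI impI)
      fix r assume r: "r < k"
      then have "ctrip n k c r \<in> cont (\<alpha> r)" using b c(2) by (auto simp: PiE_iff)
      then show "Nc n c (r, True, False) \<le> 1 \<and> Nc n c (r, False, True) \<le> 1"
        using r by (simp add: ctrip_def cont_def)
    qed
    then have "{c \<in> ?G. ctrip n k c = \<beta>} = {c \<in> wcols n k \<alpha>. ctrip n k c = \<beta>}" by auto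
    moreover have "(\<Sum>c\<in>{c \<in> wcols n k \<alpha>. ctrip n k c = \<beta>}. of_nat (card (stab n c)) * ?w c) =
        (\<Sum>c\<in>{c \<in> wcols n k \<alpha>. ctrip n k c = \<beta>}. of_nat (card (stab n c)) * (\<Prod>r\<in>{0..<k}. wtrip (\<beta> r)))"
      by (intro sum.cong refl) (auto simp: mwt_col_set)
    ultimately show "(\<Sum>c\<in>{c \<in> ?G. ctrip n k c = \<beta>}. of_nat (card (stab n c)) * ?w c) =
        of_nat (fact n) * (\<Prod>r\<in>{0..<k}. wtrip (\<beta> r))"
      using sum_card_stab[OF b n] by (simp only: sum_distrib_right[symmetric] of_nat_sum[symmetric])
  qed
  also have "\<dots> = fact n * (\<Prod>r\<in>{0..<k}. hsym (\<alpha> r))"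
    unfolding hsym_def prod_sum_PiE[OF finite_cont] by (simp only: sum_distrib_left of_nat_fact)
  finally show ?thesis .
qed

section \<open>The Jacobi-Trudi determinant\<close>

text \<open>Complete symmetric function of degree \<open>m - 1\<close> in the two variables
  \<open>1\<close> and \<open>U * V\<close>.\<close>

definition geo :: "nat \<Rightarrow> rat poly poly" where
  "geo m = (\<Sum>e<m. (U * V) ^ e)"

lemma geo_simps [simp]: "geo 0 = 0" "geo (Suc m) = geo m + (U * V) ^ m"
  by (simp_all add: geo_def)

lemma geo_add: "geo (c + b) = geo c + (U * V) ^ c * geo b"
  by (induction b) (simp_all add: algebra_simps power_add)

lemma geo_Suc': "geo (Suc m) = 1 + U * V * geo m"
  using geo_add[of 1 m] by simp

text \<open>Jacobi-Trudi for the two-row Schur polynomial of shape \<open>(a - 1, b)\<close> in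
  \<open>1\<close> and \<open>U * V\<close>; for \<open>a = b\<close> both sides vanish.\<close>

lemma geo_cross: "b \<le> a \<Longrightarrow> geo a * geo (Suc b) - geo (Suc a) * geo b = (U * V) ^ b * geo (a - b)"
proof -
  assume "b \<le> a"
  then obtain c where a: "a = c + b" by (metis add.commute le_iff_add)
  have g: "geo a = geo c + (U * V) ^ c * geo b" unfolding a by (rule geo_add)
  have p: "(U * V) ^ a = (U * V) ^ c * (U * V) ^ b" unfolding a by (rule power_add)
  have "a - b = c" using a by simp
  then show ?thesis unfolding geo_simps g p by (simp only: algebra_simps)
qed

lemma hsym_neg: "m < 0 \<Longrightarrow> hsym m = 0"
  by (auto simp: hsym_def cont_def intro!: sum.neutral)

lemma hsym_nat: "hsym (int m) = geo (Suc m) + U * geo m + V * geo m + U * V * geo (m - 1)"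
proof -
  let ?A = "(\<lambda>e. (0, 0, e)) ` {..<Suc m} :: (nat \<times> nat \<times> nat) set"
  let ?B = "(\<lambda>e. (1, 0, e)) ` {..<m} :: (nat \<times> nat \<times> nat) set"
  let ?C = "(\<lambda>e. (0, 1, e)) ` {..<m} :: (nat \<times> nat \<times> nat) set"
  \<comment> \<open>For \<open>m \<le> 1\<close> the truncated difference makes this family empty,
    as it must be: both odd variables together need \<open>m \<ge> 2\<close>.\<close>
  let ?D = "(\<lambda>e. (1, 1, e)) ` {..<m - 1} :: (nat \<times> nat \<times> nat) set"
  have "cont (int m) = ?A \<union> (?B \<union> (?C \<union> ?D))"
    unfolding cont_def by (auto simp: image_iff le_Suc_eq)
  then have "hsym (int m) = sum wtrip ?A + (sum wtrip ?B + (sum wtrip ?C + sum wtrip ?D))"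
    unfolding hsym_def by (simp only:) (subst sum.union_disjoint; (subst sum.union_disjoint; (subst sum.union_disjoint)?)?; auto)
  also have "sum wtrip ?A = geo (Suc m)"
    by (subst sum.reindex) (auto simp: inj_on_def wtrip_def geo_def power_mult_distrib)
  also have "sum wtrip ?B = U * geo m"
    by (subst sum.reindex) (auto simp: inj_on_def wtrip_def geo_def power_mult_distrib sum_distrib_left mult_ac)
  also have "sum wtrip ?C = V * geo m"
    by (subst sum.reindex) (auto simp: inj_on_def wtrip_def geo_def power_mult_distrib sum_distrib_left mult_ac)
  also have "sum wtrip ?D = U * V * geo (m - 1)"
    by (subst sum.reindex) (auto simp: inj_on_def wtrip_def geo_def power_mult_distrib sum_distrib_left mult_ac)
  finally show ?thesis by (simp only: add.assoc)
qed

text \<open>At \<open>U = -1\<close> or \<open>V = -1\<close> numerator and denominator of the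
  generating function cancel, so in positive degree the factor \<open>(1 + U) (1 + V)\<close>
  appears. It is what gets divided out on the side of the traces.\<close>

lemma hsym_pos: "m > 0 \<Longrightarrow> hsym (int m) = (1 + U) * (1 + V) * geo m"
proof -
  assume "m > 0"
  then obtain k where m: "m = Suc k" by (cases m) auto
  have "hsym (int m) = geo (Suc m) + (U + V) * geo m + U * V * geo k"
    unfolding hsym_nat m by (simp add: algebra_simps del: geo_simps)
  also have "geo (Suc m) = 1 + U * V * geo m" by (rule geo_Suc')
  also have "U * V * geo k = geo m - 1" unfolding m geo_Suc' by simp
  finally show ?thesis by (simp add: algebra_simps)
qed

text \<open>Elementary symmetric functions of \<open>U\<close> and \<open>V\<close>, that is, the
  coefficients of \<open>(1 + U t) (1 + V t)\<close>, extended by 0 to all integers.\<close>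

definition ecf :: "int \<Rightarrow> rat poly poly" where
  "ecf m = (if m = 0 then 1 else if m = 1 then U + V else if m = 2 then U * V else 0)"

text \<open>The generating function of \<open>hsym\<close> is \<open>(1 + U t) (1 + V t) / ((1 - t) (1 - U V t))\<close>.\<close>

lemma hsym_rec: "hsym m - (1 + U * V) * hsym (m - 1) + U * V * hsym (m - 2) = ecf m"
proof -
  have h0: "hsym 0 = 1" using hsym_nat[of 0] by simp
  have h1: "hsym 1 = (1 + U) * (1 + V)" using hsym_pos[of 1] by simp
  consider "m < 0" | "m = 0" | "m = 1" | "m = 2" | "m \<ge> 3" by linarith
  then show ?thesis
  proof cases
    case 1
    then show ?thesis by (simp add: hsym_neg ecf_def)
  next
    case 2
    then show ?thesis by (simp add: hsym_neg ecf_def h0)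
  next
    case 3
    then show ?thesis by (simp add: hsym_neg ecf_def h0 h1 algebra_simps)
  next
    case 4
    have "hsym 2 = (1 + U) * (1 + V) * (1 + U * V)" using hsym_pos[of 2] by (simp add: numeral_2_eq_2)
    then show ?thesis using 4 by (simp add: ecf_def h0 h1 algebra_simps)
  next
    case 5
    define k where "k = nat (m - 3)"
    have "m = int (Suc (Suc (Suc k)))" "m - 1 = int (Suc (Suc k))" "m - 2 = int (Suc k)"
      using 5 by (auto simp: k_def)
    then have h: "hsym m = (1 + U) * (1 + V) * geo (Suc (Suc (Suc k)))"
      "hsym (m - 1) = (1 + U) * (1 + V) * geo (Suc (Suc k))"
      "hsym (m - 2) = (1 + U) * (1 + V) * geo (Suc k)"
      using hsym_pos by (metis zero_less_Suc)+
    have "geo (Suc (Suc (Suc k))) - (1 + U * V) * geo (Suc (Suc k)) + U * V * geo (Suc k) = 0"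
      by (simp add: algebra_simps)
    then have "(1 + U) * (1 + V) * (geo (Suc (Suc (Suc k))) - (1 + U * V) * geo (Suc (Suc k)) + U * V * geo (Suc k)) = 0"
      by (simp only: mult_zero_right)
    then have "hsym m - (1 + U * V) * hsym (m - 1) + U * V * hsym (m - 2) = 0"
      unfolding h by (simp only: algebra_simps)
    then show ?thesis using 5 by (simp add: ecf_def)
  qed
qed

section \<open>Evaluation of block triangular determinants\<close>

lemma det_block_lower:
  fixes f :: "nat \<times> nat \<Rightarrow> 'a::idom"
  assumes "\<And>r s. r < a \<Longrightarrow> a \<le> s \<Longrightarrow> s < a + b \<Longrightarrow> f (r, s) = 0"
  shows "det (mat (a + b) (a + b) f) = det (mat a a f) * det (mat b b (\<lambda>(r, s). f (r + a, s + a)))"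
proof -
  have eq: "mat (a + b) (a + b) f = four_block_mat (mat a a f) (0\<^sub>m a b)
      (mat b a (\<lambda>(r, s). f (r + a, s))) (mat b b (\<lambda>(r, s). f (r + a, s + a)))"
    by (rule eq_matI) (auto simp: assms)
  show ?thesis unfolding eq by (rule det_four_block_mat_upper_right_zero) auto
qed

lemma det_block_upper:
  fixes f :: "nat \<times> nat \<Rightarrow> 'a::idom"
  assumes "\<And>r s. s < a \<Longrightarrow> a \<le> r \<Longrightarrow> r < a + b \<Longrightarrow> f (r, s) = 0"
  shows "det (mat (a + b) (a + b) f) = det (mat a a f) * det (mat b b (\<lambda>(r, s). f (r + a, s + a)))"
proof -
  have eq: "mat (a + b) (a + b) f = four_block_mat (mat a a f) (mat a b (\<lambda>(r, s). f (r, s + a)))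
      (0\<^sub>m b a) (mat b b (\<lambda>(r, s). f (r + a, s + a)))"
    by (rule eq_matI) (auto simp: assms)
  show ?thesis unfolding eq by (rule det_four_block_mat_lower_left_zero) auto
qed

lemma det_mat_2: "det (mat 2 2 f) = f (0, 0) * f (1, 1) - f (0, 1) * f (1, 0)"
  for f :: "nat \<times> nat \<Rightarrow> 'a::comm_ring_1"
proof -
  have "det (mat 2 2 f) = (\<Sum>j<2. mat 2 2 f $$ (0, j) * cofactor (mat 2 2 f) 0 j)"
    by (rule laplace_expansion_row) auto
  moreover have "det (mat_delete (mat 2 2 f) 0 0) = f (1, 1)" "det (mat_delete (mat 2 2 f) 0 1) = f (1, 0)"
    by (subst det_single; simp add: mat_delete_def)+
  moreover have "{..<2::nat} = {0, 1}" by auto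
  ultimately show ?thesis by (simp add: cofactor_def)
qed

text \<open>\<open>qint (k + 1)\<close> is the complete symmetric function of degree
  \<open>k\<close> in \<open>U\<close> and \<open>V\<close>; its generating function has denominator
  \<open>(1 - U t) (1 - V t)\<close>.\<close>

lemma qint_rec: "qint (int j + 3) = (U + V) * qint (int j + 2) - U * V * qint (int j + 1)"
proof -
  have q: "qint (int k + 1) = (\<Sum>a<Suc k. U ^ a * V ^ (k - a))" for k
    by (simp add: qint_def atLeast0LessThan nat_add_distrib)
  have step: "(\<Sum>a<Suc (Suc k). U ^ a * V ^ (Suc k - a)) = U ^ Suc k + V * (\<Sum>a<Suc k. U ^ a * V ^ (k - a))" for k
    unfolding sum.lessThan_Suc[of _ "Suc k"] sum_distrib_left
    by (simp add: Suc_diff_le mult_ac)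
  have 1: "qint (int j + 2) = U ^ Suc j + V * qint (int j + 1)"
    using step[of j] q[of "Suc j"] q[of j] by (simp add: algebra_simps)
  have 2: "qint (int j + 3) = U ^ Suc (Suc j) + V * qint (int j + 2)"
    using step[of "Suc j"] q[of "Suc (Suc j)"] q[of "Suc j"] by (simp add: algebra_simps)
  show ?thesis unfolding 2 1 by (simp add: algebra_simps)
qed

text \<open>Dual Jacobi-Trudi for a complete symmetric function. The first row has only the entries
  \<open>U + V\<close> and \<open>U * V\<close>, and the minor of the second has a unit vector as
  first column, so the expansion satisfies the recurrence of \<open>qint\<close>.\<close>

lemma det_ecf_ones: "det (mat j j (\<lambda>(r, s). ecf (1 - int r + int s))) = qint (int j + 1)"
proof (induction j rule: less_induct)
  case (less j)
  let ?D = "\<lambda>j. mat j j (\<lambda>(r, s). ecf (1 - int r + int s))"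
  consider "j = 0" | "j = 1" | k where "j = Suc (Suc k)"
    by (metis One_nat_def not0_implies_Suc)
  then show ?case
  proof cases
    case 1
    then show ?thesis by (simp add: qint_def)
  next
    case 2
    have "det (?D 1) = U + V" by (subst det_single) (auto simp: ecf_def)
    moreover have "qint 2 = U + V" by (simp add: qint_def numeral_2_eq_2 atLeast0LessThan)
    ultimately show ?thesis using 2 by simp
  next
    case (3 k)
    have d0: "mat_delete (?D j) 0 0 = ?D (Suc k)"
      by (rule eq_matI) (auto simp: 3 mat_delete_def algebra_simps)
    have d1: "mat_delete (?D j) 0 1 = mat (1 + k) (1 + k) (\<lambda>(r, s). ecf (if s = 0 then - int r else 1 - int r + int s))"
      by (rule eq_matI) (auto simp: 3 mat_delete_def algebra_simps)
    have "det (mat_delete (?D j) 0 1) = det (mat 1 1 (\<lambda>(r, s). ecf (if s = 0 then - int r else 1 - int r + int s))) *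
        det (mat k k (\<lambda>(r, s). (\<lambda>(r, s). ecf (if s = 0 then - int r else 1 - int r + int s)) (r + 1, s + 1)))"
      unfolding d1 by (rule det_block_upper) (auto simp: ecf_def)
    also have "det (mat 1 1 (\<lambda>(r, s). ecf (if s = 0 then - int r else 1 - int r + int s))) = 1"
      by (subst det_single) (auto simp: ecf_def)
    also have "mat k k (\<lambda>(r, s). (\<lambda>(r, s). ecf (if s = 0 then - int r else 1 - int r + int s)) (r + 1, s + 1)) = ?D k"
      by (rule eq_matI) (auto simp: algebra_simps)
    finally have det1: "det (mat_delete (?D j) 0 1) = det (?D k)" by simp
    have "det (?D j) = (\<Sum>s<j. ?D j $$ (0, s) * cofactor (?D j) 0 s)"
      by (rule laplace_expansion_row) (auto simp: 3)
    also have "\<dots> = (\<Sum>s\<in>{0, 1}. ?D j $$ (0, s) * cofactor (?D j) 0 s)"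
      by (rule sum.mono_neutral_right) (auto simp: 3 ecf_def)
    also have "\<dots> = (U + V) * det (?D (Suc k)) - U * V * det (?D k)"
      using d0 det1 by (simp add: 3 cofactor_def ecf_def)
    also have "\<dots> = (U + V) * qint (int k + 2) - U * V * qint (int k + 1)"
      using less[of k] less[of "Suc k"] 3 by (simp add: algebra_simps)
    also have "\<dots> = qint (int j + 1)" using qint_rec[of k] 3 by (simp add: algebra_simps)
    finally show ?thesis .
  qed
qed

text \<open>The top row of a part 2 starts with \<open>ecf 2 = U * V\<close> and continues with
  \<open>ecf\<close> at arguments above 2, which is zero, so it splits off a factor.\<close>

lemma det_ecf_twos:
  "det (mat (l + j) (l + j) (\<lambda>(r, s). ecf ((if r < l then 2 else 1) - int r + int s))) = (U * V) ^ l * qint (int j + 1)"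
proof (induction l)
  case 0
  then show ?case using det_ecf_ones[of j] by simp
next
  case (Suc l)
  let ?f = "\<lambda>l. \<lambda>(r, s). ecf ((if r < l then 2 else 1) - int r + int s)"
  have "det (mat (1 + (l + j)) (1 + (l + j)) (?f (Suc l))) =
      det (mat 1 1 (?f (Suc l))) * det (mat (l + j) (l + j) (\<lambda>(r, s). ?f (Suc l) (r + 1, s + 1)))"
    by (rule det_block_lower) (auto simp: ecf_def)
  also have "det (mat 1 1 (?f (Suc l))) = U * V"
    by (subst det_single) (auto simp: ecf_def)
  also have "mat (l + j) (l + j) (\<lambda>(r, s). ?f (Suc l) (r + 1, s + 1)) = mat (l + j) (l + j) (?f l)"
    by (rule eq_matI) (auto simp: algebra_simps)
  finally show ?case using Suc by simp
qed

text \<open>Right multiplication by the unitriangular Toeplitz matrix of \<open>(1 - t) (1 - U V t)\<close>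
  (leaving the first two columns alone) makes the Jacobi-Trudi matrix block triangular.\<close>

lemma det_hsym_column_reduce:
  fixes a :: "nat \<Rightarrow> int"
  shows "det (mat k k (\<lambda>(r, s). hsym (a r + int s))) =
    det (mat k k (\<lambda>(r, s). if s < 2 then hsym (a r + int s) else ecf (a r + int s)))"
proof -
  let ?H = "mat k k (\<lambda>(r, s). hsym (a r + int s))"
  let ?c = "\<lambda>s' s. (if s' = s then 1 else 0) +
    (if 2 \<le> s then (if s' = s - 1 then - (1 + U * V) else 0) + (if s' = s - 2 then U * V else 0) else 0)"
  let ?C = "mat k k (\<lambda>(s', s). ?c s' s)"
  have "upper_triangular ?C" unfolding upper_triangular_def by auto
  then have "det ?C = prod_list (diag_mat ?C)" by (rule det_upper_triangular) (rule mat_carrier)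
  also have "diag_mat ?C = replicate k 1"
    by (rule nth_equalityI) (auto simp: diag_mat_def)
  finally have C: "det ?C = 1" by simp
  have "?H * ?C = mat k k (\<lambda>(r, s). if s < 2 then hsym (a r + int s) else ecf (a r + int s))"
  proof (rule eq_matI)
    fix r s assume "r < dim_row (mat k k (\<lambda>(r, s). if s < 2 then hsym (a r + int s) else ecf (a r + int s)))"
      "s < dim_col (mat k k (\<lambda>(r, s). if s < 2 then hsym (a r + int s) else ecf (a r + int s)))"
    then have rs: "r < k" "s < k" by auto
    have "(?H * ?C) $$ (r, s) = (\<Sum>s'\<in>{0..<k}. hsym (a r + int s') * ?c s' s)"
      using rs by (simp add: scalar_prod_def)
    also have "\<dots> = hsym (a r + int s) + (if 2 \<le> s then
        hsym (a r + int (s - 1)) * - (1 + U * V) + hsym (a r + int (s - 2)) * (U * V) else 0)"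
    proof (cases "2 \<le> s")
      case True
      have "(\<Sum>s'\<in>{0..<k}. hsym (a r + int s') * ?c s' s) =
          (\<Sum>s'\<in>{0..<k}. if s' = s then hsym (a r + int s') else 0) +
          ((\<Sum>s'\<in>{0..<k}. if s' = s - 1 then hsym (a r + int s') * - (1 + U * V) else 0) +
           (\<Sum>s'\<in>{0..<k}. if s' = s - 2 then hsym (a r + int s') * (U * V) else 0))"
        unfolding sum.distrib[symmetric] using True by (intro sum.cong refl) (auto simp: algebra_simps)
      also have "\<dots> = hsym (a r + int s) +
          (hsym (a r + int (s - 1)) * - (1 + U * V) + hsym (a r + int (s - 2)) * (U * V))"
        using rs by (simp only: sum.delta finite_atLeastLessThan atLeastLessThan_iff) auto
      finally show ?thesis using True by simp
    next
      case False
      have "(\<Sum>s'\<in>{0..<k}. hsym (a r + int s') * ?c s' s) =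
          (\<Sum>s'\<in>{0..<k}. if s' = s then hsym (a r + int s') else 0)"
        using False by (intro sum.cong refl) auto
      then show ?thesis using False rs by simp
    qed
    also have "\<dots> = (if s < 2 then hsym (a r + int s) else ecf (a r + int s))"
    proof (cases "2 \<le> s")
      case True
      then have e: "a r + int (s - 1) = a r + int s - 1" "a r + int (s - 2) = a r + int s - 2" by auto
      show ?thesis using True hsym_rec[of "a r + int s"] unfolding e by (simp add: algebra_simps)
    qed simp
    finally show "(?H * ?C) $$ (r, s) = mat k k (\<lambda>(r, s). if s < 2 then hsym (a r + int s) else ecf (a r + int s)) $$ (r, s)"
      using rs by simp
  qed auto
  moreover have "det (?H * ?C) = det ?H * det ?C" by (rule det_mult) auto
  ultimately show ?thesis using C by simp
qed

definition jt :: "nat list \<Rightarrow> rat poly poly" where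
  "jt lam = det (mat (length lam) (length lam) (\<lambda>(r, s). hsym (int (lam ! r) - int r + int s)))"

text \<open>After the column reduction the first two rows vanish beyond the second column because
  both parts are at least 2. The upper block gives a two-row Schur polynomial; the lower one
  involves only the parts 2 and 1.\<close>

lemma jt_double_hook:
  assumes "l2 \<le> l1" "2 \<le> l2"
  shows "jt ([l1, l2] @ replicate l 2 @ replicate j 1) =
    ((1 + U) * (1 + V)) ^ 2 * ((U * V) ^ (l2 - 1) * geo (l1 - l2 + 1)) * ((U * V) ^ l * qint (int j + 1))"
proof -
  let ?lam = "[l1, l2] @ replicate l 2 @ replicate j 1"
  let ?g = "\<lambda>(r, s). if s < 2 then hsym (int (?lam ! r) - int r + int s) else ecf (int (?lam ! r) - int r + int s)"
  have "jt ?lam = det (mat (2 + (l + j)) (2 + (l + j)) ?g)"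
    unfolding jt_def by (subst det_hsym_column_reduce) simp
  also have "\<dots> = det (mat 2 2 ?g) * det (mat (l + j) (l + j) (\<lambda>(r, s). ?g (r + 2, s + 2)))"
  proof (rule det_block_lower)
    fix r s :: nat assume "r < 2" "2 \<le> s"
    then show "?g (r, s) = 0" using assms by (cases r) (auto simp: ecf_def)
  qed
  also have "mat (l + j) (l + j) (\<lambda>(r, s). ?g (r + 2, s + 2)) =
      mat (l + j) (l + j) (\<lambda>(r, s). ecf ((if r < l then 2 else 1) - int r + int s))"
    by (rule eq_matI) (auto simp: nth_append algebra_simps)
  also have "det (mat 2 2 ?g) = hsym (int l1) * hsym (int l2) - hsym (int (Suc l1)) * hsym (int (l2 - 1))"
    using assms by (simp add: det_mat_2 of_nat_diff algebra_simps)
  also have "\<dots> = ((1 + U) * (1 + V)) ^ 2 * (geo l1 * geo (Suc (l2 - 1)) - geo (Suc l1) * geo (l2 - 1))"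
  proof -
    \<comment> \<open>All four degrees are positive, the smallest being \<open>l2 - 1\<close>, so
      each entry carries the factor \<open>(1 + U) (1 + V)\<close>.\<close>
    have h: "hsym (int l1) = (1 + U) * (1 + V) * geo l1" "hsym (int l2) = (1 + U) * (1 + V) * geo (Suc (l2 - 1))"
      "hsym (int (Suc l1)) = (1 + U) * (1 + V) * geo (Suc l1)" "hsym (int (l2 - 1)) = (1 + U) * (1 + V) * geo (l2 - 1)"
      using hsym_pos[of l1] hsym_pos[of l2] hsym_pos[of "Suc l1"] hsym_pos[of "l2 - 1"] assms by (simp_all del: geo_simps)
    show ?thesis unfolding h by (simp only: power2_eq_square algebra_simps)
  qed
  also have "geo l1 * geo (Suc (l2 - 1)) - geo (Suc l1) * geo (l2 - 1) = (U * V) ^ (l2 - 1) * geo (l1 - (l2 - 1))"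
    using assms by (intro geo_cross) simp
  also have "l1 - (l2 - 1) = l1 - l2 + 1" using assms by simp
  finally show ?thesis by (simp only: det_ecf_twos)
qed

lemma const2_of_int_sign: "const2 (of_int (sign w)) = of_int (sign w)"
  by (auto simp: sign_def)

text \<open>For each \<open>w\<close> the Frobenius formula asks for the content
  \<open>lam ! r - r + w r\<close>, whose total is \<open>n\<close>; \<open>burnside\<close> turns
  it into a product of values of \<open>hsym\<close>, and the alternating sum is the Leibniz
  formula.\<close>

theorem irr_char_pairing:
  assumes n: "sum_list lam = n"
  shows "(\<Sum>\<sigma> | \<sigma> permutes {0..<n}. asum n \<sigma> * const2 (irr_char lam n \<sigma>)) = fact n * jt lam"
proof -
  let ?k = "length lam"
  let ?a = "\<lambda>w r. int (lam ! r) + int (?k - 1 - r) - int (?k - 1 - w r)"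
  let ?W = "{w. w permutes {0..<?k}}" and ?S = "{\<sigma>. \<sigma> permutes {0..<n}}"
  have a: "?a w r = int (lam ! r) - int r + int (w r)" if "w permutes {0..<?k}" "r < ?k" for w r
  proof -
    have "w r < ?k" using permutes_in_image[OF that(1), of r] that(2) by simp
    then show ?thesis using that(2) by simp
  qed
  have sum_a: "(\<Sum>r\<in>{0..<?k}. ?a w r) = int n" if w: "w permutes {0..<?k}" for w
  proof -
    have "(\<Sum>r\<in>{0..<?k}. ?a w r) = (\<Sum>r\<in>{0..<?k}. int (lam ! r) - int r + int (w r))"
      using a[OF w] by (intro sum.cong refl) simp
    also have "\<dots> = int (\<Sum>r\<in>{0..<?k}. lam ! r) - (\<Sum>r\<in>{0..<?k}. int r) + (\<Sum>r\<in>{0..<?k}. int (w r))"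
      by (simp add: sum.distrib sum_subtractf)
    also have "(\<Sum>r\<in>{0..<?k}. int (w r)) = (\<Sum>r\<in>{0..<?k}. int r)"
      using sum.permute[OF w, of int] by (simp add: o_def)
    finally show ?thesis using n by (simp only: sum_list_sum_nth diff_add_cancel)
  qed
  have "(\<Sum>\<sigma>\<in>?S. asum n \<sigma> * const2 (irr_char lam n \<sigma>)) =
      (\<Sum>\<sigma>\<in>?S. \<Sum>w\<in>?W. of_int (sign w) * (asum n \<sigma> * of_nat (psum_coeff n \<sigma> ?k (?a w))))"
    by (intro sum.cong refl)
      (simp add: irr_char_def Let_def const2_sum const2_of_nat const2_of_int_sign sum_distrib_left mult_ac)
  also have "\<dots> = (\<Sum>w\<in>?W. of_int (sign w) * (\<Sum>\<sigma>\<in>?S. asum n \<sigma> * of_nat (psum_coeff n \<sigma> ?k (?a w))))"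
    by (subst sum.swap) (simp only: sum_distrib_left)
  also have "\<dots> = (\<Sum>w\<in>?W. of_int (sign w) * (fact n * (\<Prod>r\<in>{0..<?k}. hsym (?a w r))))"
    by (intro sum.cong refl arg_cong2[of _ _ _ _ "(*)"] burnside sum_a) simp
  also have "\<dots> = (\<Sum>w\<in>?W. fact n * (of_int (sign w) * (\<Prod>r\<in>{0..<?k}. hsym (int (lam ! r) - int r + int (w r)))))"
  proof (rule sum.cong[OF refl])
    fix w assume "w \<in> ?W"
    then have "(\<Prod>r\<in>{0..<?k}. hsym (?a w r)) = (\<Prod>r\<in>{0..<?k}. hsym (int (lam ! r) - int r + int (w r)))"
      by (intro prod.cong refl arg_cong[of _ _ hsym] a) auto
    then show "of_int (sign w) * (fact n * (\<Prod>r\<in>{0..<?k}. hsym (?a w r))) =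
        fact n * (of_int (sign w) * (\<Prod>r\<in>{0..<?k}. hsym (int (lam ! r) - int r + int (w r))))"
      by (simp only: mult.left_commute)
  qed
  also have "\<dots> = fact n * (\<Sum>w\<in>?W. of_int (sign w) * (\<Prod>r\<in>{0..<?k}. hsym (int (lam ! r) - int r + int (w r))))"
    by (simp only: sum_distrib_left)
  also have "(\<Sum>w\<in>?W. of_int (sign w) * (\<Prod>r\<in>{0..<?k}. hsym (int (lam ! r) - int r + int (w r)))) = jt lam"
    unfolding jt_def det_def'[OF mat_carrier]
  proof (intro sum.cong refl arg_cong2[of _ _ _ _ "(*)"] prod.cong)
    fix w r assume "w \<in> ?W" "r \<in> {0..<?k}"
    then show "hsym (int (lam ! r) - int r + int (w r)) =
        mat ?k ?k (\<lambda>(r, s). hsym (int (lam ! r) - int r + int s)) $$ (r, w r)"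
      using permutes_in_image[of w "{0..<?k}" r] by simp
  qed
  finally show ?thesis .
qed

section \<open>Coefficient extraction\<close>

text \<open>Integer exponents with value 0 outside the quadrant make multiplication by
  \<open>U\<close> or \<open>V\<close> an unconditional shift of indices.\<close>

definition cf :: "rat poly poly \<Rightarrow> int \<Rightarrow> int \<Rightarrow> rat" where
  "cf P i j = (if i < 0 \<or> j < 0 then 0 else poly.coeff (poly.coeff P (nat j)) (nat i))"

lemma cf_neg: "i < 0 \<or> j < 0 \<Longrightarrow> cf P i j = 0"
  by (simp add: cf_def)

lemma cf_add: "cf (P + Q) i j = cf P i j + cf Q i j"
  and cf_diff: "cf (P - Q) i j = cf P i j - cf Q i j"
  and cf_0: "cf 0 i j = 0"
  by (simp_all add: cf_def)

lemma cf_sum: "cf (\<Sum>x\<in>S. f x) i j = (\<Sum>x\<in>S. cf (f x) i j)"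
  by (induction S rule: infinite_finite_induct) (auto simp: cf_add cf_0)

lemma cf_const2: "cf (const2 c * P) i j = c * cf P i j"
  by (simp add: cf_def const2_def)

lemma cf_U: "cf (U * P) i j = cf P (i - 1) j"
proof -
  have "poly.coeff (U * P) k = pCons 0 (poly.coeff P k)" for k by (simp add: U_def)
  then show ?thesis by (auto simp: cf_def coeff_pCons nat_diff_distrib split: nat.split)
qed

lemma cf_V: "cf (V * P) i j = cf P i (j - 1)"
proof -
  have "V * P = pCons 0 P" by (simp add: V_def)
  then show ?thesis by (auto simp: cf_def coeff_pCons nat_diff_distrib split: nat.split)
qed

lemma cf_U_pow: "cf (U ^ a * P) i j = cf P (i - int a) j"
  by (induction a arbitrary: i) (simp_all add: cf_U mult.assoc algebra_simps)

lemma cf_V_pow: "cf (V ^ b * P) i j = cf P i (j - int b)"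
  by (induction b arbitrary: j) (simp_all add: cf_V mult.assoc algebra_simps)

lemma cf_1: "cf 1 i j = (if i = 0 \<and> j = 0 then 1 else 0)"
  by (auto simp: cf_def one_pCons coeff_pCons split: nat.splits)

lemma cf_monomial: "cf (const2 c * U ^ a * V ^ b) i j = (if i = int a \<and> j = int b then c else 0)"
proof -
  have "const2 c * U ^ a * V ^ b = const2 c * (U ^ a * (V ^ b * 1))" by simp
  then show ?thesis by (simp only: cf_const2 cf_U_pow cf_V_pow cf_1) simp
qed

lemma cf_eqI: "(\<And>i j. cf P i j = cf Q i j) \<Longrightarrow> P = Q"
proof (intro poly_eqI)
  fix a b assume "\<And>i j. cf P i j = cf Q i j"
  from this[of "int b" "int a"] show "poly.coeff (poly.coeff P a) b = poly.coeff (poly.coeff Q a) b"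
    by (simp add: cf_def)
qed

text \<open>Division by \<open>1 + t\<close>: once the negative part is known, each value is
  determined by the one before. It removes the factors \<open>1 + U\<close> and
  \<open>1 + V\<close>.\<close>

lemma pair_sum_unique:
  fixes f g :: "int \<Rightarrow> rat"
  assumes rec: "\<And>i. f i + f (i - 1) = g i + g (i - 1)" and neg: "\<And>i. i < 0 \<Longrightarrow> f i = g i"
  shows "f i = g i"
proof -
  have "f (int k) = g (int k)" for k
  proof (induction k)
    case 0
    show ?case using rec[of 0] neg[of "-1"] by simp
  next
    case (Suc k)
    then show ?case using rec[of "int (Suc k)"] by simp
  qed
  then show ?thesis using neg by (cases "i < 0") (auto elim: nonneg_int_cases simp: not_less)
qed

lemma one_minus_geo: "(1 - U * V) * geo m = 1 - (U * V) ^ m"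
  using geo_Suc'[of m] by (simp add: algebra_simps)

lemma cf_one_minus: "cf R i j - cf R (i - 1) (j - 1) = cf ((1 - U * V) * R) i j"
  unfolding left_diff_distrib mult.assoc cf_diff cf_U cf_V by simp

section \<open>An \<open>sl\<^sub>2\<close> lemma\<close>

text \<open>Coefficients for inverting \<open>X * Y\<close> on weight \<open>h\<close> by a series
  in \<open>Y ^ m * X ^ m\<close>. As \<open>X * Y\<close> sends term \<open>m\<close> to term
  \<open>m + 1\<close> plus \<open>(m + 1) * (h + m)\<close> times itself, this recursion makes the
  series collapse to the identity.\<close>

fun cas :: "rat \<Rightarrow> nat \<Rightarrow> rat" where
  "cas h 0 = 1 / h"
| "cas h (Suc m) = - cas h m / ((of_nat m + 2) * (h + of_nat m + 1))"

definition cas_op :: "nat \<Rightarrow> rat \<Rightarrow> lop \<Rightarrow> lop \<Rightarrow> lop" where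
  "cas_op M h X Y = (\<Sum>m<M. scal (cas h m) * (Y ^ m * X ^ m))"

lemma cas_Suc: "h > 0 \<Longrightarrow> cas h (Suc m) * ((of_nat m + 2) * (h + of_nat m + 1)) = - cas h m"
proof -
  assume "h > 0"
  then have "(of_nat m + 2) * (h + of_nat m + 1) \<noteq> 0"
    by (metis (no_types, opaque_lifting) add_pos_nonneg add_nonneg_pos mult_eq_0_iff of_nat_0_le_iff
        less_irrefl zero_less_numeral zero_le_one)
  then show ?thesis by simp
qed

context
  fixes X Y :: lop and K :: "int \<Rightarrow> ext set" and c :: rat
  assumes X: "\<And>k g. g \<in> K k \<Longrightarrow> app X g \<in> K (k - 1)"
    and Y: "\<And>k g. g \<in> K k \<Longrightarrow> app Y g \<in> K (k + 1)"
    and XY: "\<And>k g. g \<in> K k \<Longrightarrow> app X (app Y g) = app Y (app X g) + scl (c - 2 * of_int k) g"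
begin

lemma X_pow: "g \<in> K k \<Longrightarrow> app (X ^ m) g \<in> K (k - int m)"
proof (induction m)
  case (Suc m)
  have "k - int m - 1 = k - int (Suc m)" by simp
  then show ?case using X[OF Suc.IH[OF Suc.prems]] by (simp only: app_power_Suc(1))
qed simp

lemma Y_pow: "g \<in> K k \<Longrightarrow> app (Y ^ m) g \<in> K (k + int m)"
proof (induction m)
  case (Suc m)
  have "k + int m + 1 = k + int (Suc m)" by simp
  then show ?case using Y[OF Suc.IH[OF Suc.prems]] by (simp only: app_power_Suc(1))
qed simp

lemma X_Y_pow:
  assumes g: "g \<in> K k"
  shows "app X (app (Y ^ Suc m) g) =
    app (Y ^ Suc m) (app X g) + scl ((of_nat m + 1) * (c - 2 * of_int k - of_nat m)) (app (Y ^ m) g)"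
proof (induction m)
  case 0
  show ?case using XY[OF g] by simp
next
  case (Suc m)
  have "app X (app (Y ^ Suc (Suc m)) g) = app X (app Y (app (Y ^ Suc m) g))"
    by (simp only: app_power_Suc(1))
  also have "\<dots> = app Y (app X (app (Y ^ Suc m) g)) + scl (c - 2 * of_int (k + int (Suc m))) (app (Y ^ Suc m) g)"
    by (rule XY[OF Y_pow[OF g]])
  also have "\<dots> = app (Y ^ Suc (Suc m)) (app X g) +
      (scl ((of_nat m + 1) * (c - 2 * of_int k - of_nat m)) (app (Y ^ Suc m) g) +
       scl (c - 2 * of_int (k + int (Suc m))) (app (Y ^ Suc m) g))"
    unfolding Suc app_add app_scl by (simp only: app_power_Suc(1) add.assoc)
  also have "\<dots> = app (Y ^ Suc (Suc m)) (app X g) +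
      scl ((of_nat (Suc m) + 1) * (c - 2 * of_int k - of_nat (Suc m))) (app (Y ^ Suc m) g)"
    by (simp only: scl.scale_left_distrib[symmetric]) (simp add: algebra_simps del: power_Suc)
  finally show ?case .
qed

text \<open>Counterpart of \<open>X_Y_pow\<close> for the other side: that one yields the right
  inverse of \<open>X * Y\<close>, this one the left inverse.\<close>

lemma X_pow_Y:
  assumes g: "g \<in> K k"
  shows "app (X ^ Suc m) (app Y g) =
    app Y (app (X ^ Suc m) g) + scl ((of_nat m + 1) * (c - 2 * of_int k + of_nat m)) (app (X ^ m) g)"
proof (induction m)
  case 0
  show ?case using XY[OF g] by simp
next
  case (Suc m)
  have "app (X ^ Suc (Suc m)) (app Y g) = app X (app (X ^ Suc m) (app Y g))"
    by (simp only: app_power_Suc(1))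
  also have "\<dots> = app X (app Y (app (X ^ Suc m) g)) +
      scl ((of_nat m + 1) * (c - 2 * of_int k + of_nat m)) (app (X ^ Suc m) g)"
    unfolding Suc app_add app_scl by (simp only: app_power_Suc(1))
  also have "\<dots> = app Y (app (X ^ Suc (Suc m)) g) +
      (scl (c - 2 * of_int (k - int (Suc m))) (app (X ^ Suc m) g) +
       scl ((of_nat m + 1) * (c - 2 * of_int k + of_nat m)) (app (X ^ Suc m) g))"
    unfolding XY[OF X_pow[OF g]] by (simp only: app_power_Suc(1) add.assoc)
  also have "\<dots> = app Y (app (X ^ Suc (Suc m)) g) +
      scl ((of_nat (Suc m) + 1) * (c - 2 * of_int k + of_nat (Suc m))) (app (X ^ Suc m) g)"
    by (simp only: scl.scale_left_distrib[symmetric]) (simp add: algebra_simps del: power_Suc)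
  finally show ?case .
qed

lemma cas_telescope:
  assumes h: "h > 0" and M: "z M = (0 :: ext)"
  shows "(\<Sum>m<M. scl (cas h m) (z (Suc m) + scl ((of_nat m + 1) * (h + of_nat m)) (z m))) = z 0"
proof -
  \<comment> \<open>In this normalization \<open>cas_Suc\<close> reads
    \<open>cas h m = - s (Suc m)\<close>, so the sum telescopes from \<open>s 0 = 1\<close>.\<close>
  define s where "s m = cas h m * ((of_nat m + 1) * (h + of_nat m))" for m
  have s0: "s 0 = 1" using h by (simp add: s_def)
  have sS: "cas h m = - s (Suc m)" for m
    using cas_Suc[OF h, of m] by (simp add: s_def algebra_simps)
  have "(\<Sum>m<M. scl (cas h m) (z (Suc m) + scl ((of_nat m + 1) * (h + of_nat m)) (z m))) =
      (\<Sum>m<M. scl (s m) (z m) - scl (s (Suc m)) (z (Suc m)))"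
    by (intro sum.cong refl)
      (simp add: scl.scale_right_distrib s_def[symmetric], simp add: sS del: cas.simps)
  also have "\<dots> = scl (s 0) (z 0) - scl (s M) (z M)"
    by (rule sum_lessThan_telescope')
  finally show ?thesis using M s0 by simp
qed

text \<open>The sets \<open>K k\<close> are weight spaces of weight \<open>c - 2 * k\<close>.
  Positive weight keeps the denominators of \<open>cas\<close> away from zero, and nilpotency of
  \<open>X\<close> on \<open>g\<close> makes \<open>M\<close> terms enough.\<close>

lemma cas_op_inverse:
  assumes g: "g \<in> K k" and h: "h = c - 2 * of_int k" "h > 0" and nil: "app (X ^ M) g = 0"
  shows "app X (app Y (app (cas_op M h X Y) g)) = g"
    and "app (cas_op M h X Y) (app X (app Y g)) = g"
proof -
  define z where "z m = app (Y ^ m) (app (X ^ m) g)" for m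
  have zM: "z M = 0" by (simp add: z_def nil)
  have 1: "app X (app Y (z m)) = z (Suc m) + scl ((of_nat m + 1) * (h + of_nat m)) (z m)" for m
  proof -
    have e: "c - 2 * of_int (k - int m) - of_nat m = h + of_nat m" using h by simp
    have "app X (app Y (z m)) = app X (app (Y ^ Suc m) (app (X ^ m) g))"
      by (simp only: z_def app_power_Suc(1))
    also have "\<dots> = z (Suc m) + scl ((of_nat m + 1) * (h + of_nat m)) (z m)"
      using X_Y_pow[OF X_pow[OF g, of m], of m] unfolding e z_def by (simp only: app_power_Suc(1)[of X])
    finally show ?thesis .
  qed
  have 2: "app (Y ^ m) (app (X ^ m) (app X (app Y g))) =
      z (Suc m) + scl ((of_nat m + 1) * (h + of_nat m)) (z m)" for m
  proof -
    have "app (X ^ m) (app X (app Y g)) = app (X ^ Suc m) (app Y g)"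
      by (simp only: app_power_Suc(2))
    then show ?thesis
      using X_pow_Y[OF g, of m] unfolding h(1)[symmetric] z_def
      by (simp only: app_add app_scl app_power_Suc(2)[of Y])
  qed
  have "app X (app Y (app (cas_op M h X Y) g)) = (\<Sum>m<M. scl (cas h m) (app X (app Y (z m))))"
    unfolding cas_op_def z_def by (simp only: app_lop_sum app_sum app_scl times_lop.rep_eq app_scal)
  also have "\<dots> = z 0" unfolding 1 by (rule cas_telescope[where z = z, OF h(2) zM])
  finally show "app X (app Y (app (cas_op M h X Y) g)) = g" by (simp add: z_def)
  have "app (cas_op M h X Y) (app X (app Y g)) =
      (\<Sum>m<M. scl (cas h m) (app (Y ^ m) (app (X ^ m) (app X (app Y g)))))"
    unfolding cas_op_def by (simp only: app_lop_sum app_sum app_scl times_lop.rep_eq app_scal)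
  also have "\<dots> = z 0" unfolding 2 by (rule cas_telescope[where z = z, OF h(2) zM])
  finally show "app (cas_op M h X Y) (app X (app Y g)) = g" by (simp add: z_def)
qed

end

lemma cas_op_commute:
  assumes "T * X = X * T" "T * Y = Y * T"
  shows "T * cas_op M h X Y = cas_op M h X Y * T"
proof -
  have X: "T * X ^ m = X ^ m * T" for m
    by (induction m) (simp_all add: assms mult.assoc, metis assms(1) mult.assoc)
  have Y: "T * Y ^ m = Y ^ m * T" for m
    by (induction m) (simp_all add: assms mult.assoc, metis assms(2) mult.assoc)
  have "T * (scal a * (Y ^ m * X ^ m)) = scal a * (Y ^ m * X ^ m) * T" for a m
    by (metis X Y mult.assoc scal_comm)
  then show ?thesis by (simp add: cas_op_def sum_distrib_left sum_distrib_right)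
qed

section \<open>Polarized power sums and the bigrading\<close>

lemma commute_mult: "T * A = A * T \<Longrightarrow> T * B = B * T \<Longrightarrow> T * (A * B) = A * B * T"
  and commute_diff: "T * A = A * T \<Longrightarrow> T * B = B * T \<Longrightarrow> T * (A - B) = (A - B) * T"
  and commute_one: "T * 1 = 1 * T"
  for T A B :: lop
  by (metis mult.assoc) (simp_all add: algebra_simps)

lemma lop_eq_neg_self: "T = - T \<Longrightarrow> T = (0::lop)"
proof (rule lop_eqI, rule ext)
  fix f A assume "T = - T"
  then have "app T f = app (- T) f" by simp
  then have "app T f A = - app T f A" by (metis uminus_apply uminus_lop.rep_eq)
  then show "app T f A = app 0 f A" by simp
qed

lemma anticomm_pair:
  fixes x y z :: "'a::ring"
  assumes "x * y = - (y * x)" "x * z = - (z * x)"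
  shows "x * (y * z) = y * z * x"
proof -
  have "x * (y * z) = - (y * x) * z" using assms(1) by (simp flip: mult.assoc)
  also have "\<dots> = - (y * (x * z))" by (simp add: mult.assoc)
  finally show ?thesis by (simp add: assms(2) mult.assoc)
qed

lemma anticomm_sum:
  fixes x y :: "_ \<Rightarrow> lop"
  assumes "\<And>i j. i \<in> S \<Longrightarrow> j \<in> S \<Longrightarrow> x i * y j = - (y j * x i)"
  shows "sum x S * sum y S = - (sum y S * sum x S)"
proof -
  have "sum x S * sum y S = (\<Sum>i\<in>S. \<Sum>j\<in>S. - (y j * x i))"
    unfolding sum_product by (intro sum.cong refl assms)
  also have "\<dots> = (\<Sum>j\<in>S. \<Sum>i\<in>S. - (y j * x i))" by (rule sum.swap)
  finally show ?thesis by (simp add: sum_product sum_negf)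
qed

locale fermions =
  fixes n :: nat
  assumes n_pos: "n > 0"
begin

definition mP :: lop where "mP = (\<Sum>i<n. mul_var i)"
definition mQ :: lop where "mQ = (\<Sum>i<n. mul_var (n + i))"
definition cP :: lop where "cP = (\<Sum>i<n. con_var i)"
definition cQ :: lop where "cQ = (\<Sum>i<n. con_var (n + i))"
definition om :: lop where "om = (\<Sum>i<n. mul_var i * mul_var (n + i))"
text \<open>The reversed order of the factors makes this the adjoint of \<open>om\<close> and fixes
  the signs in \<open>omcom\<close>.\<close>

definition omc :: lop where "omc = (\<Sum>i<n. con_var (n + i) * con_var i)"
definition deg :: lop where
  "deg = (\<Sum>i<n. mul_var i * con_var i + mul_var (n + i) * con_var (n + i))"

abbreviation hn :: lop where "hn \<equiv> scal (1 / of_nat n)"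
abbreviation nn :: lop where "nn \<equiv> scal (of_nat n)"

lemma mPmP: "mP * mP = 0" and mQmQ: "mQ * mQ = 0" and cPcP: "cP * cP = 0" and cQcQ: "cQ * cQ = 0"
  and mQmP: "mQ * mP = - (mP * mQ)" and cQcP: "cQ * cP = - (cP * cQ)"
  unfolding mP_def mQ_def cP_def cQ_def
  by (intro lop_eq_neg_self anticomm_sum mul_mul con_con)+

lemma cPmQ: "cP * mQ = - (mQ * cP)" and cQmP: "cQ * mP = - (mP * cQ)"
  unfolding mP_def mQ_def cP_def cQ_def
  by (rule anticomm_sum, simp add: con_mul)+

lemma sum_con_mul:
  "inj_on e {..<n} \<Longrightarrow> (\<Sum>i<n. con_var (e i)) * (\<Sum>i<n. mul_var (e i)) =
    nn - (\<Sum>i<n. mul_var (e i)) * (\<Sum>i<n. con_var (e i))"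
proof -
  assume "inj_on e {..<n}"
  then have "(\<Sum>i<n. con_var (e i)) * (\<Sum>i<n. mul_var (e i)) =
      (\<Sum>i<n. \<Sum>j<n. (if i = j then 1 else 0) - mul_var (e j) * con_var (e i))"
    unfolding sum_product by (intro sum.cong refl) (auto simp: con_mul inj_on_def)
  also have "\<dots> = of_nat n - (\<Sum>j<n. \<Sum>i<n. mul_var (e j) * con_var (e i))"
    by (simp add: sum_subtractf) (rule sum.swap)
  finally show ?thesis by (simp add: sum_product scal_of_nat)
qed

lemma cPmP: "cP * mP = nn - mP * cP" and cQmQ: "cQ * mQ = nn - mQ * cQ"
  unfolding mP_def mQ_def cP_def cQ_def by (rule sum_con_mul, simp add: inj_on_def)+

lemma mul_om: "mul_var v * om = om * mul_var v"
  unfolding om_def sum_distrib_left sum_distrib_right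
  by (intro sum.cong refl anticomm_pair mul_mul)

lemma con_omc: "con_var v * omc = omc * con_var v"
  unfolding omc_def sum_distrib_left sum_distrib_right
  by (intro sum.cong refl anticomm_pair con_con)

lemma mPom: "om * mP = mP * om" and mQom: "om * mQ = mQ * om"
  unfolding mP_def mQ_def by (simp_all add: sum_distrib_left sum_distrib_right mul_om)

lemma cPomc: "cP * omc = omc * cP" and cQomc: "cQ * omc = omc * cQ"
  unfolding cP_def cQ_def by (simp_all add: sum_distrib_left sum_distrib_right con_omc)

lemma con_mul2: "con_var v * (mul_var w * T) = (if v = w then T else 0) - mul_var w * (con_var v * T)"
  by (simp add: con_mul left_diff_distrib flip: mult.assoc)

lemma omc_mul:
  assumes "j < n"
  shows "omc * mul_var j = mul_var j * omc + con_var (n + j)"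
    and "omc * mul_var (n + j) = mul_var (n + j) * omc - con_var j"
proof -
  have "omc * mul_var j = (\<Sum>i<n. (if i = j then con_var (n + i) else 0) + mul_var j * (con_var (n + i) * con_var i))"
    unfolding omc_def sum_distrib_right using assms
    by (intro sum.cong refl) (auto simp: mult.assoc con_mul con_mul2 right_diff_distrib)
  then show "omc * mul_var j = mul_var j * omc + con_var (n + j)"
    using assms by (simp add: sum.distrib omc_def sum_distrib_left)
  have "omc * mul_var (n + j) = (\<Sum>i<n. mul_var (n + j) * (con_var (n + i) * con_var i) - (if i = j then con_var i else 0))"
    unfolding omc_def sum_distrib_right using assms
    by (intro sum.cong refl) (auto simp: mult.assoc con_mul con_mul2 right_diff_distrib)
  then show "omc * mul_var (n + j) = mul_var (n + j) * omc - con_var j"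
    using assms by (simp add: sum_subtractf omc_def sum_distrib_left)
qed

lemma con_om:
  assumes "j < n"
  shows "con_var j * om = om * con_var j + mul_var (n + j)"
    and "con_var (n + j) * om = om * con_var (n + j) - mul_var j"
proof -
  have "con_var j * om = (\<Sum>i<n. mul_var i * mul_var (n + i) * con_var j + (if i = j then mul_var (n + i) else 0))"
    unfolding om_def sum_distrib_left using assms
    by (intro sum.cong refl) (auto simp: mult.assoc con_mul con_mul2 right_diff_distrib)
  then show "con_var j * om = om * con_var j + mul_var (n + j)"
    using assms by (simp add: sum.distrib om_def sum_distrib_right)
  have "con_var (n + j) * om = (\<Sum>i<n. mul_var i * mul_var (n + i) * con_var (n + j) - (if i = j then mul_var i else 0))"
    unfolding om_def sum_distrib_left using assms
    by (intro sum.cong refl) (auto simp: mult.assoc con_mul con_mul2 right_diff_distrib)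
  then show "con_var (n + j) * om = om * con_var (n + j) - mul_var j"
    using assms by (simp add: sum_subtractf om_def sum_distrib_right)
qed

lemma omcmP: "omc * mP = mP * omc + cQ" and omcmQ: "omc * mQ = mQ * omc - cP"
  and cPom: "cP * om = om * cP + mQ" and cQom: "cQ * om = om * cQ - mP"
  unfolding mP_def mQ_def cP_def cQ_def
  by (simp_all add: sum_distrib_left sum_distrib_right omc_mul con_om sum.distrib sum_subtractf)

text \<open>Each index contributes 1 minus the number of its occupied variables; summing gives
  \<open>n\<close> minus the total degree.\<close>

lemma omcom: "omc * om = om * omc + nn - deg"
proof -
  have "omc * (mul_var i * mul_var (n + i)) = mul_var i * mul_var (n + i) * omc +
      (1 - (mul_var i * con_var i + mul_var (n + i) * con_var (n + i)))" if "i < n" for i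
  proof -
    have "omc * (mul_var i * mul_var (n + i)) = (mul_var i * omc + con_var (n + i)) * mul_var (n + i)"
      using omc_mul(1)[OF that] by (simp flip: mult.assoc)
    also have "\<dots> = mul_var i * (omc * mul_var (n + i)) + con_var (n + i) * mul_var (n + i)"
      by (simp add: distrib_right mult.assoc)
    finally show ?thesis
      using omc_mul(2)[OF that] by (simp add: con_mul right_diff_distrib mult.assoc)
  qed
  then show ?thesis
    unfolding om_def deg_def
    by (simp add: sum_distrib_left sum_distrib_right sum.distrib sum_subtractf scal_of_nat)
qed

text \<open>By \<open>cPom\<close> and \<open>cQom\<close>, \<open>om\<close> moves the kernels of
  the contractions; subtracting \<open>mP * mQ / n\<close> cancels exactly these defects. The change
  lies in the image of \<open>mP\<close>, so modulo \<open>p\<close> the two agree.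
  \<open>La\<close> is the adjoint.\<close>

definition L :: lop where "L = om - hn * (mP * mQ)"
definition La :: lop where "La = omc - hn * (cQ * cP)"
text \<open>Since \<open>cP * mP + mP * cP\<close> is the scalar \<open>n\<close>, this is the
  projection onto the kernel of \<open>cP\<close> along the image of \<open>mP\<close>.\<close>

definition piP :: lop where "piP = 1 - hn * (mP * cP)"
definition piQ :: lop where "piQ = 1 - hn * (mQ * cQ)"
definition prj :: lop where "prj = piQ * piP"

lemma mult2: "x * y = z \<Longrightarrow> x * (y * t) = z * t" for x y z t :: lop
  by (simp flip: mult.assoc)

lemma hn_nn [simp]: "hn * nn = 1" "hn * (nn * T) = T"
  using n_pos by (simp_all add: scal_mult scal_mult2)

text \<open>Rewriting to normal order, multiplications to the left of contractions. The
  \<open>mult2\<close> forms fire inside longer products, and scalars are pulled to the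
  front.\<close>

lemmas basic_rules = mPmP mQmQ cPcP cQcQ mQmP cQcP cPmQ cQmP cPmP cQmQ mPom mQom cPomc cQomc
  omcmP omcmQ cPom cQom
lemmas op_rules = basic_rules basic_rules[THEN mult2] mult.assoc distrib_left distrib_right
  left_diff_distrib right_diff_distrib scal_comm[where T = mP] scal_comm[where T = mQ]
  scal_comm[where T = cP] scal_comm[where T = cQ] scal_comm[where T = om] scal_comm[where T = omc]
  scal_comm2[where T = mP] scal_comm2[where T = mQ]
  scal_comm2[where T = cP] scal_comm2[where T = cQ] scal_comm2[where T = om] scal_comm2[where T = omc]

lemma L_mP: "L * mP = mP * L" and L_mQ: "L * mQ = mQ * L"
  and L_cP: "L * cP = cP * L" and L_cQ: "L * cQ = cQ * L"
  and La_mP: "La * mP = mP * La" and La_mQ: "La * mQ = mQ * La"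
  and La_cP: "La * cP = cP * La" and La_cQ: "La * cQ = cQ * La"
  unfolding L_def La_def by (simp_all add: op_rules)

text \<open>On the common kernel of \<open>cP\<close> and \<open>cQ\<close> the last term disappears
  and the weight is \<open>n - 1 - deg\<close>: the \<open>sl_2\<close> of \<open>n - 1\<close>
  pairs of variables.\<close>

lemma La_L: "La * L = L * La + nn - 1 - deg + hn * (mP * cP + mQ * cQ)"
proof -
  have "La * L = La * om - hn * (La * (mP * mQ))"
    by (simp add: L_def right_diff_distrib scal_comm2)
  also have "La * (mP * mQ) = mP * mQ * La"
    by (metis La_mP La_mQ mult.assoc)
  also have "La * om = om * La + nn - 1 - deg + hn * (mP * cP + mQ * cQ)"
    unfolding La_def by (simp add: omcom op_rules)
  finally show ?thesis by (simp add: L_def left_diff_distrib mult.assoc)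
qed

lemma piP_alt: "piP = hn * (cP * mP)" and piQ_alt: "piQ = hn * (cQ * mQ)"
  unfolding piP_def piQ_def by (simp_all add: op_rules)

lemma piP_mP: "piP * mP = 0" and cP_piP: "cP * piP = 0"
  and piQ_mQ: "piQ * mQ = 0" and cQ_piQ: "cQ * piQ = 0"
  unfolding piP_def piQ_def by (simp_all add: op_rules)

lemma piP_mQ: "piP * mQ = mQ * piP" and piP_cQ: "piP * cQ = cQ * piP"
  and piQ_cP: "piQ * cP = cP * piQ"
  unfolding piP_def piQ_def by (simp_all add: op_rules)

lemma prj_mP: "prj * mP = 0" and prj_mQ: "prj * mQ = 0"
  and cP_prj: "cP * prj = 0" and cQ_prj: "cQ * prj = 0"
  unfolding prj_def
     apply (simp add: mult.assoc piP_mP)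
    apply (simp add: mult.assoc piP_mQ piQ_mQ[THEN mult2])
   apply (simp add: piQ_cP[symmetric, THEN mult2] mult.assoc cP_piP)
  apply (simp add: cQ_piQ[THEN mult2])
  done

lemma prj_commute:
  assumes "T * mP = mP * T" "T * mQ = mQ * T" "T * cP = cP * T" "T * cQ = cQ * T"
  shows "T * prj = prj * T"
  unfolding prj_def piP_def piQ_def
  by (intro commute_mult commute_diff commute_one scal_comm assms)

lemma L_prj: "L * prj = prj * L" and La_prj: "La * prj = prj * La"
  by (intro prj_commute L_mP L_mQ L_cP L_cQ La_mP La_mQ La_cP La_cQ)+

lemma prj_fix: "app cP f = 0 \<Longrightarrow> app cQ f = 0 \<Longrightarrow> app prj f = f"
  by (simp add: prj_def piP_def piQ_def)

text \<open>The complement of \<open>prj\<close> has left factors \<open>mP\<close> and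
  \<open>mQ\<close>, so \<open>prj\<close> changes an element only within the ideal of
  \<open>p\<close> and \<open>q\<close>.\<close>

lemma one_minus_prj: "1 - prj = mP * (hn * cP) + mQ * (hn * cQ * piP)"
  unfolding prj_def piQ_def
  by (simp add: left_diff_distrib mult.assoc scal_comm2) (simp add: piP_def)

end

section \<open>Restriction to sets of monomials\<close>

lemma supp_in_add: "f \<in> supp_in \<A> \<Longrightarrow> g \<in> supp_in \<A> \<Longrightarrow> f + g \<in> supp_in \<A>"
  and supp_in_scl: "f \<in> supp_in \<A> \<Longrightarrow> scl c f \<in> supp_in \<A>"
  and supp_in_diff: "f \<in> supp_in \<A> \<Longrightarrow> g \<in> supp_in \<A> \<Longrightarrow> f - g \<in> supp_in \<A>"
  and supp_in_0: "0 \<in> supp_in \<A>"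
  using subspace_supp_in[of \<A>]
  by (simp_all only: scl.subspace_add scl.subspace_scale scl.subspace_diff scl.subspace_0)

lemma supp_in_mono: "f \<in> supp_in \<A> \<Longrightarrow> \<A> \<subseteq> \<B> \<Longrightarrow> f \<in> supp_in \<B>"
  by (auto simp: supp_in_def)

lemma supp_in_empty: "f \<in> supp_in {} \<Longrightarrow> f = 0"
  by (auto simp: supp_in_def fun_eq_iff)

lift_definition res :: "nat set set \<Rightarrow> lop" is "\<lambda>\<A> f A. if A \<in> \<A> then f A else 0"
  by (auto simp: fun_eq_iff)

lemma res_in: "app (res \<A>) f \<in> supp_in \<A>"
  by (auto simp: res.rep_eq supp_in_def)

lemma res_id: "f \<in> supp_in \<A> \<Longrightarrow> app (res \<A>) f = f"
  by (auto simp: res.rep_eq supp_in_def fun_eq_iff)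

lemma res_disjoint: "f \<in> supp_in \<B> \<Longrightarrow> \<A> \<inter> \<B> = {} \<Longrightarrow> app (res \<A>) f = 0"
  by (auto simp: res.rep_eq supp_in_def fun_eq_iff)

section \<open>Bidegrees and graded operators\<close>

context fermions
begin

text \<open>Bidegrees are integers with empty components out of range, so shifts by
  \<open>-1\<close> create no boundary cases.\<close>

definition bs :: "int \<Rightarrow> int \<Rightarrow> nat set set" where
  "bs i j = {A. A \<subseteq> {0..<2*n} \<and> int (card (A \<inter> {0..<n})) = i \<and> int (card (A \<inter> {n..<2*n})) = j}"

abbreviation gr :: "int \<Rightarrow> int \<Rightarrow> ext set" where
  "gr i j \<equiv> supp_in (bs i j)"

lemma bideg_bs: "bideg n i j = gr (int i) (int j)"
  by (auto simp: bideg_def bs_def supp_in_def ext_alg_def)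

lemma finite_bs [simp]: "finite (bs i j)"
  by (rule finite_subset[of _ "Pow {0..<2*n}"]) (auto simp: bs_def)

lemma bs_Pow: "bs i j \<subseteq> Pow {0..<2*n}"
  by (auto simp: bs_def)

lemma bs_ext: "f \<in> gr i j \<Longrightarrow> f \<in> ext_alg n"
  unfolding ext_alg_supp by (rule supp_in_mono[OF _ bs_Pow])

lemma bs_empty: "i < 0 \<or> i > int n \<Longrightarrow> bs i j = {}"
proof -
  have "card (A \<inter> {0..<n}) \<le> n" for A
    using card_mono[of "{0..<n}" "A \<inter> {0..<n}"] by simp
  then have "0 \<le> i \<and> i \<le> int n" if "A \<in> bs i j" for A
    using that by (auto simp: bs_def)
  then show "i < 0 \<or> i > int n \<Longrightarrow> bs i j = {}" by force
qed

lemma bs_disjoint: "(i, j) \<noteq> (i', j') \<Longrightarrow> bs i j \<inter> bs i' j' = {}"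
  by (auto simp: bs_def)

definition graded :: "lop \<Rightarrow> int \<Rightarrow> int \<Rightarrow> bool" where
  "graded T a b \<longleftrightarrow> (\<forall>i j f. f \<in> gr i j \<longrightarrow> app T f \<in> gr (i + a) (j + b))"

lemma gradedD: "graded T a b \<Longrightarrow> f \<in> gr i j \<Longrightarrow> i' = i + a \<Longrightarrow> j' = j + b \<Longrightarrow>
    app T f \<in> gr i' j'"
  by (simp add: graded_def)

lemma graded_mult:
  "graded S a b \<Longrightarrow> graded T c d \<Longrightarrow> e = a + c \<Longrightarrow> g = b + d \<Longrightarrow> graded (S * T) e g"
  unfolding graded_def times_lop.rep_eq by (simp add: add.assoc[symmetric] add.commute[of a] add.commute[of b])

lemma graded_add: "graded S a b \<Longrightarrow> graded T a b \<Longrightarrow> graded (S + T) a b"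
  and graded_diff: "graded S a b \<Longrightarrow> graded T a b \<Longrightarrow> graded (S - T) a b"
  by (simp_all add: graded_def supp_in_add supp_in_diff)

lemma graded_scal: "graded (scal c) 0 0" and graded_one: "graded 1 0 0" and graded_zero: "graded 0 a b"
  by (simp_all add: graded_def supp_in_scl supp_in_0)

lemma graded_sum: "(\<And>x. x \<in> S \<Longrightarrow> graded (T x) a b) \<Longrightarrow> graded (\<Sum>x\<in>S. T x) a b"
  by (induction S rule: infinite_finite_induct) (auto simp: graded_zero graded_add)

lemma graded_power: "graded T a b \<Longrightarrow> graded (T ^ m) (int m * a) (int m * b)"
proof (induction m)
  case (Suc m)
  then show ?case unfolding power_Suc
    by (intro graded_mult[of T a b]) (auto simp: algebra_simps)
qed (simp add: graded_one)

lemma bs_insert: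
  assumes "v < 2*n" "v \<notin> A"
  shows "insert v A \<in> bs i j \<longleftrightarrow> A \<in> bs (if v < n then i - 1 else i) (if v < n then j else j - 1)"
proof (cases "A \<subseteq> {0..<2*n}")
  case True
  then have "finite A" using finite_subset by blast
  then show ?thesis using assms True by (auto simp: bs_def)
next
  case False
  then show ?thesis by (auto simp: bs_def)
qed

lemma graded_mul_var:
  assumes "v < 2*n" shows "graded (mul_var v) (if v < n then 1 else 0) (if v < n then 0 else 1)"
  unfolding graded_def
proof (intro allI impI)
  fix i j f assume f: "f \<in> gr i j"
  have "A \<in> bs (i + (if v < n then 1 else 0)) (j + (if v < n then 0 else 1))"
    if "app (mul_var v) f A \<noteq> 0" for A
  proof -
    have "v \<in> A" "A - {v} \<in> bs i j"
      using that f by (auto simp: mul_var.rep_eq supp_in_def split: if_splits)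
    then show ?thesis
      using bs_insert[of v "A - {v}"] assms by (auto simp: insert_absorb split: if_splits)
  qed
  then show "app (mul_var v) f \<in> gr (i + (if v < n then 1 else 0)) (j + (if v < n then 0 else 1))"
    by (auto simp: supp_in_def)
qed

lemma graded_con_var:
  assumes "v < 2*n" shows "graded (con_var v) (if v < n then -1 else 0) (if v < n then 0 else -1)"
  unfolding graded_def
proof (intro allI impI)
  fix i j f assume f: "f \<in> gr i j"
  have "A \<in> bs (i + (if v < n then -1 else 0)) (j + (if v < n then 0 else -1))"
    if "app (con_var v) f A \<noteq> 0" for A
  proof -
    have "v \<notin> A" "insert v A \<in> bs i j"
      using that f by (auto simp: con_var.rep_eq supp_in_def split: if_splits)
    then show ?thesis
      using bs_insert[of v "A"] assms by (auto split: if_splits)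
  qed
  then show "app (con_var v) f \<in> gr (i + (if v < n then -1 else 0)) (j + (if v < n then 0 else -1))"
    by (auto simp: supp_in_def)
qed

lemma graded_mP: "graded mP 1 0" and graded_mQ: "graded mQ 0 1"
  and graded_cP: "graded cP (-1) 0" and graded_cQ: "graded cQ 0 (-1)"
  unfolding mP_def mQ_def cP_def cQ_def
     apply (rule graded_sum) subgoal for i using graded_mul_var[of i] by simp
    apply (rule graded_sum) subgoal for i using graded_mul_var[of "n + i"] by simp
   apply (rule graded_sum) subgoal for i using graded_con_var[of i] by simp
  apply (rule graded_sum) subgoal for i using graded_con_var[of "n + i"] by simp
  done

lemma graded_om: "graded om 1 1" and graded_omc: "graded omc (-1) (-1)"
  unfolding om_def omc_def
   apply (rule graded_sum) subgoal for i
    using graded_mul_var[of i] graded_mul_var[of "n + i"] by (auto intro: graded_mult)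
  apply (rule graded_sum) subgoal for i
    using graded_con_var[of i] graded_con_var[of "n + i"] by (auto intro: graded_mult)
  done

lemma graded_L: "graded L 1 1" and graded_La: "graded La (-1) (-1)"
  unfolding L_def La_def
  by (rule graded_diff graded_om graded_omc graded_mult[OF graded_scal graded_mult[OF graded_mP graded_mQ]]
      graded_mult[OF graded_scal graded_mult[OF graded_cQ graded_cP]] | simp)+

lemma graded_piP: "graded piP 0 0" and graded_piQ: "graded piQ 0 0"
  unfolding piP_def piQ_def
  by (rule graded_diff graded_one graded_mult[OF graded_scal graded_mult[OF graded_mP graded_cP]]
      graded_mult[OF graded_scal graded_mult[OF graded_mQ graded_cQ]] | simp)+

lemma graded_prj: "graded prj 0 0"
  unfolding prj_def by (rule graded_mult[OF graded_piQ graded_piP]) auto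

lemma graded_cas_op:
  assumes "graded X a b" "graded Y (- a) (- b)" shows "graded (cas_op M h X Y) 0 0"
  unfolding cas_op_def
  by (intro graded_sum graded_mult[OF graded_scal graded_mult[OF graded_power[OF assms(2)] graded_power[OF assms(1)]]]) auto

lemma res_graded:
  assumes T: "graded T a b" and f: "f \<in> ext_alg n"
  shows "app (res (bs i j)) (app T f) = app T (app (res (bs (i - a) (j - b))) f)"
proof -
  have "app (res (bs i j) * T) f = app (T * res (bs (i - a) (j - b))) f"
  proof (rule app_eq_on[of "Pow {0..<2*n}"])
    fix A assume A: "A \<in> Pow {0..<2*n}"
    define i' j' where "i' = int (card (A \<inter> {0..<n}))" and "j' = int (card (A \<inter> {n..<2*n}))"
    have x: "xmon A \<in> gr i' j'" using A by (intro xmon_in) (auto simp: bs_def i'_def j'_def)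
    have Tx: "app T (xmon A) \<in> gr (i' + a) (j' + b)" by (rule gradedD[OF T x refl refl])
    show "app (res (bs i j) * T) (xmon A) = app (T * res (bs (i - a) (j - b))) (xmon A)"
    proof (cases "i = i' + a \<and> j = j' + b")
      case True
      then show ?thesis using res_id[OF Tx] res_id[OF x] by simp
    next
      case False
      then have "app (res (bs i j)) (app T (xmon A)) = 0"
        by (intro res_disjoint[OF Tx] bs_disjoint) auto
      moreover have "app (res (bs (i - a) (j - b))) (xmon A) = 0"
        using False by (intro res_disjoint[OF x] bs_disjoint) auto
      ultimately show ?thesis by (simp only: times_lop.rep_eq app_0)
    qed
  qed (use f in \<open>simp_all add: ext_alg_supp\<close>)
  then show ?thesis by simp
qed

lemma res_decomp:
  assumes "f \<in> ext_alg n"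
  shows "f = (\<Sum>(i, j)\<in>{..n} \<times> {..n}. app (res (bs (int i) (int j))) f)"
proof
  fix A
  show "f A = (\<Sum>(i, j)\<in>{..n} \<times> {..n}. app (res (bs (int i) (int j))) f) A"
  proof (cases "A \<subseteq> {0..<2*n}")
    case True
    let ?a = "card (A \<inter> {0..<n})" and ?b = "card (A \<inter> {n..<2*n})"
    have le: "?a \<le> n" "?b \<le> n"
      using card_mono[of "{0..<n}" "A \<inter> {0..<n}"] card_mono[of "{n..<2*n}" "A \<inter> {n..<2*n}"] by auto
    have "(\<Sum>(i, j)\<in>{..n} \<times> {..n}. app (res (bs (int i) (int j))) f) A =
        (\<Sum>x\<in>{..n} \<times> {..n}. if x = (?a, ?b) then f A else 0)"
      unfolding sum_fun_eval
      by (intro sum.cong refl) (use True in \<open>auto simp: res.rep_eq bs_def split: if_splits\<close>)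
    then show ?thesis using le by simp
  next
    case False
    then have "f A = 0" using assms by (auto simp: ext_alg_def)
    then have "app (res \<A>) f A = 0" for \<A> by (simp add: res.rep_eq)
    then show ?thesis using \<open>f A = 0\<close> by (simp add: sum_fun_eval split_def)
  qed
qed

subsection \<open>Inverting the Lefschetz operators\<close>

text \<open>Model of the quotient by \<open>p\<close> and \<open>q\<close> inside the exterior
  algebra: \<open>prj\<close> maps onto it and fixes it.\<close>

definition Ks :: "int \<Rightarrow> int \<Rightarrow> ext set" where
  "Ks i j = {g \<in> gr i j. app cP g = 0 \<and> app cQ g = 0}"

lemma Ks_graded:
  assumes "graded T a b" "T * cP = cP * T" "T * cQ = cQ * T" "g \<in> Ks i j" "i' = i + a" "j' = j + b"
  shows "app T g \<in> Ks i' j'"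
proof -
  have "app cP (app T g) = app T (app cP g)" "app cQ (app T g) = app T (app cQ g)"
    using assms(2,3) by (metis times_lop.rep_eq)+
  then show ?thesis using assms by (auto simp: Ks_def intro: gradedD)
qed

lemma prj_Ks: "f \<in> gr i j \<Longrightarrow> app prj f \<in> Ks i j"
proof -
  assume f: "f \<in> gr i j"
  have "app (cP * prj) f = 0" "app (cQ * prj) f = 0" by (simp_all only: cP_prj cQ_prj zero_lop.rep_eq)
  then show ?thesis using gradedD[OF graded_prj f] by (simp add: Ks_def)
qed

lemma Ks_prj: "g \<in> Ks i j \<Longrightarrow> app prj g = g"
  by (rule prj_fix) (auto simp: Ks_def)

lemma deg_bs: "f \<in> gr i j \<Longrightarrow> app deg f = scl (of_int (i + j)) f"
proof
  fix A assume f: "f \<in> gr i j"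
  have mc: "app (mul_var v * con_var v) f A = (if v \<in> A then f A else 0)" for v
    by (auto simp: mul_var.rep_eq con_var.rep_eq insert_absorb)
  show "app deg f A = scl (of_int (i + j)) f A"
  proof (cases "f A = 0")
    case True
    then show ?thesis
      unfolding deg_def app_lop_sum sum_fun_eval by (simp only: plus_lop.rep_eq plus_fun_apply mc) simp
  next
    case False
    then have A: "A \<in> bs i j" using f by (auto simp: supp_in_def)
    have c1: "{..<n} \<inter> A = A \<inter> {0..<n}" by auto
    have c2: "(+) n ` ({..<n} \<inter> {x. n + x \<in> A}) = A \<inter> {n..<2*n}"
    proof
      show "A \<inter> {n..<2*n} \<subseteq> (+) n ` ({..<n} \<inter> {x. n + x \<in> A})"
      proof
        fix x assume "x \<in> A \<inter> {n..<2*n}"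
        then show "x \<in> (+) n ` ({..<n} \<inter> {x. n + x \<in> A})"
          by (intro image_eqI[of _ _ "x - n"]) auto
      qed
    qed auto
    have c3: "card ({..<n} \<inter> {x. n + x \<in> A}) = card (A \<inter> {n..<2*n})"
      unfolding c2[symmetric] by (rule card_image[symmetric]) simp
    have s1: "(\<Sum>i<n. if i \<in> A then f A else 0) = of_nat (card (A \<inter> {0..<n})) * f A"
      by (subst sum.inter_restrict[symmetric]) (simp_all only: c1 sum_constant finite_lessThan)
    have s2: "(\<Sum>i<n. if n + i \<in> A then f A else 0) = of_nat (card (A \<inter> {n..<2*n})) * f A"
      using sum.inter_restrict[of "{..<n}" "\<lambda>_. f A" "{x. n + x \<in> A}"]
      by (simp only: c3 sum_constant finite_lessThan mem_Collect_eq)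
    have "app deg f A = of_nat (card (A \<inter> {0..<n})) * f A + of_nat (card (A \<inter> {n..<2*n})) * f A"
      unfolding deg_def app_lop_sum sum_fun_eval plus_lop.rep_eq plus_fun_apply mc sum.distrib s1 s2 ..
    then show ?thesis using A by (auto simp: bs_def algebra_simps)
  qed
qed

lemma La_L_Ks:
  assumes "g \<in> Ks i j"
  shows "app La (app L g) = app L (app La g) + scl (of_int (int n - 1 - i - j)) g"
proof -
  have g: "app cP g = 0" "app cQ g = 0" and d: "app deg g = scl (of_int (i + j)) g"
    using assms deg_bs by (auto simp: Ks_def)
  have "app (La * L) g = app (L * La + nn - 1 - deg + hn * (mP * cP + mQ * cQ)) g"
    by (simp only: La_L)
  also have "\<dots> = app L (app La g) + (scl (of_nat n) g - g - scl (of_int (i + j)) g)"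
    by (simp add: g d)
  also have "scl (of_nat n) g - g - scl (of_int (i + j)) g = scl (of_int (int n - 1 - i - j)) g"
    by (rule ext) (simp add: algebra_simps)
  finally show ?thesis by (simp only: times_lop.rep_eq)
qed

lemma L_Ks: "g \<in> Ks i j \<Longrightarrow> i' = i + 1 \<Longrightarrow> j' = j + 1 \<Longrightarrow> app L g \<in> Ks i' j'"
  by (rule Ks_graded[OF graded_L L_cP L_cQ])

lemma La_Ks: "g \<in> Ks i j \<Longrightarrow> i' = i - 1 \<Longrightarrow> j' = j - 1 \<Longrightarrow> app La g \<in> Ks i' j'"
  by (rule Ks_graded[OF graded_La La_cP La_cQ]) auto

lemma Ks_zero: "g \<in> Ks i j \<Longrightarrow> i < 0 \<or> i > int n \<Longrightarrow> g = 0"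
  using bs_empty[of i j] supp_in_empty by (auto simp: Ks_def)

lemma La_nilpotent: "g \<in> Ks i j \<Longrightarrow> app (La ^ (n + 1)) g = 0"
proof (cases "i > int n")
  case False
  assume "g \<in> Ks i j"
  then have "app (La ^ m) g \<in> Ks (i - int m) (j - int m)" for m
  proof (induction m)
    case (Suc m)
    then show ?case unfolding app_power_Suc(1) by (intro La_Ks[OF Suc.IH]) auto
  qed simp
  from Ks_zero[OF this[of "n + 1"]] show ?thesis using False by linarith
qed (metis Ks_zero app_0)

lemma L_nilpotent: "g \<in> Ks i j \<Longrightarrow> app (L ^ (n + 1)) g = 0"
proof (cases "i < 0")
  case False
  assume "g \<in> Ks i j"
  then have "app (L ^ m) g \<in> Ks (i + int m) (j + int m)" for m
  proof (induction m)
    case (Suc m)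
    then show ?case unfolding app_power_Suc(1) by (intro L_Ks[OF Suc.IH]) auto
  qed simp
  from Ks_zero[OF this[of "n + 1"]] show ?thesis using False by linarith
qed (metis Ks_zero app_0)

text \<open>Inverse of \<open>La * L\<close> on \<open>Ks i j\<close> below the middle degree,
  written as a polynomial in \<open>L\<close> and \<open>La\<close> so that it is graded and
  equivariant. \<open>n + 1\<close> terms suffice because \<open>La\<close> lowers a degree between
  0 and \<open>n\<close>.\<close>

definition Qop :: "int \<Rightarrow> int \<Rightarrow> lop" where
  "Qop i j = cas_op (n + 1) (of_int (int n - 1 - i - j)) La L"

lemma Qop_inverse:
  assumes g: "g \<in> Ks i j" and ij: "i + j < int n - 1"
  shows "app La (app L (app (Qop i j) g)) = g" "app (Qop i j) (app La (app L g)) = g"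
proof -
  \<comment> \<open>The diagonal through \<open>(i, j)\<close>: one step raises the total degree by
    2, hence the weight \<open>?c - 2 * k\<close>.\<close>
  let ?K = "\<lambda>k. Ks (i + k) (j + k)" and ?c = "of_int (int n - 1 - i - j) :: rat"
  have X: "app La g \<in> ?K (k - 1)" if "g \<in> ?K k" for k g
    by (rule La_Ks[OF that]) auto
  have Y: "app L g \<in> ?K (k + 1)" if "g \<in> ?K k" for k g
    by (rule L_Ks[OF that]) auto
  have XY: "app La (app L g) = app L (app La g) + scl (?c - 2 * of_int k) g" if "g \<in> ?K k" for k g
    using La_L_Ks[OF that] by (simp add: algebra_simps)
  have g': "g \<in> ?K 0" using g by simp
  have "?c > 0" using ij by (simp only: of_int_0_less_iff)
  then show "app La (app L (app (Qop i j) g)) = g" "app (Qop i j) (app La (app L g)) = g"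
    using cas_op_inverse[of ?K La L ?c, OF X Y XY g' _ _ La_nilpotent[OF g], of ?c]
    by (auto simp: Qop_def)
qed

text \<open>The same \<open>sl_2\<close> lemma with \<open>L\<close> and \<open>La\<close>
  exchanged, since above total degree \<open>n - 1\<close> the opposite weight is positive. This
  half of the Lefschetz property puts high degrees into the ideal.\<close>

lemma L_onto:
  assumes g: "g \<in> Ks i j" and ij: "i + j > int n - 1"
  obtains y where "y \<in> gr (i - 1) (j - 1)" "g = app L y"
proof -
  let ?K = "\<lambda>k. Ks (i - k) (j - k)" and ?c = "of_int (i + j - (int n - 1)) :: rat"
  let ?Q = "cas_op (n + 1) ?c L La"
  have X: "app L g \<in> ?K (k - 1)" if "g \<in> ?K k" for k g
    by (rule L_Ks[OF that]) auto
  have Y: "app La g \<in> ?K (k + 1)" if "g \<in> ?K k" for k g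
    by (rule La_Ks[OF that]) auto
  have XY: "app L (app La g) = app La (app L g) + scl (?c - 2 * of_int k) g" if "g \<in> ?K k" for k g
  proof -
    have "app L (app La g) = app La (app L g) - scl (of_int (int n - 1 - (i - k) - (j - k))) g"
      using La_L_Ks[OF that] by simp
    then show ?thesis by (simp add: fun_eq_iff algebra_simps)
  qed
  have g': "g \<in> ?K 0" using g by simp
  have "?c > 0" using ij by (simp only: of_int_0_less_iff)
  then have "app L (app La (app ?Q g)) = g"
    using cas_op_inverse(1)[of ?K L La ?c, OF X Y XY g' _ _ L_nilpotent[OF g], of ?c] by auto
  moreover have "graded ?Q 0 0"
    by (rule graded_cas_op[OF graded_L]) (use graded_La in simp)
  then have "app La (app ?Q g) \<in> gr (i - 1) (j - 1)"
    using g by (intro gradedD[OF graded_La] gradedD[of ?Q]) (auto simp: Ks_def)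
  ultimately show ?thesis using that[of "app La (app ?Q g)"] by simp
qed

text \<open>For \<open>i + j < n\<close> this is, on the common kernel,
  \<open>1 - L (La L)^(-1) La\<close>: the projection onto the kernel of \<open>La\<close> along the
  image of \<open>L\<close>. Preceded by \<open>prj\<close>, it projects along the ideal of
  \<open>p\<close>, \<open>q\<close> and \<open>om\<close>. The inverse is taken one step down the
  diagonal.\<close>

definition Fop :: "int \<Rightarrow> int \<Rightarrow> lop" where
  "Fop i j = prj - L * (Qop (i - 1) (j - 1) * (La * prj))"

lemma graded_Qop: "graded (Qop i j) 0 0"
  unfolding Qop_def by (rule graded_cas_op[OF graded_La]) (use graded_L in simp)

lemma graded_Fop: "graded (Fop i j) 0 0"
  unfolding Fop_def
  by (intro graded_diff graded_prj graded_mult[OF graded_L graded_mult[OF graded_Qop graded_mult[OF graded_La graded_prj]]]) auto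

lemma Fop_commute:
  assumes "T * mP = mP * T" "T * mQ = mQ * T" "T * cP = cP * T" "T * cQ = cQ * T"
    "T * L = L * T" "T * La = La * T"
  shows "T * Fop i j = Fop i j * T"
  unfolding Fop_def Qop_def
  by (intro commute_mult commute_diff prj_commute cas_op_commute assms)

lemma Qop_prj: "Qop i j * prj = prj * Qop i j"
  unfolding Qop_def by (rule cas_op_commute[symmetric]) (simp_all add: L_prj La_prj)

lemma Fop_mP: "Fop i j * mP = 0" and Fop_mQ: "Fop i j * mQ = 0"
  unfolding Fop_def by (simp_all add: left_diff_distrib mult.assoc prj_mP prj_mQ)

text \<open>Modulo the image of \<open>mP\<close>, \<open>om\<close> is \<open>L\<close>, and on the
  image of \<open>L\<close> the subtracted term reproduces \<open>L * prj\<close> because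
  \<open>Qop\<close> is a left inverse.\<close>

lemma Fop_om:
  assumes z: "z \<in> gr (i - 1) (j - 1)" and ij: "i + j < int n"
  shows "app (Fop i j) (app om z) = 0"
proof -
  have om: "om = L + mP * (hn * mQ)" by (simp add: L_def scal_comm2)
  have K: "app prj z \<in> Ks (i - 1) (j - 1)" by (rule prj_Ks[OF z])
  have "app (Fop i j * om) z = app (Fop i j * L) z"
    unfolding om distrib_left mult.assoc[symmetric] Fop_mP by simp
  also have "Fop i j * L = L * prj - L * (Qop (i - 1) (j - 1) * (La * (L * prj)))"
    unfolding Fop_def by (simp add: left_diff_distrib mult.assoc L_prj)
  also have "app \<dots> z = 0"
    using Qop_inverse(2)[OF K] ij by simp
  finally show ?thesis by simp
qed

text \<open>On such vectors \<open>prj\<close> acts as the identity and the subtracted term of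
  \<open>Fop\<close> as zero, whence idempotence.\<close>

lemma Fop_La:
  assumes f: "f \<in> gr i j" and ij: "i + j < int n"
  shows "app La (app (Fop i j) f) = 0" "app prj (app (Fop i j) f) = app (Fop i j) f"
proof -
  have K: "app La (app prj f) \<in> Ks (i - 1) (j - 1)" by (rule La_Ks[OF prj_Ks[OF f]]) auto
  have "app La (app L (app (Qop (i - 1) (j - 1)) (app La (app prj f)))) = app La (app prj f)"
    using ij by (intro Qop_inverse(1)[OF K]) simp
  then show "app La (app (Fop i j) f) = 0" by (simp add: Fop_def app_diff)
  have Q: "Qop i' j' * cP = cP * Qop i' j'" "Qop i' j' * cQ = cQ * Qop i' j'" for i' j'
    unfolding Qop_def by (intro cas_op_commute[symmetric] L_cP[symmetric] La_cP[symmetric]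
        L_cQ[symmetric] La_cQ[symmetric])+
  have "app L (app (Qop (i - 1) (j - 1)) (app La (app prj f))) \<in> Ks i j"
    by (rule L_Ks[OF Ks_graded[OF graded_Qop Q K]]) auto
  then have "app (Fop i j) f \<in> Ks i j"
    using prj_Ks[OF f] by (auto simp: Fop_def Ks_def supp_in_diff app_diff)
  then show "app prj (app (Fop i j) f) = app (Fop i j) f" by (rule Ks_prj)
qed

subsection \<open>Equivariance\<close>

context
  fixes \<sigma> assumes s: "\<sigma> permutes {0..<n}"
begin

lemma var_perm_lo: "i < n \<Longrightarrow> var_perm n \<sigma> i = \<sigma> i"
  and var_perm_hi: "var_perm n \<sigma> (n + i) = n + \<sigma> i"
  by (auto simp: var_perm_def)

lemma sum_perm: "(\<Sum>i<n. g (\<sigma> i)) = (\<Sum>i<n. g i)" for g :: "nat \<Rightarrow> lop"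
  using sum.permute[OF s, of g] by (simp add: o_def atLeast0LessThan)

lemma act_sum_commute:
  assumes "\<And>i. i < n \<Longrightarrow> act_op n \<sigma> * T i = T (\<sigma> i) * act_op n \<sigma>"
  shows "act_op n \<sigma> * (\<Sum>i<n. T i) = (\<Sum>i<n. T i) * act_op n \<sigma>"
proof -
  have "act_op n \<sigma> * (\<Sum>i<n. T i) = (\<Sum>i<n. T (\<sigma> i)) * act_op n \<sigma>"
    unfolding sum_distrib_left sum_distrib_right by (intro sum.cong refl) (simp add: assms)
  then show ?thesis by (simp only: sum_perm)
qed

lemma act_mP: "act_op n \<sigma> * mP = mP * act_op n \<sigma>"
  and act_mQ: "act_op n \<sigma> * mQ = mQ * act_op n \<sigma>"
  and act_cP: "act_op n \<sigma> * cP = cP * act_op n \<sigma>"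
  and act_cQ: "act_op n \<sigma> * cQ = cQ * act_op n \<sigma>"
  and act_om: "act_op n \<sigma> * om = om * act_op n \<sigma>"
  and act_omc: "act_op n \<sigma> * omc = omc * act_op n \<sigma>"
  unfolding mP_def mQ_def cP_def cQ_def om_def omc_def
  by (rule act_sum_commute, simp add: act_mul[OF s] act_con[OF s] act_mul[OF s, THEN mult2]
      act_con[OF s, THEN mult2] var_perm_lo var_perm_hi mult.assoc)+

lemma act_L: "act_op n \<sigma> * L = L * act_op n \<sigma>"
  and act_La: "act_op n \<sigma> * La = La * act_op n \<sigma>"
  unfolding L_def La_def
  by (intro commute_diff commute_mult scal_comm act_mP act_mQ act_cP act_cQ act_om act_omc)+

lemma act_prj: "act_op n \<sigma> * prj = prj * act_op n \<sigma>"
  by (intro prj_commute act_mP act_mQ act_cP act_cQ)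

lemma act_Fop: "act_op n \<sigma> * Fop i j = Fop i j * act_op n \<sigma>"
  by (intro Fop_commute act_mP act_mQ act_cP act_cQ act_L act_La)

lemma graded_act: "graded (act_op n \<sigma>) 0 0"
  unfolding graded_def
proof (intro allI impI)
  fix i j f assume f: "f \<in> gr i j"
  let ?t = "var_perm n \<sigma>"
  have inj: "inj ?t" and im: "?t ` {0..<2*n} = {0..<2*n}"
    using permutes_inj permutes_image var_perm_permutes[OF s] by blast+
  have lo: "?t ` {0..<n} = {0..<n}"
    using permutes_image[OF s] by (auto simp: var_perm_def image_def)
  have "{n..<2*n} = {0..<2*n} - {0..<n}" by auto
  then have hi: "?t ` {n..<2*n} = {n..<2*n}"
    using image_set_diff[OF inj, of "{0..<2*n}" "{0..<n}"] im lo by simp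
  have "W \<in> bs i j" if W: "app (act_op n \<sigma>) f W \<noteq> 0" for W
  proof -
    have "W \<subseteq> {0..<2*n}" using W act_op_outside[OF _ s] by blast
    then obtain A where A: "A \<subseteq> {0..<2*n}" "W = ?t ` A"
      using im subset_imageE by metis
    then have "A \<in> bs i j" using W f act_op_image[OF A(1) s, of f] by (auto simp: supp_in_def)
    moreover have "?t ` A \<inter> {0..<n} = ?t ` (A \<inter> {0..<n})" "?t ` A \<inter> {n..<2*n} = ?t ` (A \<inter> {n..<2*n})"
      using image_Int[OF inj, of A "{0..<n}"] image_Int[OF inj, of A "{n..<2*n}"] lo hi by simp_all
    moreover have "W \<subseteq> {0..<2*n}" using A im by blast
    ultimately show ?thesis
      using A inj_on_subset[OF inj] by (simp add: bs_def card_image)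
  qed
  then show "app (act_op n \<sigma>) f \<in> gr (i + 0) (j + 0)" by (auto simp: supp_in_def)
qed

end

subsection \<open>Traces\<close>

text \<open>\<open>trA\<close>, \<open>trB\<close> and \<open>trC\<close> are the traces on the
  exterior algebra, on its quotient by \<open>p\<close>, and on that by \<open>p\<close> and
  \<open>q\<close>, the quotients being realized as kernels of contractions.\<close>

definition trA :: "int \<Rightarrow> int \<Rightarrow> (nat \<Rightarrow> nat) \<Rightarrow> rat" where
  "trA i j \<sigma> = lop_tr (bs i j) (act_op n \<sigma>)"
definition trB :: "int \<Rightarrow> int \<Rightarrow> (nat \<Rightarrow> nat) \<Rightarrow> rat" where
  "trB i j \<sigma> = lop_tr (bs i j) (piP * act_op n \<sigma>)"
definition trC :: "int \<Rightarrow> int \<Rightarrow> (nat \<Rightarrow> nat) \<Rightarrow> rat" where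
  "trC i j \<sigma> = lop_tr (bs i j) (prj * act_op n \<sigma>)"

text \<open>Split \<open>1 = piP + mP * (hn * cP)\<close>. In the second part cyclicity carries
  \<open>mP\<close> to the other end, where it meets \<open>cP\<close> as
  \<open>hn * (cP * mP) = piP\<close>, one theta-degree lower. This is division by
  \<open>1 + u\<close> for traces.\<close>

lemma trA_rec:
  assumes s: "\<sigma> permutes {0..<n}"
  shows "trA i j \<sigma> = trB i j \<sigma> + trB (i - 1) j \<sigma>"
proof -
  let ?a = "act_op n \<sigma>" let ?S = "hn * (cP * ?a)"
  have "?a = piP * ?a + mP * ?S" by (simp add: piP_def left_diff_distrib scal_comm2 mult.assoc)
  then have "trA i j \<sigma> = trB i j \<sigma> + lop_tr (bs i j) (mP * ?S)"
    unfolding trA_def trB_def by (metis tr_add)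
  also have "lop_tr (bs i j) (mP * ?S) = lop_tr (bs (i - 1) j) (?S * mP)"
  proof (rule tr_cyclic)
    have "graded ?S (-1) 0"
      by (rule graded_mult[OF graded_scal graded_mult[OF graded_cP graded_act[OF s]]]) auto
    then show "app ?S f \<in> gr (i - 1) j" if "f \<in> gr i j" for f
      by (rule gradedD[OF _ that]) auto
    show "app mP f \<in> gr i j" if "f \<in> gr (i - 1) j" for f
      by (rule gradedD[OF graded_mP that]) auto
  qed auto
  also have "?S * mP = piP * ?a"
    by (simp add: piP_alt mult.assoc act_mP[OF s])
  finally show ?thesis by (simp add: trB_def)
qed

lemma trB_rec:
  assumes s: "\<sigma> permutes {0..<n}"
  shows "trB i j \<sigma> = trC i j \<sigma> + trC i (j - 1) \<sigma>"
proof -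
  let ?a = "act_op n \<sigma>" let ?S = "hn * (cQ * (piP * ?a))"
  have "piP * ?a = prj * ?a + mQ * ?S"
    by (simp add: prj_def piQ_def left_diff_distrib scal_comm2 mult.assoc)
  then have "trB i j \<sigma> = trC i j \<sigma> + lop_tr (bs i j) (mQ * ?S)"
    unfolding trB_def trC_def by (metis tr_add)
  also have "lop_tr (bs i j) (mQ * ?S) = lop_tr (bs i (j - 1)) (?S * mQ)"
  proof (rule tr_cyclic)
    have "graded ?S 0 (-1)"
      by (rule graded_mult[OF graded_scal graded_mult[OF graded_cQ graded_mult[OF graded_piP graded_act[OF s]]]]) auto
    then show "app ?S f \<in> gr i (j - 1)" if "f \<in> gr i j" for f
      by (rule gradedD[OF _ that]) auto
    show "app mQ f \<in> gr i j" if "f \<in> gr i (j - 1)" for f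
      by (rule gradedD[OF graded_mQ that]) auto
  qed auto
  also have "?S * mQ = prj * ?a"
    by (simp add: prj_def piQ_alt mult.assoc act_mQ[OF s] piP_mQ[THEN mult2])
  finally show ?thesis by (simp add: trC_def)
qed

text \<open>The subtracted part of \<open>Fop\<close> factors through bidegree
  \<open>(i - 1, j - 1)\<close>; turned around by cyclicity it contains \<open>La * L * Qop\<close>,
  the identity on the common kernel there.\<close>

lemma tr_Fop:
  assumes s: "\<sigma> permutes {0..<n}" and ij: "i + j < int n"
  shows "lop_tr (bs i j) (Fop i j * act_op n \<sigma>) = trC i j \<sigma> - trC (i - 1) (j - 1) \<sigma>"
proof -
  let ?a = "act_op n \<sigma>" let ?Q = "Qop (i - 1) (j - 1)" let ?S = "La * (prj * ?a)"
  have "Fop i j * ?a = prj * ?a - (L * ?Q) * ?S"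
    by (simp add: Fop_def left_diff_distrib mult.assoc)
  then have "lop_tr (bs i j) (Fop i j * ?a) = trC i j \<sigma> - lop_tr (bs i j) ((L * ?Q) * ?S)"
    unfolding trC_def by (simp only: tr_diff)
  also have "lop_tr (bs i j) ((L * ?Q) * ?S) = lop_tr (bs (i - 1) (j - 1)) (?S * (L * ?Q))"
  proof (rule tr_cyclic)
    show "app ?S f \<in> gr (i - 1) (j - 1)" if "f \<in> gr i j" for f
      by (rule gradedD[OF graded_mult[OF graded_La graded_mult[OF graded_prj graded_act[OF s]]] that]) auto
    show "app (L * ?Q) f \<in> gr i j" if "f \<in> gr (i - 1) (j - 1)" for f
      by (rule gradedD[OF graded_mult[OF graded_L graded_Qop] that]) auto
  qed auto
  also have "\<dots> = trC (i - 1) (j - 1) \<sigma>"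
    unfolding trC_def
  proof (rule tr_cong)
    fix f assume f: "f \<in> gr (i - 1) (j - 1)"
    have "?S * (L * ?Q) = ?a * (La * (L * (?Q * prj)))"
      by (simp only: mult.assoc L_prj Qop_prj act_La[OF s] act_prj[OF s]
          L_prj[THEN mult2] act_La[OF s, THEN mult2] act_prj[OF s, THEN mult2])
    then have "app (?S * (L * ?Q)) f = app ?a (app La (app L (app ?Q (app prj f))))"
      by (simp only: times_lop.rep_eq)
    also have "app La (app L (app ?Q (app prj f))) = app prj f"
      by (rule Qop_inverse(1)[OF prj_Ks[OF f]]) (use ij in simp)
    finally show "app (?S * (L * ?Q)) f = app (prj * ?a) f"
      by (simp only: act_prj[OF s, symmetric] times_lop.rep_eq)
  qed
  finally show ?thesis .
qed

subsection \<open>Pairing the traces with a class function\<close>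

lemma bs_neg: "i < 0 \<or> j < 0 \<Longrightarrow> bs i j = {}"
  by (auto simp: bs_def)

lemma trA_asum:
  assumes s: "\<sigma> permutes {0..<n}"
  shows "trA i j \<sigma> = cf (asum n \<sigma>) i j"
proof -
  let ?t = "var_perm n \<sigma>" and ?X = "{A. A \<subseteq> {0..<2*n} \<and> var_perm n \<sigma> ` A = A}"
  have fX: "finite ?X" by (rule finite_subset[of _ "Pow {0..<2*n}"]) auto
  have "trA i j \<sigma> = (\<Sum>A\<in>bs i j. if ?t ` A = A then act_sign ?t A else 0)"
    unfolding trA_def lop_tr_def
  proof (rule sum.cong[OF refl])
    fix A assume "A \<in> bs i j"
    then have "A \<subseteq> {0..<2*n}" by (simp add: bs_def)
    from act_op_xmon[OF s this] show "app (act_op n \<sigma>) (xmon A) A = (if ?t ` A = A then act_sign ?t A else 0)"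
      by (auto simp: xmon_def)
  qed
  also have "\<dots> = (\<Sum>A\<in>{A \<in> bs i j. ?t ` A = A}. act_sign ?t A)"
    by (simp add: sum.inter_filter)
  also have "{A \<in> bs i j. ?t ` A = A} =
      {A \<in> ?X. int (card (A \<inter> {0..<n})) = i \<and> int (card (A \<inter> {n..<2*n})) = j}"
    by (auto simp: bs_def)
  also have "(\<Sum>A\<in>\<dots>. act_sign ?t A) = (\<Sum>A\<in>?X. if int (card (A \<inter> {0..<n})) = i \<and>
      int (card (A \<inter> {n..<2*n})) = j then act_sign ?t A else 0)"
    by (rule sum.inter_filter[OF fX])
  also have "\<dots> = (\<Sum>A\<in>?X. cf (const2 (act_sign ?t A) * mwt n A) i j)"
    unfolding mwt_def mult.assoc[symmetric] cf_monomial by (intro sum.cong refl) auto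
  finally show ?thesis by (simp only: asum_def cf_sum)
qed

text \<open>Both divisions are made after pairing: \<open>trA\<close> is known through
  \<open>asum\<close>, and \<open>trA_rec\<close> and \<open>trB_rec\<close> remove the factors
  \<open>1 + U\<close> and \<open>1 + V\<close>. Trivial and irreducible characters are treated
  alike.\<close>

lemma trC_pairing:
  assumes P: "(\<Sum>\<sigma> | \<sigma> permutes {0..<n}. asum n \<sigma> * const2 (\<chi> \<sigma>)) = (1 + U) * ((1 + V) * R)"
  shows "(\<Sum>\<sigma> | \<sigma> permutes {0..<n}. trC i j \<sigma> * \<chi> \<sigma>) = cf R i j"
proof -
  let ?S = "{\<sigma>. \<sigma> permutes {0..<n}}"
  define b c where "b i j = (\<Sum>\<sigma>\<in>?S. trB i j \<sigma> * \<chi> \<sigma>)" and "c i j = (\<Sum>\<sigma>\<in>?S. trC i j \<sigma> * \<chi> \<sigma>)" for i j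
  have neg: "b i j = 0" "c i j = 0" if "i < 0 \<or> j < 0" for i j
    using that by (simp_all add: b_def c_def trB_def trC_def lop_tr_def bs_neg)
  have B: "b i j = cf ((1 + V) * R) i j" for i j
  proof (rule pair_sum_unique[of "\<lambda>i. b i j" "\<lambda>i. cf ((1 + V) * R) i j"])
    fix i
    have "b i j + b (i - 1) j = (\<Sum>\<sigma>\<in>?S. trA i j \<sigma> * \<chi> \<sigma>)"
      unfolding b_def sum.distrib[symmetric] by (intro sum.cong refl) (simp add: trA_rec distrib_right)
    also have "\<dots> = (\<Sum>\<sigma>\<in>?S. cf (const2 (\<chi> \<sigma>) * asum n \<sigma>) i j)"
      by (intro sum.cong refl, simp only: mem_Collect_eq trA_asum cf_const2) (simp only: mult.commute)
    also have "\<dots> = cf ((1 + U) * ((1 + V) * R)) i j"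
      unfolding P[symmetric] cf_sum by (simp only: mult.commute)
    also have "\<dots> = cf ((1 + V) * R) i j + cf ((1 + V) * R) (i - 1) j"
      unfolding distrib_right[of 1 U] cf_add cf_U by simp
    finally show "b i j + b (i - 1) j = cf ((1 + V) * R) i j + cf ((1 + V) * R) (i - 1) j" .
  qed (simp add: neg cf_neg)
  have "c i j = cf R i j"
  proof (rule pair_sum_unique[of "\<lambda>j. c i j" "\<lambda>j. cf R i j"])
    fix j
    have "c i j + c i (j - 1) = b i j"
      unfolding b_def c_def sum.distrib[symmetric] by (intro sum.cong refl) (simp add: trB_rec distrib_right)
    also have "\<dots> = cf R i j + cf R i (j - 1)"
      unfolding B distrib_right[of 1 V] cf_add cf_V by simp
    finally show "c i j + c i (j - 1) = cf R i j + cf R i (j - 1)" .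
  qed (simp add: neg cf_neg)
  then show ?thesis by (simp add: c_def)
qed

lemma psum_coeff_trivial:
  assumes s: "\<sigma> permutes {0..<n}" shows "psum_coeff n \<sigma> 1 (\<lambda>_. int n) = 1"
proof -
  have "\<sigma> x < n" if "x < n" for x using permutes_in_image[OF s, of x] that by simp
  then have "fixed_words n \<sigma> 1 (\<lambda>_. int n) = {\<lambda>x\<in>{0..<n}. 0}"
    by (auto simp: fixed_words_def PiE_iff extensional_def fun_eq_iff)
  then show ?thesis by (simp add: psum_coeff_eq[OF s])
qed

text \<open>The trivial character pairs to \<open>hsym n\<close>, and
  \<open>(1 - U * V) * geo n\<close> telescopes to \<open>1 - (U * V) ^ n\<close>. Its terms sit in
  bidegrees \<open>(0, 0)\<close> and \<open>(n, n)\<close>, outside the range considered.\<close>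

lemma trivial_multiplicity:
  fixes i j :: nat
  assumes "i + j < n" "0 < i + j"
  shows "(\<Sum>\<sigma> | \<sigma> permutes {0..<n}. trC (int i) (int j) \<sigma> - trC (int i - 1) (int j - 1) \<sigma>) = 0"
proof -
  let ?S = "{\<sigma>. \<sigma> permutes {0..<n}}" and ?R = "fact n * geo n"
  have "(\<Sum>\<sigma>\<in>?S. asum n \<sigma> * const2 1) = (\<Sum>\<sigma>\<in>?S. asum n \<sigma> * of_nat (psum_coeff n \<sigma> 1 (\<lambda>_. int n)))"
    by (intro sum.cong refl) (simp only: mem_Collect_eq psum_coeff_trivial of_nat_1 const2_simps)
  also have "\<dots> = fact n * (\<Prod>r\<in>{0..<1::nat}. hsym (int n))"
    by (rule burnside) simp
  also have "\<dots> = (1 + U) * ((1 + V) * ?R)"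
    using hsym_pos[OF n_pos] by (simp add: mult_ac)
  finally have "(\<Sum>\<sigma>\<in>?S. trC i j \<sigma> * 1) = cf ?R i j" for i j
    by (rule trC_pairing)
  then have "(\<Sum>\<sigma>\<in>?S. trC (int i) (int j) \<sigma> - trC (int i - 1) (int j - 1) \<sigma>) =
      cf ((1 - U * V) * ?R) (int i) (int j)"
    by (simp only: sum_subtractf mult_1_right cf_one_minus)
  also have "(1 - U * V) * ?R = const2 (fact n) * (1 - U ^ n * (V ^ n * 1))"
  proof -
    have "const2 (fact n) = fact n" using const2_of_nat[of "fact n"] by (simp only: of_nat_fact)
    then show ?thesis
      using one_minus_geo[of n] by (simp add: mult.left_commute power_mult_distrib)
  qed
  also have "cf \<dots> (int i) (int j) = 0"
    using assms by (simp only: cf_const2 cf_diff cf_U_pow cf_V_pow cf_1) auto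
  finally show ?thesis .
qed

subsection \<open>The coinvariant ideal\<close>

text \<open>Sums of images of left multiplications, hence a right ideal by form;
  \<open>mul_var_Jd\<close> supplies the left side.\<close>

definition Jd :: "ext set" where
  "Jd = {app mP x + app mQ y + app om z | x y z. x \<in> ext_alg n \<and> y \<in> ext_alg n \<and> z \<in> ext_alg n}"

lemma subspace_ext: "scl.subspace (ext_alg n)"
  unfolding ext_alg_supp by (rule subspace_supp_in)

lemma ext_0: "0 \<in> ext_alg n"
  using subspace_ext by (rule scl.subspace_0)

lemma graded_ext: "graded T a b \<Longrightarrow> f \<in> ext_alg n \<Longrightarrow> app T f \<in> ext_alg n"
proof -
  assume T: "graded T a b" and f: "f \<in> ext_alg n"
  have "app T f = app T (\<Sum>x\<in>{..n} \<times> {..n}. app (res (bs (int (fst x)) (int (snd x)))) f)"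
    using res_decomp[OF f] by (simp add: split_def)
  also have "\<dots> = (\<Sum>x\<in>{..n} \<times> {..n}. app T (app (res (bs (int (fst x)) (int (snd x)))) f))"
    by (rule app_sum)
  also have "\<dots> \<in> ext_alg n"
    by (rule scl.subspace_sum[OF subspace_ext], rule bs_ext, rule gradedD[OF T res_in refl refl])
  finally show ?thesis .
qed

lemma Jd_I: "x \<in> ext_alg n \<Longrightarrow> y \<in> ext_alg n \<Longrightarrow> z \<in> ext_alg n \<Longrightarrow>
    app mP x + app mQ y + app om z \<in> Jd"
  by (auto simp: Jd_def)

lemma subspace_Jd: "scl.subspace Jd"
proof (rule scl.subspaceI)
  show "0 \<in> Jd" using Jd_I[OF ext_0 ext_0 ext_0] by simp
next
  fix f g assume "f \<in> Jd" "g \<in> Jd"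
  then obtain x y z x' y' z' where e: "x \<in> ext_alg n" "y \<in> ext_alg n" "z \<in> ext_alg n"
    "x' \<in> ext_alg n" "y' \<in> ext_alg n" "z' \<in> ext_alg n"
    "f = app mP x + app mQ y + app om z" "g = app mP x' + app mQ y' + app om z'"
    unfolding Jd_def by blast
  then have "f + g = app mP (x + x') + app mQ (y + y') + app om (z + z')"
    by (simp add: app_add add_ac)
  then show "f + g \<in> Jd" using e by (simp only:) (intro Jd_I scl.subspace_add[OF subspace_ext])
next
  fix c f assume "f \<in> Jd"
  then obtain x y z where e: "x \<in> ext_alg n" "y \<in> ext_alg n" "z \<in> ext_alg n"
    "f = app mP x + app mQ y + app om z"
    unfolding Jd_def by blast
  then have "scl c f = app mP (scl c x) + app mQ (scl c y) + app om (scl c z)"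
    by (simp add: app_scl scl.scale_right_distrib)
  then show "scl c f \<in> Jd" using e by (simp only:) (intro Jd_I scl.subspace_scale[OF subspace_ext])
qed

lemma mP_Jd: "x \<in> ext_alg n \<Longrightarrow> app mP x \<in> Jd"
  and mQ_Jd: "x \<in> ext_alg n \<Longrightarrow> app mQ x \<in> Jd"
  and om_Jd: "x \<in> ext_alg n \<Longrightarrow> app om x \<in> Jd"
  using Jd_I[of x 0 0] Jd_I[of 0 x 0] Jd_I[of 0 0 x] ext_0 by simp_all

text \<open>A variable anticommutes with \<open>p\<close> and \<open>q\<close> and commutes with
  \<open>om\<close>, so it moves past the generators.\<close>

lemma mul_var_Jd:
  assumes v: "v < 2*n" and "f \<in> Jd" shows "app (mul_var v) f \<in> Jd"
proof -
  obtain x y z where e: "x \<in> ext_alg n" "y \<in> ext_alg n" "z \<in> ext_alg n"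
    "f = app mP x + app mQ y + app om z" using assms(2) unfolding Jd_def by blast
  have "mul_var v * mP = mP * (- mul_var v)" "mul_var v * mQ = mQ * (- mul_var v)"
    unfolding mP_def mQ_def sum_distrib_left sum_distrib_right
    by (intro sum.cong refl, simp add: mul_mul[of v])+
  then have "app (mul_var v) f = app mP (- app (mul_var v) x) + app mQ (- app (mul_var v) y) + app om (app (mul_var v) z)"
    unfolding e(4) app_add by (metis mul_om times_lop.rep_eq uminus_lop.rep_eq)
  moreover have "app (mul_var v) g \<in> ext_alg n" if "g \<in> ext_alg n" for g
    by (rule graded_ext[OF graded_mul_var[OF v] that])
  ultimately show ?thesis
    using e by (simp only:) (intro Jd_I scl.subspace_neg[OF subspace_ext])
qed

lemma ext_mult_mP: "ext_mult (app mP f) g = app mP (ext_mult f g)"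
  and ext_mult_mQ: "ext_mult (app mQ f) g = app mQ (ext_mult f g)"
  and ext_mult_om: "ext_mult (app om f) g = app om (ext_mult f g)"
  unfolding mP_def mQ_def om_def by (simp_all add: app_lop_sum ext_mult_sum ext_mult_mul_var)

lemma Jd_right: "f \<in> Jd \<Longrightarrow> b \<in> ext_alg n \<Longrightarrow> ext_mult f b \<in> Jd"
  unfolding Jd_def by (force simp: ext_mult_add ext_mult_mP ext_mult_mQ ext_mult_om ext_mult_closed)

lemma Jd_ext: "f \<in> Jd \<Longrightarrow> f \<in> ext_alg n"
  unfolding Jd_def
  by (auto intro!: scl.subspace_add[OF subspace_ext] graded_ext[OF graded_mP] graded_ext[OF graded_mQ] graded_ext[OF graded_om])

lemma Jd_left: "a \<in> ext_alg n \<Longrightarrow> f \<in> Jd \<Longrightarrow> ext_mult a f \<in> Jd"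
proof -
  assume a: "a \<in> ext_alg n" and f: "f \<in> Jd"
  have mon: "ext_mult (xmon A) f \<in> Jd" if "finite A" "A \<subseteq> {0..<2*n}" for A
    using that
  proof (induction A rule: finite_induct)
    case empty
    then show ?case using f by (simp add: ext_mult_one[OF Jd_ext])
  next
    case (insert v A)
    have "ext_mult (xmon (insert v A)) f = scl (sg v A) (app (mul_var v) (ext_mult (xmon A) f))"
      by (simp only: xmon_insert[OF insert(2)] ext_mult_scl ext_mult_mul_var)
    then show ?case using insert
      by (simp only:) (intro scl.subspace_scale[OF subspace_Jd] mul_var_Jd; simp)
  qed
  have "a = (\<Sum>A\<in>Pow {0..<2*n}. scl (a A) (xmon A))"
    using a by (intro supp_in_expand) (auto simp: ext_alg_supp)
  then have "ext_mult a f = ext_mult (\<Sum>A\<in>Pow {0..<2*n}. scl (a A) (xmon A)) f"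
    by (rule arg_cong)
  also have "\<dots> = (\<Sum>A\<in>Pow {0..<2*n}. scl (a A) (ext_mult (xmon A) f))"
    by (simp only: ext_mult_sum ext_mult_scl)
  also have "\<dots> \<in> Jd"
    by (intro scl.subspace_sum[OF subspace_Jd] scl.subspace_scale[OF subspace_Jd] mon)
      (auto intro: finite_subset)
  finally show ?thesis .
qed

lemma one_ext: "xmon {} \<in> ext_alg n"
  unfolding ext_alg_supp by (rule xmon_in) simp

text \<open>\<open>T\<close> is left multiplication by \<open>app T (xmon {})\<close>, which is
  invariant because \<open>T\<close> is equivariant and \<open>xmon {}\<close> is fixed.\<close>

lemma generator_in_ideal:
  assumes inv: "\<And>\<sigma>. \<sigma> permutes {0..<n} \<Longrightarrow> act_op n \<sigma> * T = T * act_op n \<sigma>"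
    and gr: "graded T a b" and T0: "app T (xmon {}) {} = 0"
    and mult: "\<And>f g. ext_mult (app T f) g = app T (ext_mult f g)" and x: "x \<in> ext_alg n"
  shows "app T x \<in> coinv_ideal n"
proof -
  let ?p = "app T (xmon {})"
  have p: "?p \<in> ext_alg n" by (rule graded_ext[OF gr one_ext])
  have "act n \<sigma> ?p = ?p" if s: "\<sigma> permutes {0..<n}" for \<sigma>
    using inv[OF s] act_xmon_empty[OF s] by (metis act_op.rep_eq times_lop.rep_eq)
  then have "?p \<in> invariants0 n" using p T0 by (simp add: invariants0_def)
  moreover have "app T x = ext_mult (ext_mult (xmon {}) ?p) x"
    using ext_mult_one[OF p] ext_mult_one[OF x] by (simp only: mult)
  ultimately show ?thesis
    unfolding coinv_ideal_def using one_ext x by (intro scl.span_base) blast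
qed

lemma Jd_subset_ideal: "Jd \<subseteq> coinv_ideal n"
proof
  fix f assume "f \<in> Jd"
  then obtain x y z where e: "x \<in> ext_alg n" "y \<in> ext_alg n" "z \<in> ext_alg n"
    "f = app mP x + app mQ y + app om z" unfolding Jd_def by blast
  have "app mP (xmon {}) {} = 0" "app mQ (xmon {}) {} = 0" "app om (xmon {}) {} = 0"
    by (simp_all add: mP_def mQ_def om_def app_lop_sum sum_fun_eval mul_var.rep_eq)
  then have "app mP x \<in> coinv_ideal n" "app mQ y \<in> coinv_ideal n" "app om z \<in> coinv_ideal n"
    using e by (auto intro!: generator_in_ideal[OF act_mP graded_mP _ ext_mult_mP]
        generator_in_ideal[OF act_mQ graded_mQ _ ext_mult_mQ]
        generator_in_ideal[OF act_om graded_om _ ext_mult_om])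
  then show "f \<in> coinv_ideal n" unfolding e(4) coinv_ideal_def by (intro scl.span_add)
qed

lemma L_Jd: "y \<in> ext_alg n \<Longrightarrow> app L y \<in> Jd"
proof -
  assume y: "y \<in> ext_alg n"
  have "L = om - mP * (hn * mQ)" by (simp add: L_def scal_comm2)
  then have "app L y = app om y - app mP (app (hn * mQ) y)" by (simp only: minus_lop.rep_eq times_lop.rep_eq)
  then show ?thesis using y
    by (simp only:) (intro scl.subspace_diff[OF subspace_Jd] om_Jd mP_Jd
        graded_ext[OF graded_mult[OF graded_scal graded_mQ refl refl]])
qed

lemma minus_prj_Jd: "f \<in> ext_alg n \<Longrightarrow> f - app prj f \<in> Jd"
proof -
  assume f: "f \<in> ext_alg n"
  have "f - app prj f = app (1 - prj) f" by simp
  also have "\<dots> = app mP (app (hn * cP) f) + app mQ (app (hn * cQ * piP) f)"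
    by (simp only: one_minus_prj plus_lop.rep_eq times_lop.rep_eq)
  also have "\<dots> \<in> Jd"
    by (intro scl.subspace_add[OF subspace_Jd] mP_Jd mQ_Jd f
        graded_ext[OF graded_mult[OF graded_scal graded_cP refl refl]]
        graded_ext[OF graded_mult[OF graded_mult[OF graded_scal graded_cQ refl refl] graded_piP refl refl]])
  finally show ?thesis .
qed

lemma minus_Fop_Jd: "f \<in> ext_alg n \<Longrightarrow> f - app (Fop i j) f \<in> Jd"
proof -
  assume f: "f \<in> ext_alg n"
  let ?y = "app (Qop (i - 1) (j - 1) * (La * prj)) f"
  have "f - app (Fop i j) f = (f - app prj f) + app L ?y" by (simp add: Fop_def)
  also have "\<dots> \<in> Jd"
    by (intro scl.subspace_add[OF subspace_Jd] minus_prj_Jd L_Jd f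
        graded_ext[OF graded_mult[OF graded_Qop graded_mult[OF graded_La graded_prj refl refl] refl refl]])
  finally show ?thesis .
qed

lemma high_degree_Jd:
  assumes f: "f \<in> gr i j" and ij: "i + j \<ge> int n"
  shows "f \<in> Jd"
proof -
  obtain y where y: "y \<in> gr (i - 1) (j - 1)" "app prj f = app L y"
    using L_onto[OF prj_Ks[OF f]] ij by auto
  then have "app prj f \<in> Jd" using L_Jd[OF bs_ext] by simp
  then show ?thesis
    using scl.subspace_add[OF subspace_Jd minus_prj_Jd[OF bs_ext[OF f]]] by fastforce
qed

text \<open>The coefficients \<open>x\<close>, \<open>y\<close>, \<open>z\<close> may be
  inhomogeneous; taking the component of bidegree \<open>(i, j)\<close> replaces them by homogeneous
  ones, and \<open>Fop\<close> kills each of the three terms.\<close>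

lemma Fop_Jd:
  assumes f: "f \<in> gr i j" "f \<in> Jd" and ij: "i + j < int n"
  shows "app (Fop i j) f = 0"
proof -
  obtain x y z where e: "x \<in> ext_alg n" "y \<in> ext_alg n" "z \<in> ext_alg n"
    "f = app mP x + app mQ y + app om z" using f(2) unfolding Jd_def by blast
  have "f = app (res (bs i j)) f" by (rule res_id[OF f(1), symmetric])
  also have "\<dots> = app mP (app (res (bs (i - 1) (j - 0))) x) + app mQ (app (res (bs (i - 0) (j - 1))) y) +
      app om (app (res (bs (i - 1) (j - 1))) z)"
    unfolding e(4) app_add
    by (simp only: res_graded[OF graded_mP e(1)] res_graded[OF graded_mQ e(2)] res_graded[OF graded_om e(3)])
  finally have "app (Fop i j) f = app (Fop i j * mP) (app (res (bs (i - 1) (j - 0))) x) +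
      app (Fop i j * mQ) (app (res (bs (i - 0) (j - 1))) y) +
      app (Fop i j) (app om (app (res (bs (i - 1) (j - 1))) z))"
    by (metis app_add times_lop.rep_eq)
  then show ?thesis
    by (simp only: Fop_mP Fop_mQ zero_lop.rep_eq Fop_om[OF res_in ij] add_0_left)
qed

lemma Fop_idem:
  assumes f: "f \<in> gr i j" and ij: "i + j < int n"
  shows "app (Fop i j) (app (Fop i j) f) = app (Fop i j) f"
proof -
  have "app (Fop i j) g = app prj g - app L (app (Qop (i - 1) (j - 1)) (app La (app prj g)))" for g
    by (simp add: Fop_def)
  from this[of "app (Fop i j) f"] show ?thesis
    by (simp only: Fop_La[OF f ij] app_0 diff_zero)
qed

section \<open>Averaging over the symmetric group and comparison of the ideals\<close>

definition Eop :: lop where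
  "Eop = scal (1 / fact n) * (\<Sum>\<sigma> | \<sigma> permutes {0..<n}. act_op n \<sigma>)"

lemma Eop_fix:
  assumes "\<And>\<sigma>. \<sigma> permutes {0..<n} \<Longrightarrow> app (act_op n \<sigma>) f = f"
  shows "app Eop f = f"
proof
  fix A
  have "app Eop f = scl (1 / fact n) (\<Sum>\<sigma> | \<sigma> permutes {0..<n}. f)"
    unfolding Eop_def times_lop.rep_eq app_scal app_lop_sum
    by (intro arg_cong[of _ _ "scl (1 / fact n)"] sum.cong refl) (simp add: assms)
  then have "app Eop f A = 1 / fact n * (\<Sum>\<sigma> | \<sigma> permutes {0..<n}. f A)"
    by (simp only: scl_apply sum_fun_eval)
  then show "app Eop f A = f A"
    by (simp add: card_permutations[of "{0..<n}"])
qed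

lemma act_Eop:
  assumes r: "\<rho> permutes {0..<n}" and f: "f \<in> ext_alg n"
  shows "app (act_op n \<rho>) (app Eop f) = app Eop f"
proof -
  have "app (act_op n \<rho>) (\<Sum>\<sigma> | \<sigma> permutes {0..<n}. app (act_op n \<sigma>) f) =
      (\<Sum>\<sigma> | \<sigma> permutes {0..<n}. app (act_op n (\<rho> \<circ> \<sigma>)) f)"
    unfolding app_sum by (intro sum.cong refl act_comp r f) simp
  also have "\<dots> = (\<Sum>\<sigma> | \<sigma> permutes {0..<n}. app (act_op n \<sigma>) f)"
    by (rule setum_permutations_compose_left[OF r, symmetric])
  finally show ?thesis
    unfolding Eop_def times_lop.rep_eq app_scal app_lop_sum app_scl by (simp only:)
qed

lemma graded_Eop: "graded Eop 0 0"
  unfolding Eop_def by (rule graded_mult[OF graded_scal graded_sum[OF graded_act]]) auto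

lemma Eop_Fop: "Eop * Fop i j = Fop i j * Eop"
  unfolding Eop_def
  by (simp add: mult.assoc scal_comm2 sum_distrib_left sum_distrib_right act_Fop)

text \<open>A product of commuting idempotents whose trace is the multiplicity of the trivial
  representation in this bidegree of the quotient by \<open>p\<close>, \<open>q\<close> and
  \<open>om\<close>. That multiplicity is 0, hence so is the operator.\<close>

lemma Fop_Eop_0:
  assumes ij: "i + j < n" "0 < i + j" and f: "f \<in> gr (int i) (int j)"
  shows "app (Fop (int i) (int j) * Eop) f = 0"
proof (rule idempotent_tr_0[OF finite_bs _ _ _ f])
  let ?F = "Fop (int i) (int j)"
  have ij': "int i + int j < int n" using ij by simp
  have E: "app Eop g \<in> gr (int i) (int j)" if "g \<in> gr (int i) (int j)" for g
    by (rule gradedD[OF graded_Eop that]) auto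
  show "app (?F * Eop) g \<in> gr (int i) (int j)" if "g \<in> gr (int i) (int j)" for g
    unfolding times_lop.rep_eq by (rule gradedD[OF graded_Fop E[OF that]]) auto
  show "app (?F * Eop) (app (?F * Eop) g) = app (?F * Eop) g"
    if g: "g \<in> gr (int i) (int j)" for g
  proof -
    have "app Eop (app Eop g) = app Eop g"
      by (rule Eop_fix) (rule act_Eop[OF _ bs_ext[OF g]])
    then have "app Eop (app ?F (app Eop g)) = app ?F (app Eop g)"
      by (metis Eop_Fop times_lop.rep_eq)
    then show ?thesis
      unfolding times_lop.rep_eq by (simp only: Fop_idem[OF E[OF g] ij'])
  qed
  have "?F * Eop = scal (1 / fact n) * (\<Sum>\<sigma> | \<sigma> permutes {0..<n}. ?F * act_op n \<sigma>)"
    by (simp add: Eop_def scal_comm2 sum_distrib_left)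
  then have "lop_tr (bs (int i) (int j)) (?F * Eop) =
      1 / fact n * (\<Sum>\<sigma> | \<sigma> permutes {0..<n}. trC (int i) (int j) \<sigma> - trC (int i - 1) (int j - 1) \<sigma>)"
    by (simp only: tr_scal tr_sum) (simp add: tr_Fop[OF _ ij'])
  then show "lop_tr (bs (int i) (int j)) (?F * Eop) = 0"
    using trivial_multiplicity[OF ij] by simp
qed

text \<open>Bidegree by bidegree: the constant term is zero, high degrees lie in \<open>Jd\<close>,
  and in between an invariant component is fixed by \<open>Eop\<close>, so \<open>Fop\<close> kills
  it, while \<open>Fop\<close> is the identity modulo \<open>Jd\<close>.\<close>

lemma invariants0_Jd: "f \<in> invariants0 n \<Longrightarrow> f \<in> Jd"
proof -
  assume "f \<in> invariants0 n"
  then have f: "f \<in> ext_alg n" "f {} = 0" and inv: "\<And>\<sigma>. \<sigma> permutes {0..<n} \<Longrightarrow> app (act_op n \<sigma>) f = f"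
    by (auto simp: invariants0_def act_op.rep_eq)
  have "app (res (bs (int i) (int j))) f \<in> Jd" for i j
  proof -
    let ?g = "app (res (bs (int i) (int j))) f"
    consider "i + j = 0" | "i + j \<ge> n" | "0 < i + j" "i + j < n" by linarith
    then show ?thesis
    proof cases
      case 1
      have "A = {}" if "A \<in> bs 0 0" for A
      proof -
        have "A \<inter> {0..<n} = {}" "A \<inter> {n..<2*n} = {}" "A \<subseteq> {0..<2*n}"
          using that by (auto simp: bs_def)
        then show ?thesis by (force simp: not_less)
      qed
      then have "?g A = 0" for A using 1 f(2) by (auto simp: res.rep_eq)
      then have "?g = 0" by (simp add: fun_eq_iff)
      then show ?thesis using scl.subspace_0[OF subspace_Jd] by (simp only:)
    next
      case 2
      then show ?thesis by (intro high_degree_Jd[OF res_in]) simp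
    next
      case 3
      have "app (act_op n \<sigma>) ?g = ?g" if s: "\<sigma> permutes {0..<n}" for \<sigma>
        using res_graded[OF graded_act[OF s] f(1), of "int i" "int j"] inv[OF s] by simp
      then have "app Eop ?g = ?g" by (rule Eop_fix)
      then have "app (Fop (int i) (int j)) ?g = 0"
        using Fop_Eop_0[OF 3(2,1) res_in[of _ f]] by (simp only: times_lop.rep_eq)
      moreover have "?g - app (Fop (int i) (int j)) ?g \<in> Jd"
        by (rule minus_Fop_Jd[OF bs_ext[OF res_in]])
      ultimately show ?thesis by (simp only: diff_zero)
    qed
  qed
  then have "(\<Sum>(i, j)\<in>{..n} \<times> {..n}. app (res (bs (int i) (int j))) f) \<in> Jd"
    unfolding split_def by (intro scl.subspace_sum[OF subspace_Jd])
  then show ?thesis using res_decomp[OF f(1)] by (simp only: flip:)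
qed

lemma coinv_ideal_eq: "coinv_ideal n = Jd"
proof
  show "coinv_ideal n \<subseteq> Jd"
    unfolding coinv_ideal_def
  proof (rule scl.span_minimal[OF _ subspace_Jd], safe)
    fix a f b assume "a \<in> ext_alg n" "f \<in> invariants0 n" "b \<in> ext_alg n"
    then show "ext_mult (ext_mult a f) b \<in> Jd" by (intro Jd_right Jd_left invariants0_Jd)
  qed
qed (rule Jd_subset_ideal)

text \<open>\<open>quot_trace_eq_tr\<close> is applied with \<open>Fop\<close> below total degree
  \<open>n\<close> and with the zero operator from \<open>n\<close> on, where the whole component
  lies in the ideal.\<close>

lemma coinv_char_eq:
  assumes s: "\<sigma> permutes {0..<n}"
  shows "coinv_char n i j \<sigma> =
    (if i + j < n then trC (int i) (int j) \<sigma> - trC (int i - 1) (int j - 1) \<sigma> else 0)"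
proof -
  let ?W = "gr (int i) (int j)" and ?a = "act_op n \<sigma>"
  have a: "app ?a = act n \<sigma>" by (rule act_op.rep_eq)
  have aW: "app ?a f \<in> ?W" if "f \<in> ?W" for f
    by (rule gradedD[OF graded_act[OF s] that]) auto
  have sub: "scl.subspace (Jd \<inter> ?W)"
    by (rule scl.subspace_inter[OF subspace_Jd subspace_supp_in])
  have aU: "app ?a f \<in> Jd \<inter> ?W" if "f \<in> Jd \<inter> ?W" for f
  proof -
    obtain x y z where e: "x \<in> ext_alg n" "y \<in> ext_alg n" "z \<in> ext_alg n"
      "f = app mP x + app mQ y + app om z" using \<open>f \<in> Jd \<inter> ?W\<close> unfolding Jd_def by blast
    have "app ?a f = app mP (app ?a x) + app mQ (app ?a y) + app om (app ?a z)"
      unfolding e(4) app_add by (metis act_mP[OF s] act_mQ[OF s] act_om[OF s] times_lop.rep_eq)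
    then have "app ?a f \<in> Jd" using e
      by (simp only:) (intro Jd_I graded_ext[OF graded_act[OF s]])
    then show ?thesis using aW that by blast
  qed
  show ?thesis
  proof (cases "i + j < n")
    case True
    then have ij: "int i + int j < int n" by simp
    have "quot_trace ?W (Jd \<inter> ?W) (app ?a) = lop_tr (bs (int i) (int j)) (Fop (int i) (int j) * ?a)"
    proof (rule quot_trace_eq_tr[OF finite_bs _ aW sub _ aU])
      show F: "app (Fop (int i) (int j)) f \<in> ?W" if "f \<in> ?W" for f
        by (rule gradedD[OF graded_Fop that]) auto
      show "app (Fop (int i) (int j)) f = 0" if "f \<in> Jd \<inter> ?W" for f
        using that by (intro Fop_Jd ij) auto
      show "f - app (Fop (int i) (int j)) f \<in> Jd \<inter> ?W" if "f \<in> ?W" for f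
        using that F[OF that] by (simp add: minus_Fop_Jd[OF bs_ext[OF that]] supp_in_diff)
    qed auto
    then show ?thesis
      using True by (simp add: coinv_char_def coinv_ideal_eq bideg_bs a tr_Fop[OF s ij])
  next
    case False
    have "quot_trace ?W (Jd \<inter> ?W) (app ?a) = lop_tr (bs (int i) (int j)) (0 * ?a)"
    proof (rule quot_trace_eq_tr[OF finite_bs _ aW sub _ aU])
      show "f - app 0 f \<in> Jd \<inter> ?W" if "f \<in> ?W" for f
        using that False by (simp add: high_degree_Jd[OF that])
    qed (auto simp: supp_in_0)
    then show ?thesis
      using False by (simp add: coinv_char_def coinv_ideal_eq bideg_bs a) (simp add: lop_tr_def)
  qed
qed

text \<open>\<open>R\<close> describes the quotient by \<open>p\<close> and \<open>q\<close>; the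
  factor \<open>1 - U * V\<close> is the difference of the two traces in
  \<open>coinv_char_eq\<close>.\<close>

theorem coinv_mult_eq:
  assumes lam: "sum_list lam = n" and J: "jt lam = (1 + U) * ((1 + V) * R)"
  shows "coinv_mult n lam i j = (if i + j < n then cf ((1 - U * V) * R) (int i) (int j) else 0)"
proof -
  let ?S = "{\<sigma>. \<sigma> permutes {0..<n}}"
  have f: "const2 (fact n) = fact n" using const2_of_nat[of "fact n"] by (simp only: of_nat_fact)
  have "(\<Sum>\<sigma>\<in>?S. asum n \<sigma> * const2 (irr_char lam n \<sigma>)) = (1 + U) * ((1 + V) * (const2 (fact n) * R))"
    unfolding irr_char_pairing[OF lam] J f by (simp only: mult_ac)
  from trC_pairing[OF this]
  have C: "(\<Sum>\<sigma>\<in>?S. trC i j \<sigma> * irr_char lam n \<sigma>) = fact n * cf R i j" for i j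
    by (simp only: cf_const2)
  have "(\<Sum>\<sigma>\<in>?S. coinv_char n i j \<sigma> * irr_char lam n \<sigma>) =
      (\<Sum>\<sigma>\<in>?S. if i + j < n then trC (int i) (int j) \<sigma> * irr_char lam n \<sigma> -
        trC (int i - 1) (int j - 1) \<sigma> * irr_char lam n \<sigma> else 0)"
    by (intro sum.cong refl) (simp add: coinv_char_eq left_diff_distrib)
  also have "\<dots> = (if i + j < n then fact n * cf ((1 - U * V) * R) (int i) (int j) else 0)"
    unfolding cf_one_minus[symmetric] by (simp add: sum_subtractf C right_diff_distrib)
  finally show ?thesis by (simp add: coinv_mult_def)
qed

end

section \<open>Homogeneous components\<close>

definition homog :: "int \<Rightarrow> rat poly poly \<Rightarrow> bool" where
  "homog d P \<longleftrightarrow> (\<forall>i j. cf P i j \<noteq> 0 \<longrightarrow> i + j = d)"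

lemma homog_U_pow: "homog d P \<Longrightarrow> homog (d + int a) (U ^ a * P)"
  and homog_V_pow: "homog d P \<Longrightarrow> homog (d + int a) (V ^ a * P)"
  unfolding homog_def cf_U_pow cf_V_pow by force+

lemma homog_UV_pow: "homog d P \<Longrightarrow> homog (d + 2 * int a) ((U * V) ^ a * P)"
proof -
  assume "homog d P"
  from homog_U_pow[OF homog_V_pow[OF this]] have "homog (d + int a + int a) (U ^ a * (V ^ a * P))" .
  moreover have "d + int a + int a = d + 2 * int a" by simp
  ultimately show "homog (d + 2 * int a) ((U * V) ^ a * P)"
    by (simp only: power_mult_distrib mult.assoc)
qed

lemma homog_sum: "(\<And>x. x \<in> S \<Longrightarrow> homog d (f x)) \<Longrightarrow> homog d (\<Sum>x\<in>S. f x)"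
  unfolding homog_def cf_sum by (blast elim: sum.not_neutral_contains_not_neutral)

lemma homog_qint: "homog (int k) (qint (int k + 1))"
  unfolding qint_def
proof (rule homog_sum)
  fix a assume a: "a \<in> {0..<nat (int k + 1)}"
  let ?b = "nat (int k + 1) - 1 - a"
  have "homog 0 1" by (simp add: homog_def cf_1)
  from homog_U_pow[OF homog_V_pow[OF this]] have "homog (0 + int ?b + int a) (U ^ a * (V ^ ?b * 1))" .
  moreover have "0 + int ?b + int a = int k" using a by auto
  ultimately show "homog (int k) (U ^ a * V ^ ?b)" by (simp only: mult_1_right)
qed

theorem theorem5p2:
  fixes n l1 l2 l :: nat
  assumes "n \<ge> 1" and "l1 \<ge> l2" and "l2 \<ge> 2"
    and "2 * l + l1 + l2 \<le> n"
  defines "lam \<equiv> [l1, l2] @ replicate l 2 @ replicate (n - 2 * l - l1 - l2) 1"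
    and "m \<equiv> int n - 2 * int l - int l1 - int l2 + 2"
  shows "(l1 = l2 \<longrightarrow> frob_coeff n lam =
            (U * V) ^ (l + l2 - 1) * (U * V * qint (m - 2) + qint m + qint (m - 1)))
       \<and> (l1 > l2 \<longrightarrow> frob_coeff n lam =
            (U * V) ^ (l + l2 - 1) *
              (U * V * qint (m - 1) + U * V * qint (m - 2) + qint m + qint (m - 1)))"
proof -
  interpret fermions n by unfold_locales (use assms in simp)
  define j where "j = n - 2 * l - l1 - l2"
  define d where "d = l1 - l2"
  \<comment> \<open>Degree of \<open>B\<close>: each factor \<open>U * V\<close> counts 2 and
    \<open>qint (int j + 1)\<close> has degree \<open>j\<close>. In terms of \<open>n\<close> this
    is \<open>n - d - 2\<close>.\<close>
  define N where "N = 2 * int (l + l2 - 1) + int j"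
  have n: "n = 2 * l + l1 + l2 + j" and m: "m = int j + 2" and N: "N = int n - int d - 2"
    using assms by (auto simp: j_def m_def d_def N_def)
  define B where "B = (U * V) ^ (l + l2 - 1) * qint (int j + 1)"
  \<comment> \<open>Of the two factors \<open>(1 + U) (1 + V)\<close> in
    \<open>jt_double_hook\<close> one is divided out and the other stays in
    \<open>R\<close>.\<close>
  define R where "R = (1 + U) * ((1 + V) * (geo (d + 1) * B))"
  have homB: "homog N B"
    using homog_UV_pow[OF homog_qint] by (simp add: B_def N_def add.commute)
  have "sum_list lam = n" by (simp add: lam_def n sum_list_replicate)
  moreover have "jt lam = (1 + U) * ((1 + V) * R)"
  proof -
    have pw: "(U * V) ^ (l + l2 - 1) = (U * V) ^ (l2 - 1) * (U * V) ^ l"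
      using assms by (simp flip: power_add add: add.commute)
    show ?thesis
      unfolding lam_def j_def[symmetric] jt_double_hook[OF assms(2,3)] R_def B_def d_def pw
      by (simp only: power2_eq_square mult_ac)
  qed
  ultimately have mult: "coinv_mult n lam i k = (if i + k < n then cf ((1 - U * V) * R) (int i) (int k) else 0)" for i k
    by (rule coinv_mult_eq)
  have frob: "cf (frob_coeff n lam) i k = (if i + k < int n then cf ((1 - U * V) * R) i k else 0)" for i k
  proof -
    have "cf (frob_coeff n lam) i k =
        (\<Sum>a\<le>n. \<Sum>b\<le>n. if i = int a \<and> k = int b then coinv_mult n lam a b else 0)"
      by (simp only: frob_coeff_def cf_sum cf_monomial)
    also have "\<dots> = (if i + k < int n then cf ((1 - U * V) * R) i k else 0)"
    proof (cases "0 \<le> i \<and> 0 \<le> k")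
      case True
      then obtain a b where ab: "i = int a" "k = int b" by (metis nonneg_int_cases)
      have "(\<Sum>a'\<le>n. \<Sum>b'\<le>n. if i = int a' \<and> k = int b' then coinv_mult n lam a' b' else 0) =
          (\<Sum>a'\<le>n. if a' = a then \<Sum>b'\<le>n. if b' = b then coinv_mult n lam a b else 0 else 0)"
        by (intro sum.cong refl) (auto simp: ab intro!: sum.cong)
      \<comment> \<open>If \<open>a + b < n\<close>, both indices lie in the range of summation;
        otherwise the multiplicity is 0.\<close>
      then show ?thesis by (auto simp: ab mult)
    next
      case False
      then show ?thesis by (auto simp: cf_neg intro!: sum.neutral)
    qed
    finally show ?thesis .
  qed
  have "(1 - U * V) * R = (1 + U) * ((1 + V) * ((1 - (U * V) ^ (d + 1)) * B))"
    unfolding one_minus_geo[of "d + 1", symmetric] R_def by (simp only: mult_ac)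
  \<comment> \<open>The subtracted terms have degree at least
    \<open>N + 2 * (d + 1) = n + d\<close>, beyond the cut at \<open>n\<close>.\<close>
  then have Q: "(1 - U * V) * R = (B + U * B + V * B + U * V * B) -
      (U * V) ^ (d + 1) * (B + U * B + V * B + U * V * B)"
    by (simp add: algebra_simps)
  have cfB: "cf B a b = 0" if "a + b \<noteq> N" for a b
    using homB that by (auto simp: homog_def)
  have cfQ: "cf ((1 - U * V) * R) a b = cf (B + U * B + V * B + U * V * B) a b" if "a + b < int n" for a b
  proof -
    have "cf (U ^ (d + 1) * (V ^ (d + 1) * (B + U * B + V * B + U * (V * B)))) a b = 0"
      unfolding cf_U_pow cf_V_pow cf_add cf_U cf_V using that N by (simp add: cfB)
    then show ?thesis unfolding Q cf_diff power_mult_distrib by (simp only: mult.assoc)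
  qed
  \<comment> \<open>The recurrence of \<open>qint\<close>; \<open>j = 0\<close> is separate because
    there \<open>qint (m - 2)\<close> is zero by convention.\<close>
  have q: "U * V * qint (m - 2) + qint m = (U + V) * qint (int j + 1)"
  proof (cases j)
    case 0
    then show ?thesis by (simp add: m qint_def numeral_2_eq_2 atLeast0LessThan)
  next
    case (Suc k)
    then show ?thesis using qint_rec[of k] by (simp add: m algebra_simps)
  qed
  \<comment> \<open>Here \<open>N = n - 2\<close>: the terms \<open>U * B\<close> and
    \<open>V * B\<close> have degree \<open>n - 1\<close> and stay, \<open>U * V * B\<close> has
    degree \<open>n\<close> and is cut off.\<close>
  have eq0: "frob_coeff n lam = B + U * B + V * B" if "l1 = l2"
  proof (rule cf_eqI)
    fix a b
    have d: "d = 0" using that by (simp add: d_def)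
    show "cf (frob_coeff n lam) a b = cf (B + U * B + V * B) a b"
    proof (cases "a + b < int n")
      case True
      then have "cf (U * V * B) a b = 0" unfolding mult.assoc cf_U cf_V using N d by (simp add: cfB)
      then show ?thesis using True by (simp add: frob cfQ cf_add)
    next
      case False
      then show ?thesis using N d by (simp add: frob cf_add cf_U cf_V cfB)
    qed
  qed
  \<comment> \<open>Now \<open>U * V * B\<close> has degree \<open>n - d\<close>, which is below
    \<open>n\<close>, so all four terms stay.\<close>
  have eq1: "frob_coeff n lam = B + U * B + V * B + U * V * B" if "l1 > l2"
  proof (rule cf_eqI)
    fix a b
    have d: "d \<ge> 1" using that by (simp add: d_def)
    show "cf (frob_coeff n lam) a b = cf (B + U * B + V * B + U * V * B) a b"
    proof (cases "a + b < int n")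
      case True
      then show ?thesis by (simp add: frob cfQ)
    next
      case False
      then show ?thesis using N d unfolding mult.assoc by (simp add: frob cf_add cf_U cf_V cfB)
    qed
  qed
  have m1: "m - 1 = int j + 1" using m by simp
  show ?thesis
  proof (intro conjI impI)
    assume "l1 = l2"
    have "(U * V) ^ (l + l2 - 1) * (U * V * qint (m - 2) + qint m + qint (m - 1)) = B + U * B + V * B"
      unfolding q m1 B_def by (simp only: algebra_simps)
    then show "frob_coeff n lam = (U * V) ^ (l + l2 - 1) * (U * V * qint (m - 2) + qint m + qint (m - 1))"
      using eq0[OF \<open>l1 = l2\<close>] by simp
  next
    assume "l1 > l2"
    have "(U * V) ^ (l + l2 - 1) * (U * V * qint (m - 1) + (U * V * qint (m - 2) + qint m) + qint (m - 1)) =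
        B + U * B + V * B + U * V * B"
      unfolding q m1 B_def by (simp only: algebra_simps)
    then show "frob_coeff n lam = (U * V) ^ (l + l2 - 1) *
        (U * V * qint (m - 1) + U * V * qint (m - 2) + qint m + qint (m - 1))"
      using eq1[OF \<open>l1 > l2\<close>] by (simp only: add.assoc)
  qed
qed

end
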